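(* Let $(G,g_i,\chi_i;i\in J)$ and $(G',g'_i,\chi'_i;i\in J')$ be two element systems with characters (ESC's) over the field $k$. Then the following statements are equivalent: (i) $\mathrm{ESC}(G,g_i,\chi_i;i\in J)\cong\mathrm{ESC}(G',g'_i,\chi'_i;i\in J')$. (ii) $\mathrm{CRSC}(G,r(G,g_i,\chi_i;i\in J),\overrightarrow\chi(G,g_i,\chi_i;i\in J),u)\cong\mathrm{CRSC}(G',r'(G',g'_i,\chi'_i;i\in J'),\overrightarrow{\chi'}(G',g'_i,\chi'_i;i\in J'),u')$. (iii) There is a Hopf algebra isomorphism $\phi:kG\to kG'$ such that $V(G,g_i,\chi_i;i\in J)\cong{}_{\phi}^{\phi^{-1}}V'(G',g'_i,\chi'_i;i\in J')$ as Yetter-Drinfeld $kG$-modules. (iv) There is a Hopf algebra isomorphism $\phi:kG\to kG'$ such that $\mathcal B(V(G,g_i,\chi_i;i\in J))\cong{}_{\phi}^{\phi^{-1}}\mathcal B(V'(G',g'_i,\chi'_i;i\in J'))$ as graded braided Hopf algebras in ${}^{kG}_{kG}\mathcal{YD}$. (v) There is a Hopf algebra isomorphism $\phi:kG\to kG'$ such that $(kQ_1^1,ad(G,g_i,\chi_i;i\in J))\cong{}_{\phi}^{\phi^{-1}}(k{Q'}_1^1,ad(G',g'_i,\chi'_i;i\in J'))$ as Yetter-Drinfeld $kG$-modules. (vi) $kG[kQ_1^c,G,g_i,\chi_i;i\in J]\cong kG'[k{Q'_1}^c,G',g'_i,\chi'_i;i\in J']$ as graded Hopf algebras.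
   Context: $k$ is a field; $\widehat G$ is the set of group homomorphisms $G\to k^\times$; $Z(G)$ is the center of $G$. ESC: an element system with characters $(G,g_i,\chi_i;i\in J)$ consists of a group $G$, a set $J$, elements $g_i\in Z(G)$ and characters $\chi_i\in\widehat G$ ($i\in J$). Two ESC's $(G,g_i,\chi_i;i\in J)$, $(G',g'_i,\chi'_i;i\in J')$ are isomorphic if there are a group isomorphism $\phi:G\to G'$ and a bijection $\sigma:J\to J'$ with $\phi(g_i)=g'_{\sigma(i)}$ and $\chi'_{\sigma(i)}\phi=\chi_i$ for all $i\in J$. RSC and CRSC: $\mathcal K(G)$ is the set of conjugacy classes. A ramification is a formal sum $r=\sum_{C\in\mathcal K(G)}r_CC$ with cardinal coefficients; $I_C(r)$ is a fixed set of cardinality $r_C$; $\mathcal K_r(G)=\{C:r_C\ne0\}$. A ramification system with characters (RSC) $(G,r,\overrightarrow\chi,u)$ consists of a ramification $r$ of $G$, a map $u:\mathcal K(G)\to G$ with $u(C)\in C$, and characters $\chi_C^{(i)}\in\widehat{Z_{u(C)}}$ for $C\in\mathcal K_r(G)$, $i\in I_C(r)$, where $Z_{u(C)}$ is the centralizer of $u(C)$. It is a CRSC (central) if every $C\in\mathcal K_r(G)$ is a singleton. RSC's $(G,r,\overrightarrow\chi,u)$ and $(G',r',\overrightarrow{\chi'},u')$ are isomorphic if there is a group isomorphism $\phi:G\to G'$, for each $C\in\mathcal K(G)$ an $h_C\in G$ with $\phi(h_C^{-1}u(C)h_C)=u'(\phi(C))$, and for each $C\in\mathcal K(G)$ a bijection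 $\phi_C:I_C(r)\to I_{\phi(C)}(r')$ with ${\chi'}^{(\phi_C(i))}_{\phi(C)}(\phi(h_C^{-1}hh_C))=\chi^{(i)}_C(h)$ for all $h\in Z_{u(C)}$, $i\in I_C(r)$. CRSC of an ESC: on $J$ put $i\sim j\iff g_i=g_j$, with classes $[i]$ and a set $\bar J\subseteq J$ of representatives. Set $r(G,g_i,\chi_i;i\in J)=\sum_{i\in\bar J}|[i]|\{g_i\}$ with $I_{\{g_i\}}(r)=[i]$, and $\overrightarrow\chi(G,g_i,\chi_i;i\in J)=\{\chi^{(j)}_{\{g_i\}}\}$ with $\chi_{\{g_i\}}^{(j)}:=\chi_j$ for $i\in\bar J$, $j\in[i]$; $u$ is any map with $u(C)\in C$. $V(G,g_i,\chi_i;i\in J)$ is the (left-left) Yetter-Drinfeld $kG$-module with basis $\{x_i\mid i\in J\}$, $g\cdot x_i=\chi_i(g)x_i$, $\delta^-(x_i)=g_i\otimes x_i$; $V'(G',g'_i,\chi'_i;i\in J')$ is the same construction over $G'$. $\mathcal B(V)$ is the Nichols algebra of $V$. For a Hopf algebra isomorphism $\phi:kG\to kG'$ and an object $X'$ over $kG'$, ${}_\phi^{\phi^{-1}}X'$ is $X'$ with $kG$-action pulled back along $\phi$ and coaction pushed out along $\phi^{-1}$. Arrow bimodule of an ESC: $Q$ is the quiver with vertex set $G$ and arrows $a^{(i)}_{g_ix,x}$ from $x$ to $g_ix$ ($x\in G$, $i\in J$). $(kQ_1^c,G,g_i,\chi_i;i\in J)$ is the $kG$-Hopf bimodule $kQ_1$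 with $\delta^-(a)=t(a)\otimes a$, $\delta^+(a)=a\otimes s(a)$ ($s,t$ start and end vertex), $h\cdot a^{(i)}_{y,x}=a^{(i)}_{hy,hx}$, $a^{(i)}_{y,x}\cdot h=\chi_i(h)a^{(i)}_{yh,xh}$. $(kQ_1^1,ad(G,g_i,\chi_i;i\in J))$ is the Yetter-Drinfeld $kG$-module spanned by the arrows starting at $1$, with action $g\rhd x=g\cdot x\cdot g^{-1}$ and coaction $\delta^-$. The multiple Taft algebra $kG[kQ_1^c,G,g_i,\chi_i;i\in J]$ is the subalgebra (a graded Hopf subalgebra) generated by $kG$ and $M=kQ_1$ in the cotensor coalgebra $T^c_{kG}(M)$, which is a graded Hopf algebra with multiplication the coalgebra map with degree $0$ component $\mu_{kG}(\pi_0\otimes\pi_0)$ and degree $1$ component given by $\alpha^-(\pi_0\otimes\pi_1)+\alpha^+(\pi_1\otimes\pi_0)$, with $\alpha^\mp$ the left/right actions on $M$ and $\pi_i$ the projection to degree $i$. *)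

theory Defs
  imports Complex_Main "HOL-Library.Poly_Mapping" "HOL-Algebra.Group"
begin

unbundle cardinal_syntax

section \<open>Linear algebra over free vector spaces\<close>

text \<open>
  A vector space is a linear subspace of the free vector space on some type of basis elements.
  Up to isomorphism this is no restriction, and it makes tensor products explicit: for subspaces
  \<open>A\<close> and \<open>B\<close> of the free spaces on \<open>'a\<close> and \<open>'b\<close>, the tensor product is the span of the
  pure tensors in the free space on \<open>'a \<times> 'b\<close>.

  Linear maps between subspaces are given by linear maps of the ambient free spaces (every linear
  map on a subspace extends), and structure maps such as actions and coactions are likewise
  (bi)linear on the ambient spaces. Hence a tensor product of maps can be computed on basis vectors
  of the ambient spaces.
\<close>

type_synonym ('b, 'k) vec = "'b \<Rightarrow>\<^sub>0 'k"

definition vscale :: "'k::field \<Rightarrow> ('b, 'k) vec \<Rightarrow> ('b, 'k) vec" where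
  "vscale c v = Poly_Mapping.map ((*) c) v"

lemma lookup_vscale: "Poly_Mapping.lookup (vscale c v) b = c * Poly_Mapping.lookup v b"
  unfolding vscale_def by (auto simp: Poly_Mapping.map.rep_eq when_def)

global_interpretation pm: vector_space "vscale :: 'k::field \<Rightarrow> ('b, 'k) vec \<Rightarrow> ('b, 'k) vec"
  by unfold_locales
    (auto intro!: poly_mapping_eqI simp: lookup_vscale lookup_add distrib_left distrib_right)

abbreviation lin :: "(('b, 'k::field) vec \<Rightarrow> ('c, 'k) vec) \<Rightarrow> bool" where
  "lin f \<equiv> Vector_Spaces.linear vscale vscale f"

definition bvec :: "'b \<Rightarrow> ('b, 'k::field) vec" where
  "bvec b = Poly_Mapping.single b 1"

definition coord_space :: "'b set \<Rightarrow> ('b, 'k::field) vec set" where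
  "coord_space S = {v. Poly_Mapping.keys v \<subseteq> S}"

definition lin_ext :: "('b \<Rightarrow> ('c, 'k::field) vec) \<Rightarrow> ('b, 'k) vec \<Rightarrow> ('c, 'k) vec" where
  "lin_ext f v = (\<Sum>b\<in>Poly_Mapping.keys v. vscale (Poly_Mapping.lookup v b) (f b))"

definition bilin_ext ::
  "('a \<Rightarrow> 'b \<Rightarrow> ('c, 'k::field) vec) \<Rightarrow> ('a, 'k) vec \<Rightarrow> ('b, 'k) vec \<Rightarrow> ('c, 'k) vec" where
  "bilin_ext f v w = lin_ext (\<lambda>a. lin_ext (f a) w) v"

definition bilin :: "(('a, 'k::field) vec \<Rightarrow> ('b, 'k) vec \<Rightarrow> ('c, 'k) vec) \<Rightarrow> bool" where
  "bilin m \<longleftrightarrow> (\<forall>x. lin (m x)) \<and> (\<forall>y. lin (\<lambda>x. m x y))"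

definition tensor :: "('a, 'k::field) vec \<Rightarrow> ('b, 'k) vec \<Rightarrow> ('a \<times> 'b, 'k) vec" where
  "tensor = bilin_ext (\<lambda>a b. bvec (a, b))"

definition tensor_space ::
  "('a, 'k::field) vec set \<Rightarrow> ('b, 'k) vec set \<Rightarrow> ('a \<times> 'b, 'k) vec set" where
  "tensor_space A B = pm.span {tensor x y | x y. x \<in> A \<and> y \<in> B}"

definition tensor_map ::
  "(('a, 'k::field) vec \<Rightarrow> ('c, 'k) vec) \<Rightarrow> (('b, 'k) vec \<Rightarrow> ('d, 'k) vec) \<Rightarrow>
   ('a \<times> 'b, 'k) vec \<Rightarrow> ('c \<times> 'd, 'k) vec" where
  "tensor_map f g = lin_ext (\<lambda>(a, b). tensor (f (bvec a)) (g (bvec b)))"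

text \<open>\<open>(m \<otimes> m) \<circ> (id \<otimes> flip \<otimes> id)\<close>, applied to \<open>s \<otimes> t\<close>.\<close>

definition tensor_mult ::
  "(('b, 'k::field) vec \<Rightarrow> ('b, 'k) vec \<Rightarrow> ('b, 'k) vec) \<Rightarrow>
   ('b \<times> 'b, 'k) vec \<Rightarrow> ('b \<times> 'b, 'k) vec \<Rightarrow> ('b \<times> 'b, 'k) vec" where
  "tensor_mult m = bilin_ext (\<lambda>(a, b) (c, d). tensor (m (bvec a) (bvec c)) (m (bvec b) (bvec d)))"

text \<open>Tensor powers of a subspace live in the free space on words.\<close>

definition vcons :: "('b, 'k::field) vec \<Rightarrow> ('b list, 'k) vec \<Rightarrow> ('b list, 'k) vec" where
  "vcons = bilin_ext (\<lambda>b w. bvec (b # w))"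

primrec tpow :: "('b, 'k::field) vec set \<Rightarrow> nat \<Rightarrow> ('b list, 'k) vec set" where
  "tpow W 0 = pm.span {bvec []}"
| "tpow W (Suc n) = pm.span {vcons v t | v t. v \<in> W \<and> t \<in> tpow W n}"

text \<open>
  A model of the quotient \<open>A / N\<close> inside \<open>A\<close>: the map below is a linear projection of \<open>A\<close> along
  \<open>N\<close> onto some linear complement of \<open>N\<close>, which serves as the quotient space.
\<close>

definition quot_proj ::
  "('b, 'k::field) vec set \<Rightarrow> ('b, 'k) vec set \<Rightarrow> ('b, 'k) vec \<Rightarrow> ('b, 'k) vec" where
  "quot_proj A N = (SOME p. lin p \<and> (\<forall>x\<in>A. p x \<in> A \<and> x - p x \<in> N) \<and> (\<forall>x\<in>N. p x = 0))"


section \<open>Hopf algebras and Yetter-Drinfeld modules\<close>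

text \<open>
  Antipodes are not part of the data: an antipode is unique if it exists, and every bialgebra
  isomorphism of Hopf algebras commutes with the antipodes.
\<close>

record (overloaded) ('b, 'k) bialg =
  bspace :: "('b, 'k::field) vec set"
  bmult :: "('b, 'k) vec \<Rightarrow> ('b, 'k) vec \<Rightarrow> ('b, 'k) vec"
  bone :: "('b, 'k) vec"
  bcomult :: "('b, 'k) vec \<Rightarrow> ('b \<times> 'b, 'k) vec"
  bcounit :: "('b, 'k) vec \<Rightarrow> 'k"

record (overloaded) ('b, 'k) graded_bialg = "('b, 'k::field) bialg" +
  bdeg :: "nat \<Rightarrow> ('b, 'k) vec set"

text \<open>Left-left Yetter-Drinfeld modules over a Hopf algebra with basis type \<open>'h\<close>.\<close>

record (overloaded) ('h, 'b, 'k) yd_mod =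
  yspace :: "('b, 'k::field) vec set"
  yact :: "('h, 'k) vec \<Rightarrow> ('b, 'k) vec \<Rightarrow> ('b, 'k) vec"
  ycoact :: "('b, 'k) vec \<Rightarrow> ('h \<times> 'b, 'k) vec"

record (overloaded) ('b, 'k, 'h) braided = "('b, 'k::field) graded_bialg" +
  hact :: "('h, 'k) vec \<Rightarrow> ('b, 'k) vec \<Rightarrow> ('b, 'k) vec"
  hcoact :: "('b, 'k) vec \<Rightarrow> ('h \<times> 'b, 'k) vec"

definition yd_of :: "('b, 'k::field, 'h) braided \<Rightarrow> ('h, 'b, 'k) yd_mod" where
  "yd_of B = \<lparr>yspace = bspace B, yact = hact B, ycoact = hcoact B\<rparr>"

definition hopf_iso ::
  "('b, 'k::field, 'z) bialg_scheme \<Rightarrow> ('c, 'k, 'y) bialg_scheme \<Rightarrow>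
   (('b, 'k) vec \<Rightarrow> ('c, 'k) vec) \<Rightarrow> bool" where
  "hopf_iso A B f \<longleftrightarrow> lin f \<and> bij_betw f (bspace A) (bspace B) \<and>
     (\<forall>x\<in>bspace A. \<forall>y\<in>bspace A. f (bmult A x y) = bmult B (f x) (f y)) \<and>
     f (bone A) = bone B \<and>
     (\<forall>x\<in>bspace A. bcomult B (f x) = tensor_map f f (bcomult A x)) \<and>
     (\<forall>x\<in>bspace A. bcounit B (f x) = bcounit A x)"

definition graded_hopf_iso ::
  "('b, 'k::field, 'z) graded_bialg_scheme \<Rightarrow> ('c, 'k, 'y) graded_bialg_scheme \<Rightarrow>
   (('b, 'k) vec \<Rightarrow> ('c, 'k) vec) \<Rightarrow> bool" where
  "graded_hopf_iso A B f \<longleftrightarrow> hopf_iso A B f \<and> (\<forall>n. f ` bdeg A n = bdeg B n)"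

definition yd_iso ::
  "('h, 'k::field, 'z) bialg_scheme \<Rightarrow> ('h, 'b, 'k) yd_mod \<Rightarrow> ('h, 'c, 'k) yd_mod \<Rightarrow>
   (('b, 'k) vec \<Rightarrow> ('c, 'k) vec) \<Rightarrow> bool" where
  "yd_iso H X Y f \<longleftrightarrow> lin f \<and> bij_betw f (yspace X) (yspace Y) \<and>
     (\<forall>h\<in>bspace H. \<forall>x\<in>yspace X. f (yact X h x) = yact Y h (f x)) \<and>
     (\<forall>x\<in>yspace X. ycoact Y (f x) = tensor_map id f (ycoact X x))"

definition graded_hopf_isomorphic ::
  "('b, 'k::field) graded_bialg \<Rightarrow> ('c, 'k) graded_bialg \<Rightarrow> bool" where
  "graded_hopf_isomorphic A B \<longleftrightarrow> (\<exists>f. graded_hopf_iso A B f)"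

definition yd_isomorphic ::
  "('h, 'k::field, 'z) bialg_scheme \<Rightarrow> ('h, 'b, 'k) yd_mod \<Rightarrow> ('h, 'c, 'k) yd_mod \<Rightarrow> bool" where
  "yd_isomorphic H X Y \<longleftrightarrow> (\<exists>f. yd_iso H X Y f)"

definition braided_isomorphic ::
  "('h, 'k::field, 'z) bialg_scheme \<Rightarrow> ('b, 'k, 'h) braided \<Rightarrow> ('c, 'k, 'h) braided \<Rightarrow> bool" where
  "braided_isomorphic H X Y \<longleftrightarrow> (\<exists>f. graded_hopf_iso X Y f \<and> yd_iso H (yd_of X) (yd_of Y) f)"

text \<open>
  Change of Hopf algebra along an isomorphism \<open>\<phi>\<close> from \<open>H\<close>: the action is pulled back along \<open>\<phi>\<close>
  and the coaction is pushed out along its inverse. The inverse is the linear inverse on the image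
  of \<open>H\<close> only, so here the target Hopf algebra has to contain the basis vectors that occur in
  coactions, as a group algebra does.
\<close>

definition yd_twist ::
  "('h, 'k::field, 'z) bialg_scheme \<Rightarrow> (('h, 'k) vec \<Rightarrow> ('i, 'k) vec) \<Rightarrow>
   ('i, 'b, 'k) yd_mod \<Rightarrow> ('h, 'b, 'k) yd_mod" where
  "yd_twist H \<phi> X =
     \<lparr>yspace = yspace X,
      yact = (\<lambda>h. yact X (\<phi> h)),
      ycoact = (\<lambda>x. tensor_map (inv_into (bspace H) \<phi>) id (ycoact X x))\<rparr>"

definition braided_twist ::
  "('h, 'k::field, 'z) bialg_scheme \<Rightarrow> (('h, 'k) vec \<Rightarrow> ('i, 'k) vec) \<Rightarrow>
   ('b, 'k, 'i) braided \<Rightarrow> ('b, 'k, 'h) braided" where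
  "braided_twist H \<phi> X =
     \<lparr>bspace = bspace X, bmult = bmult X, bone = bone X, bcomult = bcomult X, bcounit = bcounit X,
      bdeg = bdeg X,
      hact = yact (yd_twist H \<phi> (yd_of X)),
      hcoact = ycoact (yd_twist H \<phi> (yd_of X))\<rparr>"


section \<open>Nichols algebras\<close>

text \<open>
  The tensor algebra \<open>T(V)\<close> of a Yetter-Drinfeld module \<open>V\<close> over \<open>H\<close>. It carries the diagonal action
  and coaction of \<open>H\<close>; its comultiplication is the algebra map into the braided tensor square
  with \<open>v \<mapsto> v \<otimes> 1 + 1 \<otimes> v\<close> for \<open>v\<close> in \<open>V\<close>, where
  \<open>(1 \<otimes> v)(x \<otimes> y) = v\<^sub>(\<^sub>-\<^sub>1\<^sub>) \<cdot> x \<otimes> v\<^sub>(\<^sub>0\<^sub>) y\<close>.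
\<close>

primrec tens_act ::
  "('h, 'k::field, 'z) bialg_scheme \<Rightarrow> ('h, 'b, 'k) yd_mod \<Rightarrow> 'b list \<Rightarrow>
   ('h, 'k) vec \<Rightarrow> ('b list, 'k) vec" where
  "tens_act H V [] h = vscale (bcounit H h) (bvec [])"
| "tens_act H V (b # w) h =
     lin_ext (\<lambda>(a, c). vcons (yact V (bvec a) (bvec b)) (tens_act H V w (bvec c))) (bcomult H h)"

primrec tens_coact ::
  "('h, 'k::field, 'z) bialg_scheme \<Rightarrow> ('h, 'b, 'k) yd_mod \<Rightarrow> 'b list \<Rightarrow>
   ('h \<times> 'b list, 'k) vec" where
  "tens_coact H V [] = tensor (bone H) (bvec [])"
| "tens_coact H V (b # w) =
     bilin_ext (\<lambda>(g, c) (h, u). tensor (bmult H (bvec g) (bvec h)) (bvec (c # u)))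
       (ycoact V (bvec b)) (tens_coact H V w)"

primrec tens_comult ::
  "('h, 'k::field, 'z) bialg_scheme \<Rightarrow> ('h, 'b, 'k) yd_mod \<Rightarrow> 'b list \<Rightarrow>
   ('b list \<times> 'b list, 'k) vec" where
  "tens_comult H V [] = bvec ([], [])"
| "tens_comult H V (b # w) =
     lin_ext (\<lambda>(x, y). bvec (b # x, y) +
         lin_ext (\<lambda>(h, c). tensor (tens_act H V x (bvec h)) (bvec (c # y))) (ycoact V (bvec b)))
       (tens_comult H V w)"

definition tensor_algebra ::
  "('h, 'k::field, 'z) bialg_scheme \<Rightarrow> ('h, 'b, 'k) yd_mod \<Rightarrow> ('b list, 'k, 'h) braided" where
  "tensor_algebra H V =
     \<lparr>bspace = pm.span (\<Union>n. tpow (yspace V) n),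
      bmult = bilin_ext (\<lambda>u w. bvec (u @ w)),
      bone = bvec [],
      bcomult = lin_ext (tens_comult H V),
      bcounit = (\<lambda>t. Poly_Mapping.lookup t []),
      bdeg = tpow (yspace V),
      hact = (\<lambda>h. lin_ext (\<lambda>w. tens_act H V w h)),
      hcoact = lin_ext (tens_coact H V)\<rparr>"

text \<open>
  \<open>B(V) = T(V) / I(V)\<close>, where \<open>I(V)\<close> is the sum of all Yetter-Drinfeld submodules of \<open>T(V)\<close> that are
  coideals and ideals generated by homogeneous elements of degree at least 2. An ideal is generated
  by such elements iff it is spanned by its homogeneous elements of degree at least 2.
\<close>

definition nichols_ideals ::
  "('h, 'k::field, 'z) bialg_scheme \<Rightarrow> ('b, 'k, 'h) braided \<Rightarrow> ('b, 'k) vec set set" where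
  "nichols_ideals H T = {I. I \<subseteq> bspace T \<and>
     I = pm.span (\<Union>n\<in>{2..}. I \<inter> bdeg T n) \<and>
     (\<forall>x\<in>bspace T. \<forall>y\<in>I. bmult T x y \<in> I \<and> bmult T y x \<in> I) \<and>
     (\<forall>y\<in>I. bcomult T y \<in> pm.span (tensor_space I (bspace T) \<union> tensor_space (bspace T) I)) \<and>
     (\<forall>y\<in>I. bcounit T y = 0) \<and>
     (\<forall>h\<in>bspace H. \<forall>y\<in>I. hact T h y \<in> I) \<and>
     (\<forall>y\<in>I. hcoact T y \<in> tensor_space (bspace H) I)}"

definition nichols_ideal ::
  "('h, 'k::field, 'z) bialg_scheme \<Rightarrow> ('b, 'k, 'h) braided \<Rightarrow> ('b, 'k) vec set" where
  "nichols_ideal H T = pm.span (\<Union>(nichols_ideals H T))"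

definition braided_quot ::
  "('b, 'k::field, 'h) braided \<Rightarrow> ('b, 'k) vec set \<Rightarrow> ('b, 'k, 'h) braided" where
  "braided_quot T I = (let p = quot_proj (bspace T) I in
     \<lparr>bspace = p ` bspace T,
      bmult = (\<lambda>x y. p (bmult T x y)),
      bone = p (bone T),
      bcomult = (\<lambda>x. tensor_map p p (bcomult T x)),
      bcounit = bcounit T,
      bdeg = (\<lambda>n. p ` bdeg T n),
      hact = (\<lambda>h x. p (hact T h x)),
      hcoact = (\<lambda>x. tensor_map id p (hcoact T x))\<rparr>)"

definition nichols ::
  "('h, 'k::field, 'z) bialg_scheme \<Rightarrow> ('h, 'b, 'k) yd_mod \<Rightarrow> ('b list, 'k, 'h) braided" where
  "nichols H V =
     braided_quot (tensor_algebra H V) (nichols_ideal H (tensor_algebra H V))"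


section \<open>Cotensor coalgebras of Hopf bimodules\<close>

record (overloaded) ('h, 'm, 'k) hopf_bimod =
  mspace :: "('m, 'k::field) vec set"
  lact :: "('h, 'k) vec \<Rightarrow> ('m, 'k) vec \<Rightarrow> ('m, 'k) vec"
  ract :: "('m, 'k) vec \<Rightarrow> ('h, 'k) vec \<Rightarrow> ('m, 'k) vec"
  lcoact :: "('m, 'k) vec \<Rightarrow> ('h \<times> 'm, 'k) vec"
  rcoact :: "('m, 'k) vec \<Rightarrow> ('m \<times> 'h, 'k) vec"

text \<open>
  The ambient free space of the cotensor coalgebra of \<open>M\<close> over \<open>H\<close> has the basis type
  \<open>'h + 'm list\<close>: \<open>Inl\<close> carries degree 0, and \<open>Inr\<close> carries the \<open>n\<close>-fold tensors for \<open>n \<ge> 1\<close>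
  as words of length \<open>n\<close> (\<open>Inr []\<close> is unused).
\<close>

definition cot_in0 :: "('h, 'k::field) vec \<Rightarrow> ('h + 'm list, 'k) vec" where
  "cot_in0 = lin_ext (\<lambda>h. bvec (Inl h))"

definition cot_in :: "('m list, 'k::field) vec \<Rightarrow> ('h + 'm list, 'k) vec" where
  "cot_in = lin_ext (\<lambda>w. bvec (Inr w))"

definition cot_in1 :: "('m, 'k::field) vec \<Rightarrow> ('h + 'm list, 'k) vec" where
  "cot_in1 = lin_ext (\<lambda>m. bvec (Inr [m]))"

definition cot_pr0 :: "('h + 'm list, 'k::field) vec \<Rightarrow> ('h, 'k) vec" where
  "cot_pr0 = lin_ext (case_sum bvec (\<lambda>w. 0))"

definition cot_pr1 :: "('h + 'm list, 'k::field) vec \<Rightarrow> ('m, 'k) vec" where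
  "cot_pr1 = lin_ext (case_sum (\<lambda>h. 0) (\<lambda>w. case w of [m] \<Rightarrow> bvec m | _ \<Rightarrow> 0))"

text \<open>
  The two maps whose equalizer defines the cotensor product at the \<open>p\<close>-th tensor sign: apply the
  right coaction to the \<open>p\<close>-th factor, or the left coaction to the \<open>(p+1)\<close>-st factor.
\<close>

definition cot_right ::
  "('h, 'm, 'k::field) hopf_bimod \<Rightarrow> nat \<Rightarrow> ('m list, 'k) vec \<Rightarrow> ('m list \<times> 'h \<times> 'm list, 'k) vec"
  where
  "cot_right M p = lin_ext (\<lambda>w.
     lin_ext (\<lambda>(m, h). bvec (take (p - 1) w @ [m], h, drop p w)) (rcoact M (bvec (w ! (p - 1)))))"

definition cot_left ::
  "('h, 'm, 'k::field) hopf_bimod \<Rightarrow> nat \<Rightarrow> ('m list, 'k) vec \<Rightarrow> ('m list \<times> 'h \<times> 'm list, 'k) vec"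
  where
  "cot_left M p = lin_ext (\<lambda>w.
     lin_ext (\<lambda>(h, m). bvec (take p w, h, m # drop (Suc p) w)) (lcoact M (bvec (w ! p))))"

definition cot_deg ::
  "('h, 'k::field, 'z) bialg_scheme \<Rightarrow> ('h, 'm, 'k) hopf_bimod \<Rightarrow> nat \<Rightarrow> ('h + 'm list, 'k) vec set"
  where
  "cot_deg H M n =
     (if n = 0 then cot_in0 ` bspace H
      else cot_in ` {t \<in> tpow (mspace M) n. \<forall>p. 0 < p \<and> p < n \<longrightarrow> cot_right M p t = cot_left M p t})"

definition cot_space ::
  "('h, 'k::field, 'z) bialg_scheme \<Rightarrow> ('h, 'm, 'k) hopf_bimod \<Rightarrow> ('h + 'm list, 'k) vec set" where
  "cot_space H M = pm.span (\<Union>n. cot_deg H M n)"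

definition cot_comult ::
  "('h, 'k::field, 'z) bialg_scheme \<Rightarrow> ('h, 'm, 'k) hopf_bimod \<Rightarrow>
   ('h + 'm list, 'k) vec \<Rightarrow> (('h + 'm list) \<times> ('h + 'm list), 'k) vec" where
  "cot_comult H M = lin_ext (case_sum
     (\<lambda>h. tensor_map cot_in0 cot_in0 (bcomult H (bvec h)))
     (\<lambda>w. lin_ext (\<lambda>(h, m). bvec (Inl h, Inr (m # tl w))) (lcoact M (bvec (hd w)))
        + (\<Sum>p\<in>{0<..<length w}. bvec (Inr (take p w), Inr (drop p w)))
        + lin_ext (\<lambda>(m, h). bvec (Inr (butlast w @ [m]), Inl h)) (rcoact M (bvec (last w)))))"

definition cot_counit ::
  "('h, 'k::field, 'z) bialg_scheme \<Rightarrow> ('h + 'm list, 'k) vec \<Rightarrow> 'k" where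
  "cot_counit H x = bcounit H (cot_pr0 x)"

text \<open>
  The first three conditions say that \<open>m\<close> is a coalgebra map from the tensor square of the cotensor
  coalgebra to the cotensor coalgebra; the last two prescribe its components in degrees 0 and 1.
\<close>

definition is_cot_mult ::
  "('h, 'k::field, 'z) bialg_scheme \<Rightarrow> ('h, 'm, 'k) hopf_bimod \<Rightarrow>
   (('h + 'm list, 'k) vec \<Rightarrow> ('h + 'm list, 'k) vec \<Rightarrow> ('h + 'm list, 'k) vec) \<Rightarrow> bool" where
  "is_cot_mult H M m \<longleftrightarrow> bilin m \<and>
     (\<forall>x\<in>cot_space H M. \<forall>y\<in>cot_space H M.
        m x y \<in> cot_space H M \<and>
        cot_comult H M (m x y) = tensor_mult m (cot_comult H M x) (cot_comult H M y) \<and>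
        cot_counit H (m x y) = cot_counit H x * cot_counit H y \<and>
        cot_pr0 (m x y) = bmult H (cot_pr0 x) (cot_pr0 y) \<and>
        cot_pr1 (m x y) = lact M (cot_pr0 x) (cot_pr1 y) + ract M (cot_pr1 x) (cot_pr0 y))"

text \<open>
  By the universal property of the cotensor coalgebra, the multiplication is unique on the cotensor
  coalgebra; the choice only concerns the irrelevant values elsewhere in the ambient space.
\<close>

definition cot_mult ::
  "('h, 'k::field, 'z) bialg_scheme \<Rightarrow> ('h, 'm, 'k) hopf_bimod \<Rightarrow>
   ('h + 'm list, 'k) vec \<Rightarrow> ('h + 'm list, 'k) vec \<Rightarrow> ('h + 'm list, 'k) vec" where
  "cot_mult H M = (SOME m. is_cot_mult H M m)"

definition gen_space ::
  "('h, 'k::field, 'z) bialg_scheme \<Rightarrow> ('h, 'm, 'k) hopf_bimod \<Rightarrow> ('h + 'm list, 'k) vec set" where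
  "gen_space H M = \<Inter>{S. pm.subspace S \<and> cot_in0 ` bspace H \<subseteq> S \<and> cot_in1 ` mspace M \<subseteq> S \<and>
     (\<forall>x\<in>S. \<forall>y\<in>S. cot_mult H M x y \<in> S)}"

definition gen_hopf ::
  "('h, 'k::field, 'z) bialg_scheme \<Rightarrow> ('h, 'm, 'k) hopf_bimod \<Rightarrow> ('h + 'm list, 'k) graded_bialg"
  where
  "gen_hopf H M =
     \<lparr>bspace = gen_space H M,
      bmult = cot_mult H M,
      bone = cot_in0 (bone H),
      bcomult = cot_comult H M,
      bcounit = cot_counit H,
      bdeg = (\<lambda>n. gen_space H M \<inter> cot_deg H M n)\<rparr>"


section \<open>Groups, characters and the two kinds of systems\<close>

definition field_units :: "'k::field monoid" where
  "field_units = \<lparr>carrier = {x. x \<noteq> 0}, monoid.mult = (*), one = 1\<rparr>"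

definition center :: "'g monoid \<Rightarrow> 'g set" where
  "center G = {z \<in> carrier G. \<forall>h\<in>carrier G. z \<otimes>\<^bsub>G\<^esub> h = h \<otimes>\<^bsub>G\<^esub> z}"

definition centralizer :: "'g monoid \<Rightarrow> 'g \<Rightarrow> 'g set" where
  "centralizer G x = {h \<in> carrier G. h \<otimes>\<^bsub>G\<^esub> x = x \<otimes>\<^bsub>G\<^esub> h}"

definition conj_classes :: "'g monoid \<Rightarrow> 'g set set" where
  "conj_classes G =
     (\<lambda>x. (\<lambda>h. h \<otimes>\<^bsub>G\<^esub> x \<otimes>\<^bsub>G\<^esub> inv\<^bsub>G\<^esub> h) ` carrier G) ` carrier G"

record ('g, 'i, 'k) esc =
  egrp :: "'g monoid"
  eidx :: "'i set"
  eelt :: "'i \<Rightarrow> 'g"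
  echr :: "'i \<Rightarrow> 'g \<Rightarrow> 'k::field"

definition ESC :: "('g, 'i, 'k::field) esc \<Rightarrow> bool" where
  "ESC E \<longleftrightarrow> group (egrp E) \<and>
     (\<forall>i\<in>eidx E. eelt E i \<in> center (egrp E) \<and> echr E i \<in> hom (egrp E) field_units)"

definition ESC_isomorphic :: "('g, 'i, 'k::field) esc \<Rightarrow> ('h, 'j, 'k) esc \<Rightarrow> bool" where
  "ESC_isomorphic E E' \<longleftrightarrow>
     (\<exists>\<phi> \<sigma>. \<phi> \<in> iso (egrp E) (egrp E') \<and> bij_betw \<sigma> (eidx E) (eidx E') \<and>
        (\<forall>i\<in>eidx E. \<phi> (eelt E i) = eelt E' (\<sigma> i) \<and>
           (\<forall>h\<in>carrier (egrp E). echr E' (\<sigma> i) (\<phi> h) = echr E i h)))"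

text \<open>
  In \<open>(G, r, \<chi>, u)\<close> the ramification \<open>r\<close> is given by its cardinal coefficients \<open>rram\<close>; \<open>ridx C\<close> is
  the chosen set \<open>I\<^sub>C(r)\<close> of cardinality \<open>r\<^sub>C\<close>.
\<close>

record ('g, 'i, 'k) rsc =
  rgrp :: "'g monoid"
  rram :: "'g set \<Rightarrow> 'i rel"
  ridx :: "'g set \<Rightarrow> 'i set"
  rchr :: "'g set \<Rightarrow> 'i \<Rightarrow> 'g \<Rightarrow> 'k::field"
  rpt :: "'g set \<Rightarrow> 'g"

definition ram_classes :: "('g, 'i, 'k::field) rsc \<Rightarrow> 'g set set" where
  "ram_classes R = {C \<in> conj_classes (rgrp R). \<not> (rram R C =o |{} :: 'i set| )}"

definition RSC :: "('g, 'i, 'k::field) rsc \<Rightarrow> bool" where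
  "RSC R \<longleftrightarrow> group (rgrp R) \<and>
     (\<forall>C\<in>conj_classes (rgrp R).
        Card_order (rram R C) \<and> |ridx R C| =o rram R C \<and> rpt R C \<in> C) \<and>
     (\<forall>C\<in>ram_classes R. \<forall>i\<in>ridx R C.
        rchr R C i \<in> hom (rgrp R\<lparr>carrier := centralizer (rgrp R) (rpt R C)\<rparr>) field_units)"

definition CRSC :: "('g, 'i, 'k::field) rsc \<Rightarrow> bool" where
  "CRSC R \<longleftrightarrow> RSC R \<and> (\<forall>C\<in>ram_classes R. \<exists>x. C = {x})"

definition RSC_isomorphic :: "('g, 'i, 'k::field) rsc \<Rightarrow> ('h, 'j, 'k) rsc \<Rightarrow> bool" where
  "RSC_isomorphic R R' \<longleftrightarrow>
     (\<exists>\<phi> c \<tau>. \<phi> \<in> iso (rgrp R) (rgrp R') \<and>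
        (\<forall>C\<in>conj_classes (rgrp R).
           c C \<in> carrier (rgrp R) \<and>
           \<phi> (inv\<^bsub>rgrp R\<^esub> (c C) \<otimes>\<^bsub>rgrp R\<^esub> rpt R C \<otimes>\<^bsub>rgrp R\<^esub> c C) = rpt R' (\<phi> ` C) \<and>
           bij_betw (\<tau> C) (ridx R C) (ridx R' (\<phi> ` C)) \<and>
           (\<forall>i\<in>ridx R C. \<forall>h\<in>centralizer (rgrp R) (rpt R C).
              rchr R' (\<phi> ` C) (\<tau> C i) (\<phi> (inv\<^bsub>rgrp R\<^esub> (c C) \<otimes>\<^bsub>rgrp R\<^esub> h \<otimes>\<^bsub>rgrp R\<^esub> c C)) =
              rchr R C i h)))"

definition CRSC_isomorphic :: "('g, 'i, 'k::field) rsc \<Rightarrow> ('h, 'j, 'k) rsc \<Rightarrow> bool" where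
  "CRSC_isomorphic R R' \<longleftrightarrow> CRSC R \<and> CRSC R' \<and> RSC_isomorphic R R'"

definition esc_class :: "('g, 'i, 'k::field) esc \<Rightarrow> 'i \<Rightarrow> 'i set" where
  "esc_class E i = {j \<in> eidx E. eelt E j = eelt E i}"

definition esc_reps :: "('g, 'i, 'k::field) esc \<Rightarrow> 'i set \<Rightarrow> bool" where
  "esc_reps E Jr \<longleftrightarrow> Jr \<subseteq> eidx E \<and> (\<forall>i\<in>eidx E. \<exists>!j. j \<in> Jr \<and> eelt E j = eelt E i)"

text \<open>
  \<open>I\<^sub>C(r)\<close> for \<open>r = \<Sum> |[i]| {g\<^sub>i}\<close>, the sum over the representatives \<open>i\<close> in \<open>Jr\<close>: at most one of
  them satisfies \<open>C = {g\<^sub>i}\<close>, so this is \<open>[i]\<close> if \<open>C = {g\<^sub>i}\<close> and empty if there is no such \<open>i\<close>.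
\<close>

definition esc_ridx :: "('g, 'i, 'k::field) esc \<Rightarrow> 'i set \<Rightarrow> 'g set \<Rightarrow> 'i set" where
  "esc_ridx E Jr C = (\<Union>i\<in>{i \<in> Jr. C = {eelt E i}}. esc_class E i)"

definition rsc_of_esc ::
  "('g, 'i, 'k::field) esc \<Rightarrow> 'i set \<Rightarrow> ('g set \<Rightarrow> 'g) \<Rightarrow> ('g, 'i, 'k) rsc" where
  "rsc_of_esc E Jr u =
     \<lparr>rgrp = egrp E,
      rram = (\<lambda>C. |esc_ridx E Jr C| ),
      ridx = esc_ridx E Jr,
      rchr = (\<lambda>C j. echr E j),
      rpt = u\<rparr>"


section \<open>Algebraic objects attached to an element system with characters\<close>

definition group_algebra :: "'g monoid \<Rightarrow> ('g, 'k::field) bialg" where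
  "group_algebra G =
     \<lparr>bspace = coord_space (carrier G),
      bmult = bilin_ext (\<lambda>g h. bvec (g \<otimes>\<^bsub>G\<^esub> h)),
      bone = bvec \<one>\<^bsub>G\<^esub>,
      bcomult = lin_ext (\<lambda>g. bvec (g, g)),
      bcounit = (\<lambda>v. \<Sum>g\<in>Poly_Mapping.keys v. Poly_Mapping.lookup v g)\<rparr>"

definition yd_V :: "('g, 'i, 'k::field) esc \<Rightarrow> ('g, 'i, 'k) yd_mod" where
  "yd_V E =
     \<lparr>yspace = coord_space (eidx E),
      yact = bilin_ext (\<lambda>g i. vscale (echr E i g) (bvec i)),
      ycoact = lin_ext (\<lambda>i. bvec (eelt E i, i))\<rparr>"

text \<open>\<open>Arrow y i x\<close> is the arrow labelled \<open>i\<close> from \<open>x\<close> to \<open>y\<close>.\<close>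

datatype ('g, 'i) arrow = Arrow (atarget: 'g) (alabel: 'i) (asource: 'g)

definition esc_arrows :: "('g, 'i, 'k::field) esc \<Rightarrow> ('g, 'i) arrow set" where
  "esc_arrows E =
     {Arrow (eelt E i \<otimes>\<^bsub>egrp E\<^esub> x) i x | x i. x \<in> carrier (egrp E) \<and> i \<in> eidx E}"

definition arrow_bimod :: "('g, 'i, 'k::field) esc \<Rightarrow> ('g, ('g, 'i) arrow, 'k) hopf_bimod" where
  "arrow_bimod E =
     \<lparr>mspace = coord_space (esc_arrows E),
      lact = bilin_ext (\<lambda>h a.
        bvec (Arrow (h \<otimes>\<^bsub>egrp E\<^esub> atarget a) (alabel a) (h \<otimes>\<^bsub>egrp E\<^esub> asource a))),
      ract = bilin_ext (\<lambda>a h. vscale (echr E (alabel a) h)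
        (bvec (Arrow (atarget a \<otimes>\<^bsub>egrp E\<^esub> h) (alabel a) (asource a \<otimes>\<^bsub>egrp E\<^esub> h)))),
      lcoact = lin_ext (\<lambda>a. bvec (atarget a, a)),
      rcoact = lin_ext (\<lambda>a. bvec (a, asource a))\<rparr>"

definition arrow_ad :: "('g, 'i, 'k::field) esc \<Rightarrow> ('g, ('g, 'i) arrow, 'k) yd_mod" where
  "arrow_ad E =
     \<lparr>yspace = coord_space {a \<in> esc_arrows E. asource a = \<one>\<^bsub>egrp E\<^esub>},
      yact = bilin_ext (\<lambda>g a.
        ract (arrow_bimod E) (lact (arrow_bimod E) (bvec g) (bvec a)) (bvec (inv\<^bsub>egrp E\<^esub> g))),
      ycoact = lcoact (arrow_bimod E)\<rparr>"

definition multiple_taft ::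
  "('g, 'i, 'k::field) esc \<Rightarrow> ('g + ('g, 'i) arrow list, 'k) graded_bialg" where
  "multiple_taft E = gen_hopf (group_algebra (egrp E)) (arrow_bimod E)"

definition all_equivalent :: "bool list \<Rightarrow> bool" where
  "all_equivalent Ps \<longleftrightarrow> (\<forall>P\<in>set Ps. \<forall>Q\<in>set Ps. P \<longleftrightarrow> Q)"

end

theory Submission
  imports Defs
begin

text \<open>
  Up to isomorphism, an element system is a group together with the number of indices that carry
  each given pair \<open>(g, \<chi>)\<close>. Every statement is compared with \<open>ESC_isomorphic\<close>: one has to see that each of the algebraic objects is built functorially from the element system,
  and that it remembers the group and these multiplicities.

  The group. The grouplike elements of a group algebra are exactly the group elements, so a
  Hopf algebra isomorphism of group algebras is induced by a group isomorphism
  (\<open>hopf_iso_group_algebra_basis\<close>).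

  The multiplicities. In each of the Yetter-Drinfeld modules that occur, the basis vector attached
  to \<open>i\<close> is a simultaneous eigenvector of the action of the group and of the operators that pick the
  components of the coaction; its eigenvalues encode \<open>g\<^sub>i\<close> and \<open>\<chi>\<^sub>i\<close>. An isomorphism turns such an
  eigenbasis into a second eigenbasis for the same operators. Both bases split into bases of the same
  common eigenspaces, and bases of one space have equal cardinality, also in infinite dimension;
  hence a bijection of the indices that respects eigenvalues (\<open>eigenbasis_matching\<close>). This settles
  the modules \<open>V\<close> and \<open>kQ\<^sub>1\<^sup>1\<close>; on the latter, \<open>G\<close> acts through the inverse characters, which
  changes nothing since inverting characters is compatible with isomorphisms.

  Nichols algebras. The component of degree 1 of \<open>B(V)\<close> is \<open>V\<close>, because the ideal lives in degrees
  \<open>\<ge> 2\<close>; so an isomorphism of Nichols algebras gives one of the modules \<open>V\<close>. Conversely an isomorphism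
  of element systems renames the letters of the tensor algebra and preserves all its structure. The
  ideal is defined by that structure alone, hence is preserved as well, and the isomorphism descends
  to the quotients (\<open>braided_quot_iso\<close>).

  Multiple Taft algebras. The product of the cotensor coalgebra is only known to be a coalgebra map
  with prescribed components in degrees 0 and 1. It is unique because the comultiplication reads off
  the coefficient of a word \<open>a w\<close> from its parts \<open>a\<close> and \<open>w\<close> (\<open>is_cot_mult_unique\<close>), and it exists
  because a recursive shuffle product of paths has the required properties (\<open>path_comult_mult\<close>,
  \<open>is_cot_mult_cmul\<close>). Renaming vertices and labels of paths respects this product, which gives an
  isomorphism of multiple Taft algebras from one of element systems. Conversely, a graded isomorphism
  restricts in degree 0 to the group algebras and in degree 1 to a map of the arrow bimodules that
  respects both actions and both coactions; the arrows starting at \<open>1\<close> are singled out by the right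
  coaction, so an isomorphism of the modules \<open>kQ\<^sub>1\<^sup>1\<close> results (\<open>graded_hopf_iso_imp_arrow_ad\<close>).

  Ramification systems. All classes with nonzero coefficient are of the form \<open>{g\<^sub>i}\<close>, the centralizer of
  \<open>g\<^sub>i\<close> is the whole group, and a character does not change under conjugation of its argument.
\<close>

section \<open>Linear algebra over free vector spaces\<close>

global_interpretation pp: vector_space_pair
  "vscale :: 'k::field \<Rightarrow> ('b, 'k) vec \<Rightarrow> ('b, 'k) vec"
  "vscale :: 'k::field \<Rightarrow> ('c, 'k) vec \<Rightarrow> ('c, 'k) vec" ..

lemma lin_iff:
  "lin f \<longleftrightarrow> (\<forall>x y. f (x + y) = f x + f y) \<and> (\<forall>c x. f (vscale c x) = vscale c (f x))"
  unfolding Vector_Spaces.linear_iff by (auto intro: pm.vector_space_axioms)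

lemma linI:
  "(\<And>x y. f (x + y) = f x + f y) \<Longrightarrow> (\<And>c x. f (vscale c x) = vscale c (f x)) \<Longrightarrow> lin f"
  by (simp add: lin_iff)

lemma lin_add: "lin f \<Longrightarrow> f (x + y) = f x + f y"
  and lin_scale: "lin f \<Longrightarrow> f (vscale c x) = vscale c (f x)"
  by (simp_all add: lin_iff)

lemma lin_0: "lin f \<Longrightarrow> f 0 = 0"
  by (rule pp.linear_0)

lemma lin_diff: "lin f \<Longrightarrow> f (x - y) = f x - f y"
  by (rule pp.linear_diff)

lemma lin_sum: "lin f \<Longrightarrow> f (\<Sum>a\<in>A. g a) = (\<Sum>a\<in>A. f (g a))"
  by (rule pp.linear_sum)

lemma lin_ident: "lin (\<lambda>x. x)"
  and lin_id: "lin id"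
  and lin_zero: "lin (\<lambda>x. 0)"
  by (simp_all add: lin_iff)

lemma lin_compose: "lin h \<Longrightarrow> lin f \<Longrightarrow> lin (\<lambda>x. h (f x))"
  by (simp add: lin_iff)

lemma lin_vscale: "lin f \<Longrightarrow> lin (\<lambda>x. vscale c (f x))"
  by (simp add: lin_iff pm.scale_right_distrib mult.commute)

lemma lin_plus: "lin f \<Longrightarrow> lin g \<Longrightarrow> lin (\<lambda>x. f x + g x)"
  by (simp add: lin_iff pm.scale_right_distrib)

lemma lin_minus: "lin f \<Longrightarrow> lin g \<Longrightarrow> lin (\<lambda>x. f x - g x)"
  by (simp add: lin_iff pm.scale_right_diff_distrib)

lemma lookup_bvec: "Poly_Mapping.lookup (bvec b) c = (if b = c then 1 else 0)"
  by (simp add: bvec_def lookup_single when_def)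

lemma keys_bvec [simp]: "Poly_Mapping.keys (bvec b :: ('b, 'k::field) vec) = {b}"
  by (simp add: bvec_def)

lemma bvec_inject [simp]: "bvec a = (bvec b :: ('b, 'k::field) vec) \<longleftrightarrow> a = b"
  by (metis keys_bvec singleton_inject)

lemma bvec_neq_0 [simp]: "bvec a \<noteq> (0 :: ('b, 'k::field) vec)"
  by (metis keys_bvec keys_zero insert_not_empty)

lemma lookup_sum_vec: "Poly_Mapping.lookup (\<Sum>a\<in>A. f a) b = (\<Sum>a\<in>A. Poly_Mapping.lookup (f a) b)"
  by (induction A rule: infinite_finite_induct) (auto simp: lookup_add)

lemma vec_expand: "v = (\<Sum>b\<in>Poly_Mapping.keys v. vscale (Poly_Mapping.lookup v b) (bvec b))"
proof (rule poly_mapping_eqI)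
  fix c
  show "Poly_Mapping.lookup v c =
      Poly_Mapping.lookup (\<Sum>b\<in>Poly_Mapping.keys v. vscale (Poly_Mapping.lookup v b) (bvec b)) c"
    by (simp add: lookup_sum_vec lookup_vscale lookup_bvec if_distrib not_in_keys_iff_lookup_eq_zero
        cong: if_cong)
qed

text \<open>
  Sums over a common superset of the supports make the linearity of \<open>lin_ext\<close> a matter of
  distributing finite sums.
\<close>

lemma lin_ext_superset:
  assumes "finite S" "Poly_Mapping.keys v \<subseteq> S"
  shows "lin_ext f v = (\<Sum>b\<in>S. vscale (Poly_Mapping.lookup v b) (f b))"
  unfolding lin_ext_def using assms
  by (intro sum.mono_neutral_left) (auto simp: not_in_keys_iff_lookup_eq_zero)

lemma lin_lin_ext [simp]: "lin (lin_ext f :: ('a, 'b::field) vec \<Rightarrow> ('c, 'b) vec)"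
proof (rule linI)
  fix x y :: "('a, 'b) vec"
  let ?S = "Poly_Mapping.keys x \<union> Poly_Mapping.keys y"
  have "lin_ext f (x + y) = (\<Sum>b\<in>?S. vscale (Poly_Mapping.lookup (x + y) b) (f b))"
    using keys_add[of x y] by (intro lin_ext_superset) auto
  also have "\<dots> = lin_ext f x + lin_ext f y"
    by (simp add: lin_ext_superset[of ?S] lookup_add pm.scale_left_distrib sum.distrib)
  finally show "lin_ext f (x + y) = lin_ext f x + lin_ext f y" .
next
  fix c :: 'b and x :: "('a, 'b) vec"
  have "Poly_Mapping.keys (vscale c x) \<subseteq> Poly_Mapping.keys x"
    by (auto simp: in_keys_iff lookup_vscale)
  then have "lin_ext f (vscale c x) =
      (\<Sum>b\<in>Poly_Mapping.keys x. vscale (Poly_Mapping.lookup (vscale c x) b) (f b))"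
    by (intro lin_ext_superset) auto
  also have "\<dots> = vscale c (lin_ext f x)"
    by (simp add: lin_ext_def lookup_vscale pm.scale_sum_right)
  finally show "lin_ext f (vscale c x) = vscale c (lin_ext f x)" .
qed

lemma lin_ext_bvec [simp]: "lin_ext f (bvec b) = f b"
  by (simp add: lin_ext_def lookup_bvec)

lemma lin_lin_ext_param:
  assumes "\<And>b. lin (\<lambda>x. f x b)"
  shows "lin (\<lambda>x. lin_ext (f x) v)"
proof (rule linI)
  show "lin_ext (f (x + y)) v = lin_ext (f x) v + lin_ext (f y) v" for x y
    by (simp add: lin_ext_def lin_add[OF assms] pm.scale_right_distrib sum.distrib)
  show "lin_ext (f (vscale c x)) v = vscale c (lin_ext (f x) v)" for c x
    by (simp add: lin_ext_def lin_scale[OF assms] pm.scale_sum_right mult.commute)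
qed

lemma lookup_lin_ext:
  "Poly_Mapping.lookup (lin_ext f v) c =
    (\<Sum>b\<in>Poly_Mapping.keys v. Poly_Mapping.lookup v b * Poly_Mapping.lookup (f b) c)"
  by (simp add: lin_ext_def lookup_sum_vec lookup_vscale)

subsection \<open>Coordinate subspaces\<close>

lemma bvec_in_coord_space [simp]: "bvec b \<in> (coord_space S :: ('b, 'k::field) vec set) \<longleftrightarrow> b \<in> S"
  by (simp add: coord_space_def)

lemma coord_spaceI: "(\<And>b. Poly_Mapping.lookup v b \<noteq> 0 \<Longrightarrow> b \<in> S) \<Longrightarrow> v \<in> coord_space S"
  by (auto simp: coord_space_def in_keys_iff)

lemma coord_spaceD: "v \<in> coord_space S \<Longrightarrow> b \<notin> S \<Longrightarrow> Poly_Mapping.lookup v b = 0"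
  by (auto simp: coord_space_def in_keys_iff)

lemma subspace_coord_space: "pm.subspace (coord_space S)"
proof (rule pm.subspaceI)
  show "x + y \<in> coord_space S" if "x \<in> coord_space S" "y \<in> coord_space S"
    for x y :: "('b, 'a) vec"
    using that keys_add[of x y] by (auto simp: coord_space_def)
  show "vscale c x \<in> coord_space S" if "x \<in> coord_space S" for c and x :: "('b, 'a) vec"
    using that by (auto intro!: coord_spaceI simp: lookup_vscale dest: coord_spaceD)
qed (simp add: coord_space_def)

lemma coord_space_eq_span: "coord_space S = pm.span (bvec ` S)"
proof
  show "coord_space S \<subseteq> (pm.span (bvec ` S) :: ('a, 'b) vec set)"
  proof
    fix v :: "('a, 'b) vec" assume "v \<in> coord_space S"
    then have "(\<Sum>b\<in>Poly_Mapping.keys v. vscale (Poly_Mapping.lookup v b) (bvec b)) \<in> pm.span (bvec ` S)"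
      by (intro pm.span_sum pm.span_scale pm.span_base) (auto simp: coord_space_def)
    then show "v \<in> pm.span (bvec ` S)"
      by (simp flip: vec_expand)
  qed
  show "pm.span (bvec ` S) \<subseteq> (coord_space S :: ('a, 'b) vec set)"
    by (rule pm.span_minimal) (auto simp: subspace_coord_space)
qed

lemma coord_space_mono: "S \<subseteq> T \<Longrightarrow> coord_space S \<subseteq> coord_space T"
  by (auto simp: coord_space_def)

lemma coord_space_UNIV [simp]: "coord_space UNIV = UNIV"
  by (auto simp: coord_space_def)

lemma independent_bvec: "pm.independent (bvec ` S :: ('b, 'k::field) vec set)"
  unfolding pm.independent_explicit_module
proof (intro allI impI)
  fix t and c :: "('b, 'k) vec \<Rightarrow> 'k" and v
  assume t: "finite t" "t \<subseteq> bvec ` S" and sum: "(\<Sum>v\<in>t. vscale (c v) v) = 0" and "v \<in> t"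
  then obtain b where v: "v = bvec b" by auto
  have "0 = Poly_Mapping.lookup (\<Sum>v\<in>t. vscale (c v) v) b"
    using sum by simp
  also have "\<dots> = (\<Sum>w\<in>t. if w = v then c v else 0)"
    unfolding lookup_sum_vec using t
    by (intro sum.cong) (auto simp: lookup_vscale lookup_bvec v)
  also have "\<dots> = c v"
    using t \<open>v \<in> t\<close> by simp
  finally show "c v = 0" by simp
qed

lemma lin_span_image: "lin f \<Longrightarrow> f ` pm.span S = pm.span (f ` S)"
  by (rule pp.linear_span_image[symmetric])

lemma lin_in_span:
  assumes "lin f" "\<And>x. x \<in> S \<Longrightarrow> f x \<in> W" "pm.subspace W" "v \<in> pm.span S"
  shows "f v \<in> W"
proof -
  have "f v \<in> pm.span (f ` S)"
    unfolding lin_span_image[OF assms(1), symmetric] using assms(4) by (rule imageI)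
  moreover have "pm.span (f ` S) \<subseteq> W"
    by (rule pm.span_minimal[OF _ assms(3)]) (use assms(2) in blast)
  ultimately show ?thesis by blast
qed

lemma lin_in_coord:
  assumes "lin f" "\<And>b. b \<in> S \<Longrightarrow> f (bvec b) \<in> W" "pm.subspace W" "v \<in> coord_space S"
  shows "f v \<in> W"
proof (rule lin_in_span[OF assms(1) _ assms(3)])
  show "v \<in> pm.span (bvec ` S)"
    using assms(4) by (simp only: coord_space_eq_span)
qed (use assms(2) in blast)

lemma lin_eq_on_span:
  assumes "lin f" "lin g" "\<And>x. x \<in> S \<Longrightarrow> f x = g x" "v \<in> pm.span S"
  shows "f v = g v"
  by (rule pp.linear_eq_on[OF assms(1,2,4,3)])

text \<open>
  This rule and its bilinear companion \<open>bilin_eq_on_coord\<close> carry almost all later computations: an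
  identity between (bi)linear expressions is reduced to basis vectors, where it is evaluated.
\<close>

lemma lin_eq_on_coord:
  assumes "lin f" "lin g" "\<And>b. b \<in> S \<Longrightarrow> f (bvec b) = g (bvec b)" "v \<in> coord_space S"
  shows "f v = g v"
proof (rule lin_eq_on_span[OF assms(1,2)])
  show "v \<in> pm.span (bvec ` S)"
    using assms(4) by (simp only: coord_space_eq_span)
qed (use assms(3) in blast)

lemma lin_eqI:
  assumes "lin f" "lin g" "\<And>b. f (bvec b) = g (bvec b)"
  shows "f v = g v"
  by (rule lin_eq_on_coord[of f g UNIV]) (use assms in auto)

lemma lin_eq_lin_ext: "lin f \<Longrightarrow> f v = lin_ext (\<lambda>b. f (bvec b)) v"
  by (rule lin_eqI) auto

subsection \<open>Bilinear maps and tensors\<close>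

lemma bilin_left: "bilin m \<Longrightarrow> lin (\<lambda>x. m x y)"
  and bilin_right: "bilin m \<Longrightarrow> lin (m x)"
  by (auto simp: bilin_def)

lemma bilin_eq_on_span:
  assumes "bilin m" "bilin n" "\<And>x y. x \<in> S \<Longrightarrow> y \<in> T \<Longrightarrow> m x y = n x y"
    and "v \<in> pm.span S" "w \<in> pm.span T"
  shows "m v w = n v w"
proof (rule lin_eq_on_span[of "\<lambda>v. m v w" "\<lambda>v. n v w", OF _ _ _ assms(4)])
  show "m x w = n x w" if "x \<in> S" for x
    by (rule lin_eq_on_span[of "m x" "n x", OF _ _ _ assms(5)])
      (use assms that in \<open>auto intro: bilin_right\<close>)
qed (use assms in \<open>auto intro: bilin_left\<close>)

lemma bilin_eq_on_coord:
  assumes "bilin m" "bilin n" "\<And>a b. a \<in> S \<Longrightarrow> b \<in> T \<Longrightarrow> m (bvec a) (bvec b) = n (bvec a) (bvec b)"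
    and "v \<in> coord_space S" "w \<in> coord_space T"
  shows "m v w = n v w"
proof (rule bilin_eq_on_span[OF assms(1,2)])
  show "v \<in> pm.span (bvec ` S)" "w \<in> pm.span (bvec ` T)"
    using assms(4,5) by (simp_all only: coord_space_eq_span)
qed (use assms(3) in blast)

lemma bilin_in_coord:
  assumes "bilin m" "\<And>a b. a \<in> S \<Longrightarrow> b \<in> T \<Longrightarrow> m (bvec a) (bvec b) \<in> W" "pm.subspace W"
    and "v \<in> coord_space S" "w \<in> coord_space T"
  shows "m v w \<in> W"
proof (rule lin_in_coord[OF bilin_left[OF assms(1)] _ assms(3,4)])
  show "m (bvec a) w \<in> W" if "a \<in> S" for a
    by (rule lin_in_coord[OF bilin_right[OF assms(1)] assms(2)[OF that] assms(3,5)])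
qed

lemma bilin_eqI:
  assumes "bilin m" "bilin n" "\<And>a b. m (bvec a) (bvec b) = n (bvec a) (bvec b)"
  shows "m v w = n v w"
  by (rule bilin_eq_on_coord[of m n UNIV UNIV]) (use assms in auto)

lemma bilin_bilin_ext [simp]: "bilin (bilin_ext f)"
  unfolding bilin_def bilin_ext_def by (auto intro: lin_lin_ext_param)

lemma bilin_ext_bvec [simp]: "bilin_ext f (bvec a) (bvec b) = f a b"
  by (simp add: bilin_ext_def)

lemma bilinI: "(\<And>x. lin (m x)) \<Longrightarrow> (\<And>y. lin (\<lambda>x. m x y)) \<Longrightarrow> bilin m"
  by (simp add: bilin_def)

lemma bilin_compose:
  assumes "bilin m" "lin f" "lin g"
  shows "bilin (\<lambda>x y. m (f x) (g y))"
  using assms lin_compose[OF bilin_left[OF assms(1)] assms(2)]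
    lin_compose[OF bilin_right[OF assms(1)] assms(3)]
  by (intro bilinI) auto

lemma lin_compose_bilin:
  assumes "lin f" "bilin m"
  shows "bilin (\<lambda>x y. f (m x y))"
  using lin_compose[OF assms(1) bilin_left[OF assms(2)]]
    lin_compose[OF assms(1) bilin_right[OF assms(2)]]
  by (intro bilinI) auto

lemma bilin_plus: "bilin m \<Longrightarrow> bilin n \<Longrightarrow> bilin (\<lambda>x y. m x y + n x y)"
  by (auto simp: bilin_def intro: lin_plus)

lemma bilin_tensor [simp]: "bilin tensor"
  by (simp add: tensor_def)

lemma tensor_bvec [simp]: "tensor (bvec a) (bvec b) = bvec (a, b)"
  by (simp add: tensor_def)

lemma lookup_tensor:
  "Poly_Mapping.lookup (tensor x y) (a, b) = Poly_Mapping.lookup x a * Poly_Mapping.lookup y b"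
proof -
  have inner: "Poly_Mapping.lookup (lin_ext (\<lambda>d. bvec (c, d)) y) (a, b) =
      (if c = a then Poly_Mapping.lookup y b else 0)" for c
  proof -
    have "Poly_Mapping.lookup (lin_ext (\<lambda>d. bvec (c, d)) y) (a, b) =
        (\<Sum>d\<in>Poly_Mapping.keys y. if d = b then (if c = a then Poly_Mapping.lookup y d else 0) else 0)"
      unfolding lookup_lin_ext by (intro sum.cong) (auto simp: lookup_bvec)
    then show ?thesis
      by (auto simp: not_in_keys_iff_lookup_eq_zero)
  qed
  have "Poly_Mapping.lookup (tensor x y) (a, b) =
      (\<Sum>c\<in>Poly_Mapping.keys x. if c = a then Poly_Mapping.lookup x c * Poly_Mapping.lookup y b else 0)"
    unfolding tensor_def bilin_ext_def lookup_lin_ext[of _ x] inner by (intro sum.cong) auto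
  then show ?thesis
    by (auto simp: not_in_keys_iff_lookup_eq_zero)
qed

lemmas tensor_scale_left = lin_scale[OF bilin_left[OF bilin_tensor]]
  and tensor_scale_right = lin_scale[OF bilin_right[OF bilin_tensor]]
  and tensor_add_left = lin_add[OF bilin_left[OF bilin_tensor]]
  and tensor_add_right = lin_add[OF bilin_right[OF bilin_tensor]]
  and tensor_zero_left = lin_0[OF bilin_left[OF bilin_tensor]]
  and tensor_zero_right = lin_0[OF bilin_right[OF bilin_tensor]]

lemma lin_tensor_map [simp]: "lin (tensor_map f g)"
  by (simp add: tensor_map_def)

lemma tensor_map_bvec [simp]: "tensor_map f g (bvec (a, b)) = tensor (f (bvec a)) (g (bvec b))"
  by (simp add: tensor_map_def)

lemma tensor_map_tensor:
  assumes "lin f" "lin g"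
  shows "tensor_map f g (tensor x y) = tensor (f x) (g y)"
  by (rule bilin_eqI[of "\<lambda>x y. tensor_map f g (tensor x y)" "\<lambda>x y. tensor (f x) (g y)"])
    (auto intro: lin_compose_bilin bilin_compose assms)

lemma subspace_tensor_space: "pm.subspace (tensor_space A B)"
  by (simp add: tensor_space_def)

lemma tensor_in_tensor_space: "x \<in> A \<Longrightarrow> y \<in> B \<Longrightarrow> tensor x y \<in> tensor_space A B"
  unfolding tensor_space_def by (intro pm.span_base) auto

lemma tensor_space_mono: "A \<subseteq> A' \<Longrightarrow> B \<subseteq> B' \<Longrightarrow> tensor_space A B \<subseteq> tensor_space A' B'"
  unfolding tensor_space_def by (rule pm.span_mono) auto

lemma coord_space_subset_tensor_space:
  "coord_space (S \<times> T) \<subseteq> tensor_space (coord_space S) (coord_space T)"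
  unfolding coord_space_eq_span[of "S \<times> T"]
proof (rule pm.span_minimal[OF _ subspace_tensor_space])
  have "tensor (bvec a) (bvec b) \<in> tensor_space (coord_space S) (coord_space T)" if "a \<in> S" "b \<in> T"
    for a b using that by (intro tensor_in_tensor_space) auto
  then show "bvec ` (S \<times> T) \<subseteq> tensor_space (coord_space S) (coord_space T)" by auto
qed

lemma tensor_map_in_tensor_space:
  assumes "lin f" "lin g" "\<And>x. x \<in> A \<Longrightarrow> f x \<in> A'" "\<And>y. y \<in> B \<Longrightarrow> g y \<in> B'"
    and "z \<in> tensor_space A B"
  shows "tensor_map f g z \<in> tensor_space A' B'"
  using assms(5) unfolding tensor_space_def[of A B]
proof (rule lin_in_span[OF lin_tensor_map, rotated 2])
  show "pm.subspace (tensor_space A' B')" by (rule subspace_tensor_space)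
qed (use assms in \<open>auto simp: tensor_map_tensor intro!: tensor_in_tensor_space\<close>)

lemma tensor_map_eq_on:
  assumes "lin f" "lin g" "lin f'" "lin g'"
    and "\<And>x. x \<in> A \<Longrightarrow> f x = f' x" "\<And>y. y \<in> B \<Longrightarrow> g y = g' y"
    and "z \<in> tensor_space A B"
  shows "tensor_map f g z = tensor_map f' g' z"
  using assms(7) unfolding tensor_space_def
  by (rule lin_eq_on_span[OF lin_tensor_map lin_tensor_map, rotated])
    (use assms in \<open>auto simp: tensor_map_tensor\<close>)

text \<open>
  \<open>tensor_map f g\<close> evaluates \<open>f\<close> and \<open>g\<close> on basis vectors only, so agreement there is enough even for
  maps that are not linear, such as the set-theoretic inverse of an isomorphism.
\<close>

lemma tensor_map_cong_coord:
  assumes "\<And>a. a \<in> S \<Longrightarrow> f (bvec a) = f' (bvec a)" "\<And>b. b \<in> T \<Longrightarrow> g (bvec b) = g' (bvec b)"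
    and "z \<in> coord_space (S \<times> T)"
  shows "tensor_map f g z = tensor_map f' g' z"
  using assms(3) by (rule lin_eq_on_coord[OF lin_tensor_map lin_tensor_map, rotated])
    (use assms in auto)

lemma tensor_map_compose:
  assumes "lin f'" "lin g'"
  shows "tensor_map f' g' (tensor_map f g z) = tensor_map (\<lambda>x. f' (f x)) (\<lambda>y. g' (g y)) z"
  by (rule lin_eqI[of "\<lambda>z. tensor_map f' g' (tensor_map f g z)"])
    (auto simp: tensor_map_tensor assms intro: lin_compose)

lemma tensor_map_tensor_bvec:
  assumes "lin g"
  shows "tensor_map f g (tensor (bvec a) y) = tensor (f (bvec a)) (g y)"
  by (rule lin_eqI[OF lin_compose[OF lin_tensor_map bilin_right[OF bilin_tensor]]
        lin_compose[OF bilin_right[OF bilin_tensor] assms]]) simp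

lemma tensor_map_left_tensor: "lin f \<Longrightarrow> tensor_map f id (tensor x y) = tensor (f x) y"
  by (simp add: tensor_map_tensor lin_id)

lemma tensor_map_zero: "tensor_map (\<lambda>_. 0) g z = 0"
  by (rule lin_eqI[OF lin_tensor_map lin_zero]) (auto simp: tensor_zero_left)

lemma bilin_tensor_mult [simp]: "bilin (tensor_mult m)"
  by (simp add: tensor_mult_def)

lemma tensor_mult_bvec [simp]:
  "tensor_mult m (bvec (a, b)) (bvec (c, d)) = tensor (m (bvec a) (bvec c)) (m (bvec b) (bvec d))"
  by (simp add: tensor_mult_def)

subsection \<open>Maps induced by maps of bases\<close>

definition basis_map :: "('a \<Rightarrow> 'b) \<Rightarrow> ('a, 'k::field) vec \<Rightarrow> ('b, 'k) vec" where
  "basis_map f = lin_ext (\<lambda>a. bvec (f a))"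

lemma lin_basis_map [simp]: "lin (basis_map f)"
  by (simp add: basis_map_def)

lemma basis_map_bvec [simp]: "basis_map f (bvec a) = bvec (f a)"
  by (simp add: basis_map_def)

lemma basis_map_in_coord_space:
  "v \<in> coord_space S \<Longrightarrow> (\<And>a. a \<in> S \<Longrightarrow> f a \<in> T) \<Longrightarrow> basis_map f v \<in> coord_space T"
  by (rule lin_in_coord[of _ S]) (auto simp: subspace_coord_space)

lemma basis_map_inverse:
  assumes "\<And>a. a \<in> S \<Longrightarrow> g (f a) = a" "v \<in> coord_space S"
  shows "basis_map g (basis_map f v) = v"
  by (rule lin_eq_on_coord[OF lin_compose[OF lin_basis_map lin_basis_map] lin_ident _ assms(2)])
    (simp add: assms(1))

lemma bij_betw_basis_map:
  assumes "bij_betw f S T"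
  shows "bij_betw (basis_map f) (coord_space S) (coord_space T)"
proof (rule bij_betw_byWitness[where f' = "basis_map (inv_into S f)"])
  show "\<forall>a\<in>coord_space S. basis_map (inv_into S f) (basis_map f a) = a"
    using assms by (intro ballI basis_map_inverse[of S]) (auto simp: bij_betw_inv_into_left)
  show "\<forall>a\<in>coord_space T. basis_map f (basis_map (inv_into S f) a) = a"
    using assms by (intro ballI basis_map_inverse[of T]) (auto simp: bij_betw_inv_into_right)
  show "basis_map f ` coord_space S \<subseteq> coord_space T"
    using assms by (auto intro!: basis_map_in_coord_space simp: bij_betwE)
  show "basis_map (inv_into S f) ` coord_space T \<subseteq> coord_space S"
    using bij_betw_inv_into[OF assms] by (auto intro!: basis_map_in_coord_space simp: bij_betwE)
qed

lemma basis_map_image_coord: "basis_map f ` coord_space S = coord_space (f ` S)"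
  unfolding coord_space_eq_span lin_span_image[OF lin_basis_map] by (simp add: image_image)

subsection \<open>Coefficients and slices\<close>

lemma sum_coeffs_eq_lin_ext:
  "vscale (\<Sum>b\<in>Poly_Mapping.keys v. Poly_Mapping.lookup v b) x = lin_ext (\<lambda>_. x) v"
  by (simp add: lin_ext_def pm.scale_sum_left)

text \<open>
  The predicate \<open>lin\<close> only speaks about maps between free spaces. A linear form \<open>\<epsilon>\<close> is therefore
  handled through \<open>\<lambda>x. vscale (\<epsilon> x) (bvec ())\<close>, and this lemma returns to scalars.
\<close>

lemma vscale_bvec_inject: "vscale a (bvec x) = vscale b (bvec x) \<Longrightarrow> a = b"
  by (drule arg_cong[of _ _ "\<lambda>v. Poly_Mapping.lookup v x"]) (simp add: lookup_vscale lookup_bvec)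

lemma lookup_lin_ext_delta:
  assumes "v \<in> coord_space S" "\<And>b. b \<in> S \<Longrightarrow> Poly_Mapping.lookup (f b) c = (if b = b0 then 1 else 0)"
  shows "Poly_Mapping.lookup (lin_ext f v) c = Poly_Mapping.lookup v b0"
proof -
  have "Poly_Mapping.lookup (lin_ext f v) c =
      (\<Sum>b\<in>Poly_Mapping.keys v. if b = b0 then Poly_Mapping.lookup v b else 0)"
    unfolding lookup_lin_ext using assms by (intro sum.cong) (auto simp: coord_space_def)
  then show ?thesis by (auto simp: not_in_keys_iff_lookup_eq_zero)
qed

lemma lookup_lin_ext_zero:
  assumes "v \<in> coord_space S" "\<And>b. b \<in> S \<Longrightarrow> Poly_Mapping.lookup (f b) c = 0"
  shows "Poly_Mapping.lookup (lin_ext f v) c = 0"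
  unfolding lookup_lin_ext using assms by (intro sum.neutral) (auto simp: coord_space_def)

lemma lookup_tensor_mult_cong:
  assumes s: "s \<in> coord_space (S \<times> S)" and t: "t \<in> coord_space (S \<times> S)"
    and p: "\<And>a b. a \<in> S \<Longrightarrow> b \<in> S \<Longrightarrow>
      Poly_Mapping.lookup (m (bvec a) (bvec b)) p = Poly_Mapping.lookup (m' (bvec a) (bvec b)) p"
    and q: "\<And>a b. a \<in> S \<Longrightarrow> b \<in> S \<Longrightarrow>
      Poly_Mapping.lookup (m (bvec a) (bvec b)) q = Poly_Mapping.lookup (m' (bvec a) (bvec b)) q"
  shows "Poly_Mapping.lookup (tensor_mult m s t) (p, q) = Poly_Mapping.lookup (tensor_mult m' s t) (p, q)"
  unfolding tensor_mult_def bilin_ext_def lookup_lin_ext[of _ s]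
proof (rule sum.cong[OF refl])
  fix ab assume "ab \<in> Poly_Mapping.keys s"
  then obtain a b where ab: "ab = (a, b)" "a \<in> S" "b \<in> S" using s by (auto simp: coord_space_def)
  have "Poly_Mapping.lookup (lin_ext (\<lambda>(c, d). tensor (m (bvec a) (bvec c)) (m (bvec b) (bvec d))) t) (p, q) =
      Poly_Mapping.lookup (lin_ext (\<lambda>(c, d). tensor (m' (bvec a) (bvec c)) (m' (bvec b) (bvec d))) t) (p, q)"
    unfolding lookup_lin_ext using t ab
    by (intro sum.cong) (auto simp: lookup_tensor coord_space_def p q)
  then show "Poly_Mapping.lookup s ab * Poly_Mapping.lookup (lin_ext ((\<lambda>(a, b) (c, d).
        tensor (m (bvec a) (bvec c)) (m (bvec b) (bvec d))) ab) t) (p, q) =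
      Poly_Mapping.lookup s ab * Poly_Mapping.lookup (lin_ext ((\<lambda>(a, b) (c, d).
        tensor (m' (bvec a) (bvec c)) (m' (bvec b) (bvec d))) ab) t) (p, q)"
    by (simp add: ab)
qed

text \<open>
  Applied after a left coaction, \<open>left_slice k\<close> is the projection to the homogeneous component of degree \<open>k\<close>
  for the grading given by the coaction.
\<close>

definition left_slice :: "'a \<Rightarrow> ('a \<times> 'b, 'k::field) vec \<Rightarrow> ('b, 'k) vec" where
  "left_slice k = lin_ext (\<lambda>(a, b). if a = k then bvec b else 0)"

lemma lin_left_slice [simp]: "lin (left_slice k)"
  by (simp add: left_slice_def)

lemma left_slice_tensor:
  fixes x :: "('a, 'k::field) vec" and y :: "('b, 'k) vec"
  shows "left_slice c (tensor x y) = vscale (Poly_Mapping.lookup x c) y"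
proof (rule bilin_eqI[of "\<lambda>x y. left_slice c (tensor x y)" "\<lambda>x y. vscale (Poly_Mapping.lookup x c) y"])
  show "bilin (\<lambda>(x :: ('a, 'k) vec) (y :: ('b, 'k) vec). vscale (Poly_Mapping.lookup x c) y)"
    by (intro bilinI linI)
      (simp_all add: lookup_add lookup_vscale pm.scale_left_distrib pm.scale_right_distrib mult.commute)
  show "bilin (\<lambda>(x :: ('a, 'k) vec) (y :: ('b, 'k) vec). left_slice c (tensor x y))"
    by (rule lin_compose_bilin) simp_all
qed (simp add: left_slice_def lookup_bvec)

text \<open>
  The counterpart of \<open>left_slice\<close> for right coactions.
\<close>

definition right_slice :: "'b \<Rightarrow> ('a \<times> 'b, 'k::field) vec \<Rightarrow> ('a, 'k) vec" where
  "right_slice c = lin_ext (\<lambda>(a, b). if b = c then bvec a else 0)"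

lemma lin_right_slice [simp]: "lin (right_slice c)"
  by (simp add: right_slice_def)

lemma right_slice_bvec [simp]: "right_slice c (bvec (a, b)) = (if b = c then bvec a else 0)"
  by (simp add: right_slice_def)

lemma right_slice_tensor_bvec: "right_slice c (tensor x (bvec b)) = (if b = c then x else 0)"
proof (cases "b = c")
  case True
  have "right_slice c (tensor x (bvec c)) = x"
    by (rule lin_eqI[OF lin_compose[OF lin_right_slice bilin_left[OF bilin_tensor]] lin_ident]) simp
  then show ?thesis using True by simp
next
  case False
  have "right_slice c (tensor x (bvec b)) = 0"
    by (rule lin_eqI[OF lin_compose[OF lin_right_slice bilin_left[OF bilin_tensor]] lin_zero]) (simp add: False)
  then show ?thesis using False by simp
qed

section \<open>Simultaneous eigenbases\<close>

lemma span_family_expand: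
  assumes "v \<in> pm.span (c ` J)"
  obtains T r where "finite T" "T \<subseteq> J" "v = (\<Sum>j\<in>T. vscale (r j) (c j))"
proof -
  obtain t r where t: "finite t" "t \<subseteq> c ` J" and v: "v = (\<Sum>a\<in>t. vscale (r a) a)"
    using assms unfolding pm.span_explicit by blast
  obtain T where T: "T \<subseteq> J" "finite T" "c ` T = t" "inj_on c T"
    using t by (metis finite_image_iff subset_image_inj)
  have "v = (\<Sum>j\<in>T. vscale (r (c j)) (c j))"
    unfolding v T(3)[symmetric] by (simp add: sum.reindex[OF T(4)])
  then show thesis using T that[of T "\<lambda>j. r (c j)"] by blast
qed

lemma independent_family_coeff_0:
  assumes "inj_on c J" "pm.independent (c ` J)" "finite T" "T \<subseteq> J"
    and "(\<Sum>j\<in>T. vscale (r j) (c j)) = 0" "j \<in> T"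
  shows "r j = 0"
proof -
  have inj: "inj_on c T" using assms inj_on_subset by blast
  have "(\<Sum>a\<in>c ` T. vscale (r (the_inv_into T c a)) a) = 0"
    unfolding sum.reindex[OF inj] using assms(5) inj
    by (simp add: the_inv_into_f_f cong: sum.cong)
  then have "r (the_inv_into T c (c j)) = 0"
    by (rule pm.independentD[OF assms(2), rotated 2]) (use assms in auto)
  then show ?thesis using the_inv_into_f_f[OF inj] assms(6) by simp
qed

text \<open>
  Expand \<open>v\<close> in the eigenbasis and apply \<open>A s - l s\<close>: by independence, each coefficient times
  \<open>\<mu> j s - l s\<close> vanishes, so only basis vectors with the eigenvalues of \<open>v\<close> can occur.
\<close>

lemma eigenvector_in_span:
  fixes A :: "'s \<Rightarrow> ('b, 'k::field) vec \<Rightarrow> ('b, 'k) vec"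
  assumes lin: "\<And>s. s \<in> S \<Longrightarrow> lin (A s)"
    and c: "inj_on c J" "pm.independent (c ` J)"
    and eig: "\<And>j s. j \<in> J \<Longrightarrow> s \<in> S \<Longrightarrow> A s (c j) = vscale (\<mu> j s) (c j)"
    and v: "v \<in> pm.span (c ` J)" "\<And>s. s \<in> S \<Longrightarrow> A s v = vscale (l s) v"
  shows "v \<in> pm.span (c ` {j \<in> J. \<forall>s\<in>S. \<mu> j s = l s})"
proof -
  obtain T r where T: "finite T" "T \<subseteq> J" and vT: "v = (\<Sum>j\<in>T. vscale (r j) (c j))"
    using span_family_expand[OF v(1)] .
  \<comment> \<open>the coefficients of \<open>A s v - l s v = 0\<close>\<close>
  have zero: "r j * (\<mu> j s - l s) = 0" if "j \<in> T" "s \<in> S" for j s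
  proof -
    have "(\<Sum>j\<in>T. vscale (r j * (\<mu> j s - l s)) (c j)) =
        (\<Sum>j\<in>T. vscale (r j) (A s (c j))) - (\<Sum>j\<in>T. vscale (l s) (vscale (r j) (c j)))"
      unfolding sum_subtractf[symmetric]
      using T that eig by (intro sum.cong) (auto simp: algebra_simps pm.scale_left_diff_distrib)
    also have "\<dots> = A s v - vscale (l s) v"
      using lin[OF that(2)] by (simp add: vT lin_sum lin_scale pm.scale_sum_right)
    also have "\<dots> = 0" using v(2) that by simp
    finally show ?thesis
      by (rule independent_family_coeff_0[OF c T _ that(1)])
  qed
  have "vscale (r j) (c j) \<in> pm.span (c ` {j \<in> J. \<forall>s\<in>S. \<mu> j s = l s})" if "j \<in> T" for j
  proof (cases "r j = 0")
    case False
    then have "j \<in> {j \<in> J. \<forall>s\<in>S. \<mu> j s = l s}"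
      using zero that T by auto
    then show ?thesis by (intro pm.span_scale pm.span_base imageI)
  qed (simp add: pm.span_zero)
  then show ?thesis unfolding vT by (rule pm.span_sum)
qed

text \<open>
  The members of either basis with a prescribed system \<open>l\<close> of eigenvalues span the same common
  eigenspace, by the previous lemma in both directions. Bases of one vector space are in bijection, and the
  bijections for the different \<open>l\<close> fit together.
\<close>

lemma eigenbasis_matching:
  fixes A :: "'s \<Rightarrow> ('b, 'k::field) vec \<Rightarrow> ('b, 'k) vec"
  assumes lin: "\<And>s. s \<in> S \<Longrightarrow> lin (A s)"
    and b: "inj_on b I" "pm.independent (b ` I)"
    and beig: "\<And>i s. i \<in> I \<Longrightarrow> s \<in> S \<Longrightarrow> A s (b i) = vscale (\<kappa> i s) (b i)"
    and c: "inj_on c J" "pm.independent (c ` J)"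
    and ceig: "\<And>j s. j \<in> J \<Longrightarrow> s \<in> S \<Longrightarrow> A s (c j) = vscale (\<mu> j s) (c j)"
    and span: "pm.span (b ` I) = pm.span (c ` J)"
  obtains \<sigma> where "bij_betw \<sigma> I J" "\<And>i s. i \<in> I \<Longrightarrow> s \<in> S \<Longrightarrow> \<mu> (\<sigma> i) s = \<kappa> i s"
proof -
  define I' where "I' l = {i \<in> I. \<forall>s\<in>S. \<kappa> i s = l s}" for l
  define J' where "J' l = {j \<in> J. \<forall>s\<in>S. \<mu> j s = l s}" for l
  have "\<exists>f. bij_betw f (I' l) (J' l)" for l
  proof -
    have "pm.span (b ` I' l) = pm.span (c ` J' l)"
    proof
      have "b i \<in> pm.span (c ` J' l)" if i: "i \<in> I' l" for i
        unfolding J'_def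
      proof (rule eigenvector_in_span[OF lin c ceig])
        show "b i \<in> pm.span (c ` J)"
          using i unfolding span[symmetric] I'_def by (intro pm.span_base) auto
        show "A s (b i) = vscale (l s) (b i)" if "s \<in> S" for s
          using i beig that unfolding I'_def by auto
      qed
      then show "pm.span (b ` I' l) \<subseteq> pm.span (c ` J' l)"
        by (intro pm.span_minimal) auto
    next
      have "c j \<in> pm.span (b ` I' l)" if j: "j \<in> J' l" for j
        unfolding I'_def
      proof (rule eigenvector_in_span[OF lin b beig])
        show "c j \<in> pm.span (b ` I)"
          using j unfolding span J'_def by (intro pm.span_base) auto
        show "A s (c j) = vscale (l s) (c j)" if "s \<in> S" for s
          using j ceig that unfolding J'_def by auto
      qed
      then show "pm.span (c ` J' l) \<subseteq> pm.span (b ` I' l)"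
        by (intro pm.span_minimal) auto
    qed
    moreover have "pm.independent (b ` I' l)" "pm.independent (c ` J' l)"
      by (rule pm.independent_mono[OF b(2)] pm.independent_mono[OF c(2)]; auto simp: I'_def J'_def)+
    ultimately obtain h where "bij_betw h (b ` I' l) (c ` J' l)"
      using pm.bij_if_span_eq_span_bases by blast
    moreover have "bij_betw b (I' l) (b ` I' l)" "bij_betw c (J' l) (c ` J' l)"
      using b(1) c(1) by (auto simp: I'_def J'_def bij_betw_def intro: inj_on_subset)
    ultimately show ?thesis
      by (meson bij_betw_inv_into bij_betw_trans)
  qed
  then obtain \<tau> where \<tau>: "\<And>l. bij_betw (\<tau> l) (I' l) (J' l)"
    by metis
  \<comment> \<open>eigenvalues matter on \<open>S\<close> only; restricting makes equal systems equal as functions\<close>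
  define \<sigma> where "\<sigma> i = \<tau> (restrict (\<kappa> i) S) i" for i
  have I'I: "i \<in> I' (restrict (\<kappa> i) S)" if "i \<in> I" for i
    using that by (auto simp: I'_def)
  have \<sigma>J': "\<sigma> i \<in> J' (restrict (\<kappa> i) S)" if "i \<in> I" for i
    using \<tau> I'I[OF that] unfolding \<sigma>_def by (meson bij_betwE)
  then have lab: "\<mu> (\<sigma> i) s = \<kappa> i s" if "i \<in> I" "s \<in> S" for i s
    using that by (auto simp: J'_def)
  have "bij_betw \<sigma> I J"
  proof (rule bij_betwI')
    fix i i' assume i: "i \<in> I" "i' \<in> I"
    have "i = i'" if eq: "\<sigma> i = \<sigma> i'"
    proof -
      have l: "restrict (\<kappa> i) S = restrict (\<kappa> i') S"
        using lab[OF i(1)] lab[OF i(2)] eq by (auto simp: restrict_def)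
      show ?thesis
        using eq I'I[OF i(1)] I'I[OF i(2)] \<tau>[of "restrict (\<kappa> i') S"]
        unfolding \<sigma>_def l bij_betw_def inj_on_def by blast
    qed
    then show "\<sigma> i = \<sigma> i' \<longleftrightarrow> i = i'" by blast
  next
    show "\<sigma> i \<in> J" if "i \<in> I" for i
      using \<sigma>J'[OF that] by (simp add: J'_def)
  next
    fix j assume j: "j \<in> J"
    let ?l = "restrict (\<mu> j) S"
    have "j \<in> J' ?l" using j by (simp add: J'_def)
    then obtain i where i: "i \<in> I' ?l" "\<tau> ?l i = j"
      using \<tau>[of ?l] by (metis bij_betw_iff_bijections)
    moreover have "restrict (\<kappa> i) S = ?l"
      using i(1) by (auto simp: I'_def restrict_def)
    ultimately show "\<exists>i\<in>I. j = \<sigma> i"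
      unfolding \<sigma>_def by (intro bexI[of _ i]) (auto simp: I'_def)
  qed
  then show thesis using lab that by blast
qed

section \<open>Isomorphisms of group algebras\<close>

lemma group_algebra_simps [simp]:
  "bspace (group_algebra G) = coord_space (carrier G)"
  "bone (group_algebra G) = bvec \<one>\<^bsub>G\<^esub>"
  "bmult (group_algebra G) (bvec g) (bvec h) = bvec (g \<otimes>\<^bsub>G\<^esub> h)"
  "bcomult (group_algebra G) (bvec g) = bvec (g, g)"
  "bcounit (group_algebra G) (bvec g) = 1"
  "bilin (bmult (group_algebra G))"
  "lin (bcomult (group_algebra G))"
  by (simp_all add: group_algebra_def lookup_bvec)

lemma bcounit_group_algebra:
  "vscale (bcounit (group_algebra G) v) x = lin_ext (\<lambda>_. x) v"
  by (simp add: group_algebra_def sum_coeffs_eq_lin_ext)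

lemma bcounit_basis_map:
  "bcounit (group_algebra G') (basis_map \<psi> x) = bcounit (group_algebra G) x"
proof (rule vscale_bvec_inject)
  show "vscale (bcounit (group_algebra G') (basis_map \<psi> x)) (bvec ()) =
    vscale (bcounit (group_algebra G) x) (bvec ())"
    unfolding bcounit_group_algebra by (rule lin_eqI[OF lin_compose]) auto
qed

text \<open>
  Comparing coefficients at \<open>(a, b)\<close> shows that the coefficients of a grouplike element are
  orthogonal idempotents of the field, so exactly one of them is 1.
\<close>

lemma grouplike_is_bvec:
  fixes v :: "('g, 'k::field) vec"
  assumes "lin_ext (\<lambda>g. bvec (g, g)) v = tensor v v" "v \<noteq> 0"
  obtains h where "v = bvec h"
proof -
  have l: "Poly_Mapping.lookup v a * Poly_Mapping.lookup v b =
      (if a = b then Poly_Mapping.lookup v a else 0)" for a b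
  proof -
    have "Poly_Mapping.lookup v a * Poly_Mapping.lookup v b =
        Poly_Mapping.lookup (lin_ext (\<lambda>g. bvec (g, g)) v) (a, b)"
      by (simp add: assms(1) lookup_tensor)
    also have "\<dots> = (\<Sum>g\<in>Poly_Mapping.keys v.
        if g = a then (if a = b then Poly_Mapping.lookup v a else 0) else 0)"
      unfolding lookup_lin_ext by (intro sum.cong) (auto simp: lookup_bvec)
    also have "\<dots> = (if a = b then Poly_Mapping.lookup v a else 0)"
      by (auto simp: not_in_keys_iff_lookup_eq_zero)
    finally show ?thesis .
  qed
  obtain h where h: "Poly_Mapping.lookup v h \<noteq> 0"
    using assms(2) by (metis lookup_zero poly_mapping_eqI)
  then have "Poly_Mapping.lookup v h = 1"
    using l[of h h] by simp
  moreover have "Poly_Mapping.lookup v b = 0" if "b \<noteq> h" for b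
    using l[of h b] h that by simp
  ultimately have "v = bvec h"
    by (intro poly_mapping_eqI) (auto simp: lookup_bvec)
  then show thesis by (rule that)
qed

lemma hopf_iso_group_algebra_basis:
  assumes "group G" "group G'"
    and iso: "hopf_iso (group_algebra G :: ('g, 'k::field) bialg) (group_algebra G' :: ('h, 'k) bialg) \<phi>"
  obtains \<psi> where "\<psi> \<in> iso G G'" "\<And>g. g \<in> carrier G \<Longrightarrow> \<phi> (bvec g) = bvec (\<psi> g)"
proof -
  interpret G: group G by fact
  have lin: "lin \<phi>" and bij: "bij_betw \<phi> (coord_space (carrier G)) (coord_space (carrier G'))"
    and mult: "\<And>x y. x \<in> coord_space (carrier G) \<Longrightarrow> y \<in> coord_space (carrier G) \<Longrightarrow>
       \<phi> (bmult (group_algebra G) x y) = bmult (group_algebra G') (\<phi> x) (\<phi> y)"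
    and comult: "\<And>x. x \<in> coord_space (carrier G) \<Longrightarrow>
       bcomult (group_algebra G') (\<phi> x) = tensor_map \<phi> \<phi> (bcomult (group_algebra G) x)"
    using iso by (simp_all add: hopf_iso_def)
  have "\<exists>h. \<phi> (bvec g) = bvec h" if g: "g \<in> carrier G" for g
  proof -
    have "lin_ext (\<lambda>g. bvec (g, g)) (\<phi> (bvec g)) = tensor (\<phi> (bvec g)) (\<phi> (bvec g))"
      using comult[of "bvec g"] g by (simp add: group_algebra_def)
    moreover have "\<phi> (bvec g) \<noteq> 0"
    proof
      assume "\<phi> (bvec g) = 0"
      then have "\<phi> (bvec g) = \<phi> 0" by (simp add: lin_0[OF lin])
      then have "bvec g = (0 :: ('g, 'k) vec)"
        by (rule inj_onD[OF bij_betw_imp_inj_on[OF bij]])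
          (use g pm.subspace_0[OF subspace_coord_space] in auto)
      then show False by simp
    qed
    ultimately show ?thesis using grouplike_is_bvec by blast
  qed
  then obtain \<psi> where \<psi>: "\<And>g. g \<in> carrier G \<Longrightarrow> \<phi> (bvec g) = bvec (\<psi> g)"
    by metis
  have carr: "\<psi> g \<in> carrier G'" if "g \<in> carrier G" for g
    using bij_betwE[OF bij, rule_format, of "bvec g"] that \<psi> by simp
  have "\<psi> \<in> iso G G'"
    unfolding iso_def mem_Collect_eq
  proof (intro conjI homI bij_betw_imageI inj_onI equalityI subsetI)
    show "\<psi> (x \<otimes>\<^bsub>G\<^esub> y) = \<psi> x \<otimes>\<^bsub>G'\<^esub> \<psi> y" if "x \<in> carrier G" "y \<in> carrier G" for x y
      using mult[of "bvec x" "bvec y"] that by (simp add: \<psi>)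
    show "x = y" if "x \<in> carrier G" "y \<in> carrier G" "\<psi> x = \<psi> y" for x y
      using inj_onD[OF bij_betw_imp_inj_on[OF bij], of "bvec x" "bvec y"] that \<psi> by simp
    fix h assume "h \<in> carrier G'"
    then have "bvec h \<in> \<phi> ` coord_space (carrier G)"
      using bij by (simp add: bij_betw_def)
    then obtain v where v: "v \<in> coord_space (carrier G)" "bvec h = \<phi> v" by blast
    have "\<phi> v \<in> coord_space (\<psi> ` carrier G)"
      by (rule lin_in_coord[OF lin _ subspace_coord_space v(1)]) (simp add: \<psi>)
    then show "h \<in> \<psi> ` carrier G" by (simp flip: v(2))
  qed (use carr in auto)
  then show thesis using \<psi> that by blast
qed

lemma hopf_iso_basis_map:
  assumes "group G" "group G'" "\<psi> \<in> iso G G'"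
  shows "hopf_iso (group_algebra G) (group_algebra G') (basis_map \<psi>)"
proof -
  interpret G: group G by fact
  have hom: "\<psi> \<in> hom G G'" and bij: "bij_betw \<psi> (carrier G) (carrier G')"
    using assms by (auto simp: iso_def)
  have mult: "basis_map \<psi> (bmult (group_algebra G) x y) =
      bmult (group_algebra G') (basis_map \<psi> x) (basis_map \<psi> y)"
    if "x \<in> coord_space (carrier G)" "y \<in> coord_space (carrier G)" for x y :: "('a, 'c) vec"
    by (rule bilin_eq_on_coord[OF lin_compose_bilin bilin_compose _ that])
      (use hom in \<open>auto simp: hom_mult\<close>)
  have comult: "bcomult (group_algebra G') (basis_map \<psi> x) =
      tensor_map (basis_map \<psi>) (basis_map \<psi>) (bcomult (group_algebra G) x)"
    for x :: "('a, 'c) vec"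
    by (rule lin_eqI[OF lin_compose lin_compose]) auto
  show ?thesis
    unfolding hopf_iso_def using bij_betw_basis_map[OF bij] mult comult bcounit_basis_map hom_one[OF hom assms(1,2)]
    by auto
qed

section \<open>Yetter-Drinfeld modules with an eigenbasis\<close>

text \<open>
  A family that diagonalizes the module: \<open>b j\<close> is homogeneous of degree \<open>d j\<close> and the group acts on it
  through the scalars \<open>c j\<close>.
\<close>

definition yd_eigenbasis ::
  "'g monoid \<Rightarrow> ('g, 'b, 'k::field) yd_mod \<Rightarrow> 'i set \<Rightarrow> ('i \<Rightarrow> ('b, 'k) vec) \<Rightarrow> ('i \<Rightarrow> 'g) \<Rightarrow>
   ('i \<Rightarrow> 'g \<Rightarrow> 'k) \<Rightarrow> bool" where
  "yd_eigenbasis G X J b d c \<longleftrightarrow>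
     bilin (yact X) \<and> lin (ycoact X) \<and> pm.subspace (yspace X) \<and>
     inj_on b J \<and> pm.independent (b ` J) \<and>
     (\<forall>j\<in>J. b j \<in> yspace X \<and> d j \<in> carrier G \<and>
        ycoact X (b j) = tensor (bvec (d j)) (b j) \<and>
        (\<forall>g\<in>carrier G. yact X (bvec g) (b j) = vscale (c j g) (b j)))"

text \<open>
  An isomorphism \<open>\<phi>\<close> of group algebras together with the group isomorphism \<open>\<psi>\<close> that induces it on
  group elements; outside the group algebras \<open>\<phi>\<close> is arbitrary.
\<close>

locale group_algebra_iso =
  fixes G :: "'g monoid" and G' :: "'h monoid"
    and \<phi> :: "('g, 'k::field) vec \<Rightarrow> ('h, 'k) vec" and \<psi> :: "'g \<Rightarrow> 'h"
  assumes G: "group G" and G': "group G'"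
    and hopf: "hopf_iso (group_algebra G) (group_algebra G') \<phi>"
    and psi: "\<psi> \<in> iso G G'"
    and phi_bvec: "\<And>g. g \<in> carrier G \<Longrightarrow> \<phi> (bvec g) = bvec (\<psi> g)"
begin

lemma lin_phi: "lin \<phi>"
  and bij_phi: "bij_betw \<phi> (coord_space (carrier G)) (coord_space (carrier G'))"
  using hopf by (auto simp: hopf_iso_def)

lemma hom_psi: "\<psi> \<in> hom G G'"
  and bij_psi: "bij_betw \<psi> (carrier G) (carrier G')"
  using psi by (auto simp: iso_def)

lemma psi_carrier: "g \<in> carrier G \<Longrightarrow> \<psi> g \<in> carrier G'"
  using bij_psi by (rule bij_betwE[rule_format])

lemma inv_phi_bvec:
  assumes "g \<in> carrier G"
  shows "inv_into (coord_space (carrier G)) \<phi> (bvec (\<psi> g)) = bvec g"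
  using inv_into_f_f[OF bij_betw_imp_inj_on[OF bij_phi], of "bvec g"] assms phi_bvec by simp

lemma twisted_coact:
  assumes "yd_eigenbasis G' X' J' b' d' c'" "j \<in> J'" "d' j = \<psi> g" "g \<in> carrier G"
  shows "ycoact (yd_twist (group_algebra G) \<phi> X') (b' j) = tensor (bvec g) (b' j)"
  using assms inv_phi_bvec
  by (simp add: yd_eigenbasis_def yd_twist_def tensor_map_tensor_bvec lin_id)

text \<open>
  The operators are the actions of the group elements and the projections to the components of the
  coaction. An isomorphism \<open>f\<close> carries the eigenbasis of \<open>X\<close> to a second eigenbasis inside \<open>X'\<close>, and
  \<open>eigenbasis_matching\<close> compares it with the given one.
\<close>

lemma yd_iso_matching:
  assumes X: "yd_eigenbasis G X J b d c" and X': "yd_eigenbasis G' X' J' b' d' c'"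
    and f: "yd_iso (group_algebra G) X (yd_twist (group_algebra G) \<phi> X') f"
    and span: "f ` pm.span (b ` J) = pm.span (b' ` J')"
  shows "\<exists>\<sigma>. bij_betw \<sigma> J J' \<and>
    (\<forall>j\<in>J. \<psi> (d j) = d' (\<sigma> j) \<and> (\<forall>g\<in>carrier G. c' (\<sigma> j) (\<psi> g) = c j g))"
proof -
  let ?X = "yd_twist (group_algebra G) \<phi> X'"
  let ?\<theta> = "inv_into (carrier G) \<psi>"
  \<comment> \<open>\<open>Inl g\<close> stands for the action of \<open>g\<close>, \<open>Inr k\<close> for the component of degree \<open>k\<close>\<close>
  define A where "A s = (case s of Inl g \<Rightarrow> yact ?X (bvec g) | Inr k \<Rightarrow> (\<lambda>x. left_slice k (ycoact ?X x)))"
    for s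
  let ?S = "Inl ` carrier G \<union> Inr ` carrier G"
  define \<kappa> where "\<kappa> j s = (case s of Inl g \<Rightarrow> c j g | Inr k \<Rightarrow> if k = d j then 1 else 0)" for j s
  define \<mu> where "\<mu> j s = (case s of Inl g \<Rightarrow> c' j (\<psi> g) | Inr k \<Rightarrow> if k = ?\<theta> (d' j) then 1 else 0)"
    for j s
  have linf: "lin f" and bijf: "bij_betw f (yspace X) (yspace X')"
    and actf: "\<And>g x. g \<in> carrier G \<Longrightarrow> x \<in> yspace X \<Longrightarrow> f (yact X (bvec g) x) = yact ?X (bvec g) (f x)"
    and coactf: "\<And>x. x \<in> yspace X \<Longrightarrow> ycoact ?X (f x) = tensor_map id f (ycoact X x)"
    using f by (auto simp: yd_iso_def yd_twist_def)
  have sub: "pm.span (b ` J) \<subseteq> yspace X"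
    using X unfolding yd_eigenbasis_def by (intro pm.span_minimal) auto
  have injf: "inj_on f (pm.span (b ` J))"
    using bij_betw_imp_inj_on[OF bijf] sub by (rule inj_on_subset)
  have \<theta>: "?\<theta> (d' j) \<in> carrier G" "\<psi> (?\<theta> (d' j)) = d' j" if "j \<in> J'" for j
  proof -
    have "d' j \<in> carrier G'" using X' that by (simp add: yd_eigenbasis_def)
    then show "?\<theta> (d' j) \<in> carrier G" "\<psi> (?\<theta> (d' j)) = d' j"
      using bij_psi by (auto simp: bij_betw_inv_into_right inv_into_into bij_betw_imp_surj_on)
  qed
  obtain \<sigma> where \<sigma>: "bij_betw \<sigma> J J'"
    and match: "\<And>i s. i \<in> J \<Longrightarrow> s \<in> ?S \<Longrightarrow> \<mu> (\<sigma> i) s = \<kappa> i s"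
  proof (rule eigenbasis_matching[of ?S A "\<lambda>j. f (b j)" J \<kappa> b' J' \<mu>])
    show "lin (A s)" if "s \<in> ?S" for s
    proof (cases s)
      case (Inl g)
      then show ?thesis
        using X' bilin_right[of "yact X'"] by (simp add: A_def yd_twist_def yd_eigenbasis_def)
    next
      case (Inr k)
      have "lin (\<lambda>x. left_slice k (tensor_map (inv_into (coord_space (carrier G)) \<phi>) id (ycoact X' x)))"
        using X' unfolding yd_eigenbasis_def by (intro lin_compose[OF lin_left_slice lin_compose[OF lin_tensor_map]]) blast
      then show ?thesis using Inr by (simp add: A_def yd_twist_def)
    qed
    show "inj_on (\<lambda>j. f (b j)) J"
      using X injf pm.span_superset[of "b ` J"] comp_inj_on[of b J f] inj_on_subset[of f _ "b ` J"]
      unfolding yd_eigenbasis_def o_def by blast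
    show "pm.independent ((\<lambda>j. f (b j)) ` J)"
      using X pp.linear_independent_injective_image[OF linf _ injf]
      unfolding yd_eigenbasis_def by (simp add: image_image)
    show "A s (f (b i)) = vscale (\<kappa> i s) (f (b i))" if i: "i \<in> J" and s: "s \<in> ?S" for i s
    proof (cases s)
      case (Inl g)
      then have g: "g \<in> carrier G" using s by auto
      have bi: "b i \<in> yspace X" "yact X (bvec g) (b i) = vscale (c i g) (b i)"
        using X i g by (simp_all add: yd_eigenbasis_def)
      show ?thesis
        using actf[OF g bi(1)] Inl by (simp add: A_def \<kappa>_def bi(2) lin_scale[OF linf])
    next
      case (Inr k)
      have "ycoact ?X (f (b i)) = tensor (bvec (d i)) (f (b i))"
        using i X coactf unfolding yd_eigenbasis_def by (simp add: tensor_map_tensor_bvec linf)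
      then show ?thesis
        using Inr by (simp add: A_def \<kappa>_def left_slice_tensor lookup_bvec)
    qed
    show "A s (b' j) = vscale (\<mu> j s) (b' j)" if j: "j \<in> J'" and s: "s \<in> ?S" for j s
    proof (cases s)
      case (Inl g)
      then show ?thesis
        using s j X' psi_carrier phi_bvec unfolding A_def \<mu>_def yd_eigenbasis_def
        by (auto simp: yd_twist_def)
    next
      case (Inr k)
      then show ?thesis
        using twisted_coact[OF X' j, of "?\<theta> (d' j)"] \<theta>[OF j]
        by (simp add: A_def \<mu>_def left_slice_tensor lookup_bvec)
    qed
    show "pm.span ((\<lambda>j. f (b j)) ` J) = pm.span (b' ` J')"
      using span unfolding lin_span_image[OF linf] image_image .
  qed (use X' in \<open>auto simp: yd_eigenbasis_def\<close>)
  have "\<psi> (d j) = d' (\<sigma> j)" if j: "j \<in> J" for j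
  proof -
    have "d j \<in> carrier G" using X j by (simp add: yd_eigenbasis_def)
    then have "d j = ?\<theta> (d' (\<sigma> j))"
      using match[OF j, of "Inr (d j)"] by (auto simp: \<mu>_def \<kappa>_def split: if_splits)
    then show ?thesis using \<theta>(2) bij_betwE[OF \<sigma>] j by simp
  qed
  moreover have "c' (\<sigma> j) (\<psi> g) = c j g" if "j \<in> J" "g \<in> carrier G" for j g
    using match[OF that(1), of "Inl g"] that(2) by (simp add: \<mu>_def \<kappa>_def)
  ultimately show ?thesis using \<sigma> by blast
qed

lemma yd_iso_of_matching:
  assumes X: "yd_eigenbasis G X J b d c" and X': "yd_eigenbasis G' X' J' b' d' c'"
    and span: "yspace X = pm.span (b ` J)" and span': "yspace X' = pm.span (b' ` J')"
    and \<sigma>: "bij_betw \<sigma> J J'"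
    and match: "\<And>j. j \<in> J \<Longrightarrow> \<psi> (d j) = d' (\<sigma> j)"
      "\<And>j g. j \<in> J \<Longrightarrow> g \<in> carrier G \<Longrightarrow> c' (\<sigma> j) (\<psi> g) = c j g"
  shows "\<exists>f. yd_iso (group_algebra G) X (yd_twist (group_algebra G) \<phi> X') f"
proof -
  let ?X = "yd_twist (group_algebra G) \<phi> X'"
  have bJ: "inj_on b J" "pm.independent (b ` J)" and bJ': "inj_on b' J'" "pm.independent (b' ` J')"
    using X X' by (auto simp: yd_eigenbasis_def)
  obtain f where linf: "lin f" and f0: "\<forall>x\<in>b ` J. f x = b' (\<sigma> (inv_into J b x))"
    using pp.linear_independent_extend[OF bJ(2), of "\<lambda>x. b' (\<sigma> (inv_into J b x))"] by auto
  obtain f' where linf': "lin f'" and f'0: "\<forall>x\<in>b' ` J'. f' x = b (inv_into J \<sigma> (inv_into J' b' x))"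
    using pp.linear_independent_extend[OF bJ'(2), of "\<lambda>x. b (inv_into J \<sigma> (inv_into J' b' x))"] by auto
  have f: "f (b j) = b' (\<sigma> j)" if "j \<in> J" for j
    using f0 bJ(1) that by simp
  have f': "f' (b' j) = b (inv_into J \<sigma> j)" if "j \<in> J'" for j
    using f'0 bJ'(1) that by simp
  have \<sigma>J: "\<sigma> j \<in> J'" if "j \<in> J" for j
    using \<sigma> that by (meson bij_betwE)
  have \<sigma>J': "inv_into J \<sigma> j \<in> J" if "j \<in> J'" for j
    using bij_betw_inv_into[OF \<sigma>] that by (meson bij_betwE)
  have "bij_betw f (yspace X) (yspace X')"
    unfolding span span'
  proof (rule bij_betw_byWitness[where f' = f'])
    show "\<forall>x\<in>pm.span (b ` J). f' (f x) = x"
    proof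
      fix x assume "x \<in> pm.span (b ` J)"
      then show "f' (f x) = x"
        by (rule lin_eq_on_span[OF lin_compose[OF linf' linf] lin_ident, rotated])
          (auto simp: f f' \<sigma>J bij_betw_inv_into_left[OF \<sigma>])
    qed
    show "\<forall>x\<in>pm.span (b' ` J'). f (f' x) = x"
    proof
      fix x assume "x \<in> pm.span (b' ` J')"
      then show "f (f' x) = x"
        by (rule lin_eq_on_span[OF lin_compose[OF linf linf'] lin_ident, rotated])
          (auto simp: f f' \<sigma>J' bij_betw_inv_into_right[OF \<sigma>])
    qed
    show "f ` pm.span (b ` J) \<subseteq> pm.span (b' ` J')"
      unfolding lin_span_image[OF linf] by (rule pm.span_mono) (auto simp: f \<sigma>J)
    show "f' ` pm.span (b' ` J') \<subseteq> pm.span (b ` J)"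
      unfolding lin_span_image[OF linf'] by (rule pm.span_mono) (auto simp: f' \<sigma>J')
  qed
  moreover have "f (yact X h x) = yact X' (\<phi> h) (f x)"
    if "h \<in> coord_space (carrier G)" "x \<in> yspace X" for h x
  proof (rule bilin_eq_on_span[of "\<lambda>h x. f (yact X h x)" "\<lambda>h x. yact X' (\<phi> h) (f x)"])
    show "bilin (\<lambda>h x. f (yact X h x))" "bilin (\<lambda>h x. yact X' (\<phi> h) (f x))"
      using X X' by (auto simp: yd_eigenbasis_def linf lin_phi intro: lin_compose_bilin bilin_compose)
    show "h \<in> pm.span (bvec ` carrier G)" "x \<in> pm.span (b ` J)"
      using that by (simp_all add: coord_space_eq_span span)
    show "f (yact X h x) = yact X' (\<phi> h) (f x)" if "h \<in> bvec ` carrier G" "x \<in> b ` J" for h x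
      using that X X' \<sigma>J unfolding yd_eigenbasis_def
      by (auto simp: f phi_bvec psi_carrier match lin_scale[OF linf])
  qed
  moreover have "ycoact ?X (f x) = tensor_map id f (ycoact X x)" if "x \<in> yspace X" for x
  proof (rule lin_eq_on_span[of "\<lambda>x. ycoact ?X (f x)" "\<lambda>x. tensor_map id f (ycoact X x)"])
    show "lin (\<lambda>x. ycoact ?X (f x))" "lin (\<lambda>x. tensor_map id f (ycoact X x))"
      using X X' lin_compose[OF lin_compose[OF lin_tensor_map, of "ycoact X'"] linf]
        lin_compose[OF lin_tensor_map, of "ycoact X"]
      by (simp_all add: yd_eigenbasis_def yd_twist_def)
    show "x \<in> pm.span (b ` J)" using that span by simp
    show "ycoact ?X (f x) = tensor_map id f (ycoact X x)" if x: "x \<in> b ` J" for x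
    proof -
      obtain j where j: "j \<in> J" "x = b j" using x by blast
      then have "ycoact ?X (f x) = tensor (bvec (d j)) (b' (\<sigma> j))"
        using X by (simp add: f twisted_coact[OF X' \<sigma>J] match yd_eigenbasis_def)
      then show ?thesis
        using X j by (simp add: yd_eigenbasis_def tensor_map_tensor_bvec linf f)
    qed
  qed
  ultimately have "yd_iso (group_algebra G) X ?X f"
    unfolding yd_iso_def using linf by (simp add: yd_twist_def)
  then show ?thesis by blast
qed

end

lemma group_algebra_iso_basis_map:
  assumes "group G" "group G'" "\<psi> \<in> iso G G'"
  shows "group_algebra_iso G G' (basis_map \<psi> :: ('g, 'k::field) vec \<Rightarrow> ('h, 'k) vec) \<psi>"
  using assms hopf_iso_basis_map[OF assms] by (intro group_algebra_iso.intro) simp_all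

lemma hopf_iso_imp_group_algebra_iso:
  assumes "group G" "group G'" "hopf_iso (group_algebra G) (group_algebra G') \<phi>"
  obtains \<psi> where "group_algebra_iso G G' \<phi> \<psi>"
proof -
  obtain \<psi> where "\<psi> \<in> iso G G'" "\<And>g. g \<in> carrier G \<Longrightarrow> \<phi> (bvec g) = bvec (\<psi> g)"
    using hopf_iso_group_algebra_basis[OF assms] by blast
  then have "group_algebra_iso G G' \<phi> \<psi>"
    using assms by (intro group_algebra_iso.intro) simp_all
  then show thesis by (rule that)
qed

section \<open>The Yetter-Drinfeld modules of an element system\<close>

abbreviation gralg :: "('g, 'i, 'k::field) esc \<Rightarrow> ('g, 'k) bialg" where
  "gralg E \<equiv> group_algebra (egrp E)"

lemma ESC_group: "ESC E \<Longrightarrow> group (egrp E)"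
  by (simp add: ESC_def)

lemma ESC_elt: "ESC E \<Longrightarrow> i \<in> eidx E \<Longrightarrow> eelt E i \<in> carrier (egrp E)"
  by (auto simp: ESC_def center_def)

lemma ESC_central:
  "ESC E \<Longrightarrow> i \<in> eidx E \<Longrightarrow> h \<in> carrier (egrp E) \<Longrightarrow>
    eelt E i \<otimes>\<^bsub>egrp E\<^esub> h = h \<otimes>\<^bsub>egrp E\<^esub> eelt E i"
  by (auto simp: ESC_def center_def)

lemma ESC_char_mult:
  "ESC E \<Longrightarrow> i \<in> eidx E \<Longrightarrow> g \<in> carrier (egrp E) \<Longrightarrow> h \<in> carrier (egrp E) \<Longrightarrow>
    echr E i (g \<otimes>\<^bsub>egrp E\<^esub> h) = echr E i g * echr E i h"
  by (auto simp: ESC_def field_units_def hom_def)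

lemma ESC_char_nonzero:
  "ESC E \<Longrightarrow> i \<in> eidx E \<Longrightarrow> g \<in> carrier (egrp E) \<Longrightarrow> echr E i g \<noteq> 0"
  by (auto simp: ESC_def field_units_def hom_def)

lemma ESC_char_conj:
  assumes "ESC E" "i \<in> eidx E" "g \<in> carrier (egrp E)" "h \<in> carrier (egrp E)"
  shows "echr E i (inv\<^bsub>egrp E\<^esub> h \<otimes>\<^bsub>egrp E\<^esub> g \<otimes>\<^bsub>egrp E\<^esub> h) = echr E i g"
proof -
  interpret group "egrp E" by (rule ESC_group) fact
  let ?G = "egrp E"
  have "echr E i h * echr E i (inv\<^bsub>?G\<^esub> h \<otimes>\<^bsub>?G\<^esub> g \<otimes>\<^bsub>?G\<^esub> h) =
      echr E i (h \<otimes>\<^bsub>?G\<^esub> (inv\<^bsub>?G\<^esub> h \<otimes>\<^bsub>?G\<^esub> g \<otimes>\<^bsub>?G\<^esub> h))"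
    using assms by (simp add: ESC_char_mult)
  also have "h \<otimes>\<^bsub>?G\<^esub> (inv\<^bsub>?G\<^esub> h \<otimes>\<^bsub>?G\<^esub> g \<otimes>\<^bsub>?G\<^esub> h) = g \<otimes>\<^bsub>?G\<^esub> h"
    using assms by (simp add: m_assoc[symmetric])
  also have "echr E i \<dots> = echr E i h * echr E i g"
    using assms by (simp add: ESC_char_mult)
  finally show ?thesis
    using ESC_char_nonzero[OF assms(1,2,4)] by simp
qed

text \<open>
  The data of an isomorphism of element systems, named so that it can be inverted and passed to the
  functorial constructions below.
\<close>

definition esc_iso :: "('g, 'i, 'k::field) esc \<Rightarrow> ('h, 'j, 'k) esc \<Rightarrow> ('g \<Rightarrow> 'h) \<Rightarrow> ('i \<Rightarrow> 'j) \<Rightarrow> bool" where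
  "esc_iso E E' \<psi> \<sigma> \<longleftrightarrow> \<psi> \<in> iso (egrp E) (egrp E') \<and> bij_betw \<sigma> (eidx E) (eidx E') \<and>
    (\<forall>i\<in>eidx E. \<psi> (eelt E i) = eelt E' (\<sigma> i) \<and>
       (\<forall>h\<in>carrier (egrp E). echr E' (\<sigma> i) (\<psi> h) = echr E i h))"

lemma ESC_isomorphic_iff_esc_iso: "ESC_isomorphic E E' \<longleftrightarrow> (\<exists>\<psi> \<sigma>. esc_iso E E' \<psi> \<sigma>)"
  by (simp add: ESC_isomorphic_def esc_iso_def)

lemma esc_iso_inverse:
  assumes E: "ESC E" and E': "ESC E'" and iso: "esc_iso E E' \<psi> \<sigma>"
  shows "esc_iso E' E (inv_into (carrier (egrp E)) \<psi>) (inv_into (eidx E) \<sigma>)"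
proof -
  have \<psi>: "\<psi> \<in> iso (egrp E) (egrp E')" and \<sigma>: "bij_betw \<sigma> (eidx E) (eidx E')"
    and elt: "\<And>i. i \<in> eidx E \<Longrightarrow> \<psi> (eelt E i) = eelt E' (\<sigma> i)"
    and chr: "\<And>i h. i \<in> eidx E \<Longrightarrow> h \<in> carrier (egrp E) \<Longrightarrow> echr E' (\<sigma> i) (\<psi> h) = echr E i h"
    using iso by (auto simp: esc_iso_def)
  have bij: "bij_betw \<psi> (carrier (egrp E)) (carrier (egrp E'))" using \<psi> by (simp add: iso_def)
  show ?thesis
    unfolding esc_iso_def
  proof (intro conjI ballI)
    show "inv_into (carrier (egrp E)) \<psi> \<in> iso (egrp E') (egrp E)"
      by (rule group.iso_set_sym[OF ESC_group[OF E] \<psi>])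
    show "bij_betw (inv_into (eidx E) \<sigma>) (eidx E') (eidx E)" by (rule bij_betw_inv_into[OF \<sigma>])
    fix j assume j: "j \<in> eidx E'"
    then obtain i where i: "i \<in> eidx E" "j = \<sigma> i" using \<sigma> by (auto simp: bij_betw_def)
    have inv: "inv_into (eidx E) \<sigma> j = i" using i bij_betw_inv_into_left[OF \<sigma>] by simp
    show "inv_into (carrier (egrp E)) \<psi> (eelt E' j) = eelt E (inv_into (eidx E) \<sigma> j)"
      unfolding inv using i elt[OF i(1), symmetric] bij_betw_inv_into_left[OF bij ESC_elt[OF E i(1)]] by simp
    fix h assume "h \<in> carrier (egrp E')"
    then obtain g where g: "g \<in> carrier (egrp E)" "h = \<psi> g" using bij by (auto simp: bij_betw_def)
    show "echr E (inv_into (eidx E) \<sigma> j) (inv_into (carrier (egrp E)) \<psi> h) = echr E' j h"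
      unfolding inv using g i chr bij_betw_inv_into_left[OF bij g(1)] by simp
  qed
qed

lemma yd_V_eigenbasis:
  assumes "ESC E"
  shows "yd_eigenbasis (egrp E) (yd_V E) (eidx E) bvec (eelt E) (echr E)"
  using assms by (auto simp: yd_eigenbasis_def yd_V_def subspace_coord_space independent_bvec
      ESC_elt inj_on_def)

lemma yspace_yd_V: "yspace (yd_V E) = pm.span (bvec ` eidx E)"
  by (simp add: yd_V_def coord_space_eq_span)

definition arrow_at_1 :: "('g, 'i, 'k::field) esc \<Rightarrow> 'i \<Rightarrow> ('g, 'i) arrow" where
  "arrow_at_1 E i = Arrow (eelt E i) i \<one>\<^bsub>egrp E\<^esub>"

lemma arrows_at_1:
  assumes "ESC E"
  shows "{a \<in> esc_arrows E. asource a = \<one>\<^bsub>egrp E\<^esub>} = arrow_at_1 E ` eidx E"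
proof -
  interpret group "egrp E" by (rule ESC_group) fact
  show ?thesis
    using assms by (auto simp: esc_arrows_def arrow_at_1_def ESC_elt intro!: exI[of _ "\<one>\<^bsub>egrp E\<^esub>"])
qed

text \<open>
  Since \<open>g\<^sub>i\<close> is central, conjugation by \<open>g\<close> fixes the arrow from \<open>1\<close> to \<open>g\<^sub>i\<close> up to the scalar that the
  right action by \<open>g\<^sup>-\<^sup>1\<close> contributes; this is why the characters appear inverted.
\<close>

lemma arrow_ad_eigenbasis:
  assumes "ESC E"
  shows "yd_eigenbasis (egrp E) (arrow_ad E) (eidx E) (\<lambda>i. bvec (arrow_at_1 E i)) (eelt E)
    (\<lambda>i g. echr E i (inv\<^bsub>egrp E\<^esub> g))"
proof -
  interpret group "egrp E" by (rule ESC_group) fact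
  have "pm.independent ((\<lambda>i. bvec (arrow_at_1 E i) :: (('a, 'b) arrow, 'c) vec) ` eidx E)"
    using independent_bvec[of "arrow_at_1 E ` eidx E"] by (simp add: image_image)
  moreover have "g \<otimes>\<^bsub>egrp E\<^esub> eelt E i \<otimes>\<^bsub>egrp E\<^esub> inv\<^bsub>egrp E\<^esub> g = eelt E i"
    if "i \<in> eidx E" "g \<in> carrier (egrp E)" for i g
    using assms that by (simp add: ESC_central[symmetric] ESC_elt m_assoc)
  ultimately show ?thesis
    using assms unfolding yd_eigenbasis_def arrow_ad_def arrows_at_1[OF assms]
    by (auto simp: subspace_coord_space ESC_elt arrow_bimod_def arrow_at_1_def inj_on_def)
qed

lemma yspace_arrow_ad:
  "ESC E \<Longrightarrow> yspace (arrow_ad E) = pm.span ((\<lambda>i. bvec (arrow_at_1 E i)) ` eidx E)"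
  unfolding arrow_ad_def by (simp add: arrows_at_1 coord_space_eq_span image_image)

text \<open>
  Substitute \<open>g\<^sup>-\<^sup>1\<close> for \<open>g\<close>, using that \<open>\<psi>\<close> commutes with inverses.
\<close>

lemma inverse_character_iff:
  assumes "group G" "group G'" "\<psi> \<in> iso G G'"
  shows "(\<forall>g\<in>carrier G. c' (inv\<^bsub>G'\<^esub> \<psi> g) = c (inv\<^bsub>G\<^esub> g)) \<longleftrightarrow> (\<forall>g\<in>carrier G. c' (\<psi> g) = c g)"
    (is "?l \<longleftrightarrow> ?r")
proof -
  interpret group_hom G G' \<psi>
    using assms by (auto simp: group_hom_def group_hom_axioms_def iso_def)
  show ?thesis
  proof
    assume ?l
    then have "c' (\<psi> g) = c g" if "g \<in> carrier G" for g
      using that bspec[OF \<open>?l\<close>, of "inv\<^bsub>G\<^esub> g"] by simp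
    then show ?r by blast
  next
    assume ?r
    then have "c' (inv\<^bsub>G'\<^esub> \<psi> g) = c (inv\<^bsub>G\<^esub> g)" if "g \<in> carrier G" for g
      using that bspec[OF \<open>?r\<close>, of "inv\<^bsub>G\<^esub> g"] by simp
    then show ?l by blast
  qed
qed

text \<open>
  The common core of the comparisons with Yetter-Drinfeld modules. The hypothesis \<open>chars\<close> allows the
  module to carry the characters in another but equivalent form, such as their inverses.
\<close>

lemma ESC_isomorphic_iff_yd_isomorphic:
  fixes E :: "('g, 'i, 'k::field) esc" and E' :: "('h, 'j, 'k) esc"
    and X :: "('g, 'b, 'k) yd_mod" and X' :: "('h, 'c, 'k) yd_mod"
  assumes E: "ESC E" and E': "ESC E'"
    and X: "yd_eigenbasis (egrp E) X (eidx E) b (eelt E) c" "yspace X = pm.span (b ` eidx E)"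
    and X': "yd_eigenbasis (egrp E') X' (eidx E') b' (eelt E') c'" "yspace X' = pm.span (b' ` eidx E')"
    and chars: "\<And>\<psi> i j. \<psi> \<in> iso (egrp E) (egrp E') \<Longrightarrow>
      (\<forall>g\<in>carrier (egrp E). c' j (\<psi> g) = c i g) \<longleftrightarrow>
      (\<forall>g\<in>carrier (egrp E). echr E' j (\<psi> g) = echr E i g)"
  shows "ESC_isomorphic E E' \<longleftrightarrow>
    (\<exists>\<phi>. hopf_iso (gralg E) (gralg E') \<phi> \<and> yd_isomorphic (gralg E) X (yd_twist (gralg E) \<phi> X'))"
proof
  assume "ESC_isomorphic E E'"
  then obtain \<psi> \<sigma> where \<psi>: "\<psi> \<in> iso (egrp E) (egrp E')" and \<sigma>: "bij_betw \<sigma> (eidx E) (eidx E')"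
    and elt: "\<And>i. i \<in> eidx E \<Longrightarrow> \<psi> (eelt E i) = eelt E' (\<sigma> i)"
    and chr: "\<And>i. i \<in> eidx E \<Longrightarrow> \<forall>h\<in>carrier (egrp E). echr E' (\<sigma> i) (\<psi> h) = echr E i h"
    unfolding ESC_isomorphic_def by auto
  interpret group_algebra_iso "egrp E" "egrp E'" "basis_map \<psi>" \<psi>
    using group_algebra_iso_basis_map[OF ESC_group[OF E] ESC_group[OF E'] \<psi>] .
  have "c' (\<sigma> i) (\<psi> g) = c i g" if "i \<in> eidx E" "g \<in> carrier (egrp E)" for i g
    using chars[OF \<psi>, of "\<sigma> i" i] chr[OF that(1)] that(2) by blast
  then show "\<exists>\<phi>. hopf_iso (gralg E) (gralg E') \<phi> \<and> yd_isomorphic (gralg E) X (yd_twist (gralg E) \<phi> X')"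
    unfolding yd_isomorphic_def
    using hopf yd_iso_of_matching[OF X(1) X'(1) X(2) X'(2) \<sigma> elt] by blast
next
  assume "\<exists>\<phi>. hopf_iso (gralg E) (gralg E') \<phi> \<and> yd_isomorphic (gralg E) X (yd_twist (gralg E) \<phi> X')"
  then obtain \<phi> f where \<phi>: "hopf_iso (gralg E) (gralg E') \<phi>"
    and f: "yd_iso (gralg E) X (yd_twist (gralg E) \<phi> X') f"
    unfolding yd_isomorphic_def by blast
  obtain \<psi> where "group_algebra_iso (egrp E) (egrp E') \<phi> \<psi>"
    using hopf_iso_imp_group_algebra_iso[OF ESC_group[OF E] ESC_group[OF E'] \<phi>] .
  then interpret group_algebra_iso "egrp E" "egrp E'" \<phi> \<psi> .
  have "f ` pm.span (b ` eidx E) = pm.span (b' ` eidx E')"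
    using f by (simp add: yd_iso_def yd_twist_def bij_betw_def flip: X(2) X'(2))
  then obtain \<sigma> where \<sigma>: "bij_betw \<sigma> (eidx E) (eidx E')"
    and elt: "\<forall>i\<in>eidx E. \<psi> (eelt E i) = eelt E' (\<sigma> i) \<and> (\<forall>g\<in>carrier (egrp E). c' (\<sigma> i) (\<psi> g) = c i g)"
    using yd_iso_matching[OF X(1) X'(1) f] by blast
  then show "ESC_isomorphic E E'"
    unfolding ESC_isomorphic_def using psi chars[OF psi] by blast
qed

lemma ESC_isomorphic_iff_yd_V:
  assumes "ESC E" "ESC E'"
  shows "ESC_isomorphic E E' \<longleftrightarrow>
    (\<exists>\<phi>. hopf_iso (gralg E) (gralg E') \<phi> \<and>
      yd_isomorphic (gralg E) (yd_V E) (yd_twist (gralg E) \<phi> (yd_V E')))"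
  by (rule ESC_isomorphic_iff_yd_isomorphic[OF assms yd_V_eigenbasis[OF assms(1)] yspace_yd_V
        yd_V_eigenbasis[OF assms(2)] yspace_yd_V refl])

lemma ESC_isomorphic_iff_arrow_ad:
  assumes "ESC E" "ESC E'"
  shows "ESC_isomorphic E E' \<longleftrightarrow>
    (\<exists>\<phi>. hopf_iso (gralg E) (gralg E') \<phi> \<and>
      yd_isomorphic (gralg E) (arrow_ad E) (yd_twist (gralg E) \<phi> (arrow_ad E')))"
  by (rule ESC_isomorphic_iff_yd_isomorphic[OF assms arrow_ad_eigenbasis[OF assms(1)]
        yspace_arrow_ad[OF assms(1)] arrow_ad_eigenbasis[OF assms(2)] yspace_arrow_ad[OF assms(2)]
        inverse_character_iff[OF ESC_group[OF assms(1)] ESC_group[OF assms(2)]]])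

section \<open>Ramification systems of element systems\<close>

text \<open>
  In this form the choice of representatives has disappeared.
\<close>

lemma esc_ridx_eq:
  assumes "esc_reps E Jr"
  shows "esc_ridx E Jr C = {j \<in> eidx E. C = {eelt E j}}"
  using assms unfolding esc_ridx_def esc_class_def esc_reps_def by (auto, metis)

lemma conj_class_central:
  assumes "group G" "z \<in> center G"
  shows "(\<lambda>h. h \<otimes>\<^bsub>G\<^esub> z \<otimes>\<^bsub>G\<^esub> inv\<^bsub>G\<^esub> h) ` carrier G = {z}"
proof -
  interpret group G by fact
  have "h \<otimes>\<^bsub>G\<^esub> z \<otimes>\<^bsub>G\<^esub> inv\<^bsub>G\<^esub> h = z" if "h \<in> carrier G" for h
    using assms that by (simp add: center_def m_assoc flip: m_assoc[of z])
      (metis (no_types, lifting) inv_closed m_assoc r_inv r_one)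
  then show ?thesis using one_closed by (auto simp: image_iff) 
qed

lemma singleton_conj_class:
  assumes "group G" "z \<in> center G"
  shows "{z} \<in> conj_classes G"
  unfolding conj_classes_def conj_class_central[OF assms, symmetric]
  using assms(2) by (auto simp: center_def)

lemma CRSC_rsc_of_esc:
  assumes E: "ESC E" and r: "esc_reps E Jr" and u: "\<forall>C\<in>conj_classes (egrp E). u C \<in> C"
  shows "CRSC (rsc_of_esc E Jr u)"
proof -
  let ?R = "rsc_of_esc E Jr u"
  have ram: "\<exists>j\<in>eidx E. C = {eelt E j}" if C: "C \<in> ram_classes ?R" for C
  proof (rule ccontr)
    assume "\<not> (\<exists>j\<in>eidx E. C = {eelt E j})"
    then have "{j \<in> eidx E. C = {eelt E j}} = {}" by blast
    then have "rram ?R C = |{}|"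
      by (simp only: rsc_of_esc_def esc_ridx_eq[OF r] rsc.simps)
    then show False
      using C by (simp add: ram_classes_def card_of_refl)
  qed
  have "echr E i \<in> hom (egrp E\<lparr>carrier := centralizer (egrp E) x\<rparr>) field_units"
    if "i \<in> eidx E" for i x
  proof -
    have "echr E i \<in> hom (egrp E) field_units" using E that by (simp add: ESC_def)
    then show ?thesis by (auto simp: hom_def centralizer_def)
  qed
  then have "RSC ?R"
    unfolding RSC_def using ESC_group[OF E] u
    by (auto simp: rsc_of_esc_def card_of_Card_order card_of_refl esc_ridx_eq[OF r])
  then show ?thesis
    unfolding CRSC_def using ram by blast
qed

lemma iso_image_conj_class:
  assumes "group G" "group G'" "\<psi> \<in> iso G G'" "x \<in> carrier G"
  shows "\<psi> ` (\<lambda>h. h \<otimes>\<^bsub>G\<^esub> x \<otimes>\<^bsub>G\<^esub> inv\<^bsub>G\<^esub> h) ` carrier G =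
    (\<lambda>h. h \<otimes>\<^bsub>G'\<^esub> \<psi> x \<otimes>\<^bsub>G'\<^esub> inv\<^bsub>G'\<^esub> h) ` carrier G'"
proof -
  interpret group_hom G G' \<psi>
    using assms by (auto simp: group_hom_def group_hom_axioms_def iso_def)
  have surj: "\<psi> ` carrier G = carrier G'"
    using assms(3) by (simp add: iso_def bij_betw_def)
  have "\<psi> (h \<otimes>\<^bsub>G\<^esub> x \<otimes>\<^bsub>G\<^esub> inv\<^bsub>G\<^esub> h) = \<psi> h \<otimes>\<^bsub>G'\<^esub> \<psi> x \<otimes>\<^bsub>G'\<^esub> inv\<^bsub>G'\<^esub> \<psi> h"
    if "h \<in> carrier G" for h
    using that assms(4) by simp
  then show ?thesis
    unfolding surj[symmetric] image_image by (rule image_cong[OF refl])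
qed

text \<open>
  Supplies the elements \<open>h\<^sub>C\<close> that an isomorphism of ramification systems has to provide, also for
  the classes that do not ramify.
\<close>

lemma conj_class_transitive:
  assumes "group G" "C \<in> conj_classes G" "x \<in> C" "y \<in> C"
  shows "\<exists>h\<in>carrier G. inv\<^bsub>G\<^esub> h \<otimes>\<^bsub>G\<^esub> x \<otimes>\<^bsub>G\<^esub> h = y"
proof -
  interpret group G by fact
  obtain z a b where z: "z \<in> carrier G" "a \<in> carrier G" "b \<in> carrier G"
    and x: "x = a \<otimes>\<^bsub>G\<^esub> z \<otimes>\<^bsub>G\<^esub> inv\<^bsub>G\<^esub> a" and y: "y = b \<otimes>\<^bsub>G\<^esub> z \<otimes>\<^bsub>G\<^esub> inv\<^bsub>G\<^esub> b"
    using assms unfolding conj_classes_def by blast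
  let ?h = "a \<otimes>\<^bsub>G\<^esub> inv\<^bsub>G\<^esub> b"
  have cancel: "inv\<^bsub>G\<^esub> a \<otimes>\<^bsub>G\<^esub> (a \<otimes>\<^bsub>G\<^esub> w) = w" if "w \<in> carrier G" for w
    using that z by (simp flip: m_assoc)
  have "inv\<^bsub>G\<^esub> ?h \<otimes>\<^bsub>G\<^esub> x \<otimes>\<^bsub>G\<^esub> ?h = y"
    unfolding x y using z by (simp add: inv_mult_group m_assoc cancel)
  then show ?thesis using z by blast
qed

lemma conj_class_subset: "group G \<Longrightarrow> C \<in> conj_classes G \<Longrightarrow> C \<subseteq> carrier G"
  by (auto simp: conj_classes_def group.is_monoid monoid.m_closed)

text \<open>
  From left to right, the bijection of the index sets is restricted to the indices over each class. From
  right to left, the bijections over the classes \<open>{g\<^sub>i}\<close> are glued; an index \<open>j\<close> of the second system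
  is hit because the preimage of \<open>g'\<^sub>j\<close> is again central, so that it forms a conjugacy class.
\<close>

lemma ESC_isomorphic_iff_CRSC:
  fixes E :: "('g, 'i, 'k::field) esc" and E' :: "('h, 'j, 'k) esc"
  assumes E: "ESC E" and E': "ESC E'" and r: "esc_reps E Jr" and r': "esc_reps E' Jr'"
    and u: "\<forall>C\<in>conj_classes (egrp E). u C \<in> C" and u': "\<forall>C\<in>conj_classes (egrp E'). u' C \<in> C"
  shows "ESC_isomorphic E E' \<longleftrightarrow> CRSC_isomorphic (rsc_of_esc E Jr u) (rsc_of_esc E' Jr' u')"
proof -
  let ?G = "egrp E" and ?G' = "egrp E'"
  let ?I = "\<lambda>C. {j \<in> eidx E. C = {eelt E j}}" and ?I' = "\<lambda>C. {j \<in> eidx E'. C = {eelt E' j}}"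
  interpret G: group ?G by (rule ESC_group[OF E])
  interpret G': group ?G' by (rule ESC_group[OF E'])
  have iso_iff: "CRSC_isomorphic (rsc_of_esc E Jr u) (rsc_of_esc E' Jr' u') \<longleftrightarrow>
    (\<exists>\<phi> c \<tau>. \<phi> \<in> iso ?G ?G' \<and>
        (\<forall>C\<in>conj_classes ?G. c C \<in> carrier ?G \<and>
           \<phi> (inv\<^bsub>?G\<^esub> (c C) \<otimes>\<^bsub>?G\<^esub> u C \<otimes>\<^bsub>?G\<^esub> c C) = u' (\<phi> ` C) \<and>
           bij_betw (\<tau> C) (?I C) (?I' (\<phi> ` C)) \<and>
           (\<forall>i\<in>?I C. \<forall>h\<in>centralizer ?G (u C).
              echr E' (\<tau> C i) (\<phi> (inv\<^bsub>?G\<^esub> (c C) \<otimes>\<^bsub>?G\<^esub> h \<otimes>\<^bsub>?G\<^esub> c C)) = echr E i h)))"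
    unfolding CRSC_isomorphic_def RSC_isomorphic_def
    using CRSC_rsc_of_esc[OF E r u] CRSC_rsc_of_esc[OF E' r' u']
    by (simp add: rsc_of_esc_def esc_ridx_eq[OF r] esc_ridx_eq[OF r'])
  show ?thesis
  proof
    assume "ESC_isomorphic E E'"
    then obtain \<psi> \<sigma> where \<psi>: "\<psi> \<in> iso ?G ?G'" and \<sigma>: "bij_betw \<sigma> (eidx E) (eidx E')"
      and elt: "\<And>i. i \<in> eidx E \<Longrightarrow> \<psi> (eelt E i) = eelt E' (\<sigma> i)"
      and chr: "\<And>i h. i \<in> eidx E \<Longrightarrow> h \<in> carrier ?G \<Longrightarrow> echr E' (\<sigma> i) (\<psi> h) = echr E i h"
      unfolding ESC_isomorphic_def by auto
    have inj: "inj_on \<psi> (carrier ?G)" using \<psi> by (simp add: iso_def bij_betw_def)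
    have "\<exists>h\<in>carrier ?G. \<psi> (inv\<^bsub>?G\<^esub> h \<otimes>\<^bsub>?G\<^esub> u C \<otimes>\<^bsub>?G\<^esub> h) = u' (\<psi> ` C)"
      if C: "C \<in> conj_classes ?G" for C
    proof -
      have "\<psi> x \<in> carrier ?G'" if "x \<in> carrier ?G" for x
        using that \<psi> by (auto simp: iso_def hom_def)
      then have "\<psi> ` C \<in> conj_classes ?G'"
        using C iso_image_conj_class[OF ESC_group[OF E] ESC_group[OF E'] \<psi>]
        unfolding conj_classes_def by blast
      then obtain x where x: "x \<in> C" "u' (\<psi> ` C) = \<psi> x"
        using u' by blast
      then show ?thesis
        using conj_class_transitive[OF ESC_group[OF E] C _ x(1), of "u C"] u C by auto
    qed
    then obtain c where c: "\<And>C. C \<in> conj_classes ?G \<Longrightarrow> c C \<in> carrier ?G \<and>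
        \<psi> (inv\<^bsub>?G\<^esub> (c C) \<otimes>\<^bsub>?G\<^esub> u C \<otimes>\<^bsub>?G\<^esub> c C) = u' (\<psi> ` C)"
      by metis
    have bij: "bij_betw \<sigma> (?I C) (?I' (\<psi> ` C))" if C: "C \<in> conj_classes ?G" for C
    proof (rule bij_betw_subset[OF \<sigma>])
      have "C = {eelt E j} \<longleftrightarrow> \<psi> ` C = {eelt E' (\<sigma> j)}" if j: "j \<in> eidx E" for j
        using inj_on_image_eq_iff[OF inj conj_class_subset[OF ESC_group[OF E] C], of "{eelt E j}"]
          ESC_elt[OF E j] elt[OF j] by simp
      then show "\<sigma> ` ?I C = ?I' (\<psi> ` C)"
        unfolding bij_betw_imp_surj_on[OF \<sigma>, symmetric] by blast
    qed auto
    have "echr E' (\<sigma> i) (\<psi> (inv\<^bsub>?G\<^esub> (c C) \<otimes>\<^bsub>?G\<^esub> h \<otimes>\<^bsub>?G\<^esub> c C)) = echr E i h"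
      if "C \<in> conj_classes ?G" "i \<in> ?I C" "h \<in> centralizer ?G (u C)" for C i h
      using that c[OF that(1)] chr[of i] ESC_char_conj[OF E, of i h] by (auto simp: centralizer_def)
    then show "CRSC_isomorphic (rsc_of_esc E Jr u) (rsc_of_esc E' Jr' u')"
      unfolding iso_iff using \<psi> c bij by (intro exI[of _ \<psi>] exI[of _ c] exI[of _ "\<lambda>_. \<sigma>"]) blast
  next
    assume "CRSC_isomorphic (rsc_of_esc E Jr u) (rsc_of_esc E' Jr' u')"
    then obtain \<psi> c \<tau> where \<psi>: "\<psi> \<in> iso ?G ?G'"
      and c: "\<And>C. C \<in> conj_classes ?G \<Longrightarrow> c C \<in> carrier ?G"
      and \<tau>: "\<And>C. C \<in> conj_classes ?G \<Longrightarrow> bij_betw (\<tau> C) (?I C) (?I' (\<psi> ` C))"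
      and chr: "\<And>C i h. C \<in> conj_classes ?G \<Longrightarrow> i \<in> ?I C \<Longrightarrow> h \<in> centralizer ?G (u C) \<Longrightarrow>
          echr E' (\<tau> C i) (\<psi> (inv\<^bsub>?G\<^esub> (c C) \<otimes>\<^bsub>?G\<^esub> h \<otimes>\<^bsub>?G\<^esub> c C)) = echr E i h"
      unfolding iso_iff by blast
    interpret h: group_hom ?G ?G' \<psi>
      using \<psi> by unfold_locales (auto simp: iso_def)
    have bij\<psi>: "bij_betw \<psi> (carrier ?G) (carrier ?G')" using \<psi> by (simp add: iso_def)
    define \<sigma> where "\<sigma> i = \<tau> {eelt E i} i" for i
    have cls: "{eelt E i} \<in> conj_classes ?G" if "i \<in> eidx E" for i
      using E that by (intro singleton_conj_class) (auto simp: ESC_def)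
    have \<sigma>: "\<sigma> i \<in> eidx E'" "eelt E' (\<sigma> i) = \<psi> (eelt E i)" if "i \<in> eidx E" for i
      using bij_betwE[OF \<tau>[OF cls[OF that]]] that unfolding \<sigma>_def by auto
    have "bij_betw \<sigma> (eidx E) (eidx E')"
    proof (rule bij_betwI')
      fix i j assume ij: "i \<in> eidx E" "j \<in> eidx E"
      have "i = j" if eq: "\<sigma> i = \<sigma> j"
      proof -
        have "eelt E i = eelt E j"
          using \<sigma>(2)[OF ij(1)] \<sigma>(2)[OF ij(2)] eq ESC_elt[OF E] ij bij_betw_imp_inj_on[OF bij\<psi>]
          by (auto dest: inj_onD)
        then show ?thesis
          using eq ij bij_betw_imp_inj_on[OF \<tau>[OF cls[OF ij(2)]]]
          unfolding \<sigma>_def by (auto dest: inj_onD)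
      qed
      then show "\<sigma> i = \<sigma> j \<longleftrightarrow> i = j" by blast
    next
      show "\<sigma> i \<in> eidx E'" if "i \<in> eidx E" for i using \<sigma>(1)[OF that] .
    next
      fix j assume j: "j \<in> eidx E'"
      obtain x where x: "x \<in> carrier ?G" "\<psi> x = eelt E' j"
        using ESC_elt[OF E' j] bij\<psi> by (metis bij_betw_iff_bijections)
      have cx: "x \<in> center ?G"
        unfolding center_def
      proof (intro CollectI conjI ballI x(1))
        fix h assume h: "h \<in> carrier ?G"
        have "\<psi> (x \<otimes>\<^bsub>?G\<^esub> h) = \<psi> (h \<otimes>\<^bsub>?G\<^esub> x)"
          using h x ESC_central[OF E' j, of "\<psi> h"] by simp
        then show "x \<otimes>\<^bsub>?G\<^esub> h = h \<otimes>\<^bsub>?G\<^esub> x"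
          by (rule inj_onD[OF bij_betw_imp_inj_on[OF bij\<psi>]]) (use h x in auto)
      qed
      then have "bij_betw (\<tau> {x}) (?I {x}) (?I' {eelt E' j})"
        using \<tau>[OF singleton_conj_class[OF ESC_group[OF E] cx]] x(2) by simp
      then have "\<tau> {x} ` ?I {x} = ?I' {eelt E' j}"
        by (rule bij_betw_imp_surj_on)
      moreover have "j \<in> ?I' {eelt E' j}" using j by simp
      ultimately have "j \<in> \<tau> {x} ` ?I {x}" by (simp only:)
      then obtain i where "j = \<tau> {x} i" "i \<in> ?I {x}" by (rule imageE)
      then show "\<exists>i\<in>eidx E. j = \<sigma> i"
        unfolding \<sigma>_def by auto
    qed
    moreover have "echr E' (\<sigma> i) (\<psi> h) = echr E i h" if i: "i \<in> eidx E" and h: "h \<in> carrier ?G" for i h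
    proof -
      have "u {eelt E i} = eelt E i" using u cls[OF i] by blast
      then have "h \<in> centralizer ?G (u {eelt E i})"
        using h ESC_central[OF E i h] by (simp add: centralizer_def)
      then show ?thesis
        using chr[OF cls[OF i], of i h] i h c[OF cls[OF i]]
          ESC_char_conj[OF E' \<sigma>(1)[OF i], of "\<psi> h" "\<psi> (c {eelt E i})"]
        by (simp add: \<sigma>_def[symmetric])
    qed
    ultimately show "ESC_isomorphic E E'"
      unfolding ESC_isomorphic_def using \<psi> \<sigma>(2)
      by (intro exI[of _ \<psi>] exI[of _ \<sigma>]) simp
  qed
qed

section \<open>Functoriality of the quotient by the Nichols ideal\<close>

text \<open>
  The closure and linearity properties that are needed to pass to the quotient by the Nichols ideal.
  The counit appears as a map to a one-dimensional free space because \<open>lin\<close> does not apply to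
  scalar-valued maps.
\<close>

locale braided_space =
  fixes H :: "('h, 'k::field) bialg" and T :: "('b, 'k, 'h) braided"
  assumes subspace_T: "pm.subspace (bspace T)"
    and deg_subset: "bdeg T n \<subseteq> bspace T"
    and bilin_mult: "bilin (bmult T)"
    and lin_comult: "lin (bcomult T)"
    and lin_counit: "lin (\<lambda>x. vscale (bcounit T x) (bvec ()))"
    and bilin_act: "bilin (hact T)"
    and lin_coact: "lin (hcoact T)"
    and one_closed: "bone T \<in> bspace T"
    and mult_closed: "x \<in> bspace T \<Longrightarrow> y \<in> bspace T \<Longrightarrow> bmult T x y \<in> bspace T"
    and comult_closed: "x \<in> bspace T \<Longrightarrow> bcomult T x \<in> tensor_space (bspace T) (bspace T)"
    and act_closed: "h \<in> bspace H \<Longrightarrow> x \<in> bspace T \<Longrightarrow> hact T h x \<in> bspace T"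
    and coact_closed: "x \<in> bspace T \<Longrightarrow> hcoact T x \<in> tensor_space (bspace H) (bspace T)"
begin

definition N :: "('b, 'k) vec set" where
  "N = nichols_ideal H T"

definition p :: "('b, 'k) vec \<Rightarrow> ('b, 'k) vec" where
  "p = quot_proj (bspace T) N"

abbreviation B :: "('b, 'k, 'h) braided" where
  "B \<equiv> braided_quot T N"

lemma subspace_N: "pm.subspace N"
  by (simp add: N_def nichols_ideal_def)

lemma N_subset: "N \<subseteq> bspace T"
  unfolding N_def nichols_ideal_def
  by (rule pm.span_minimal[OF _ subspace_T]) (auto simp: nichols_ideals_def)

lemma ideal_subset_N: "I \<in> nichols_ideals H T \<Longrightarrow> I \<subseteq> N"
  unfolding N_def nichols_ideal_def using pm.span_superset by blast

text \<open>
  All closure properties of the single ideals pass to their sum \<open>N\<close> by linearity.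
\<close>

lemma lin_on_N:
  assumes "lin f" "pm.subspace W" "\<And>I y. I \<in> nichols_ideals H T \<Longrightarrow> y \<in> I \<Longrightarrow> f y \<in> W" "y \<in> N"
  shows "f y \<in> W"
  by (rule lin_in_span[OF assms(1) _ assms(2) assms(4)[unfolded N_def nichols_ideal_def]])
    (use assms(3) in blast)

lemma N_mult:
  assumes "x \<in> bspace T" "y \<in> N"
  shows "bmult T x y \<in> N" "bmult T y x \<in> N"
proof -
  have "bmult T x y \<in> N \<and> bmult T y x \<in> N" if "I \<in> nichols_ideals H T" "y \<in> I" for I y
    using that assms(1) ideal_subset_N[OF that(1)] by (auto simp: nichols_ideals_def)
  then show "bmult T x y \<in> N" "bmult T y x \<in> N"
    using assms(2) lin_on_N[OF bilin_right[OF bilin_mult] subspace_N]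
      lin_on_N[OF bilin_left[OF bilin_mult] subspace_N] by blast+
qed

lemma N_act:
  assumes "h \<in> bspace H" "y \<in> N"
  shows "hact T h y \<in> N"
  using assms(2)
proof (rule lin_on_N[OF bilin_right[OF bilin_act] subspace_N, rotated])
  show "hact T h y \<in> N" if "I \<in> nichols_ideals H T" "y \<in> I" for I y
    using that assms(1) ideal_subset_N[OF that(1)] by (auto simp: nichols_ideals_def)
qed

lemma N_counit:
  assumes "y \<in> N"
  shows "bcounit T y = 0"
proof -
  have "vscale (bcounit T y) (bvec ()) \<in> {0 :: (unit, 'k) vec}"
    using assms
  proof (rule lin_on_N[OF lin_counit, rotated 2])
    show "vscale (bcounit T y) (bvec ()) \<in> {0 :: (unit, 'k) vec}"
      if "I \<in> nichols_ideals H T" "y \<in> I" for I y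
      using that by (auto simp: nichols_ideals_def)
  qed (rule pm.subspace_single_0)
  then show ?thesis by simp
qed

lemma N_comult:
  assumes "y \<in> N"
  shows "bcomult T y \<in> pm.span (tensor_space N (bspace T) \<union> tensor_space (bspace T) N)"
  using assms
proof (rule lin_on_N[OF lin_comult pm.subspace_span, rotated])
  fix I y assume I: "I \<in> nichols_ideals H T" "y \<in> I"
  then have "bcomult T y \<in> pm.span (tensor_space I (bspace T) \<union> tensor_space (bspace T) I)"
    by (auto simp: nichols_ideals_def)
  moreover have "tensor_space I (bspace T) \<union> tensor_space (bspace T) I \<subseteq>
      tensor_space N (bspace T) \<union> tensor_space (bspace T) N"
    using tensor_space_mono[OF ideal_subset_N[OF I(1)] order_refl]
      tensor_space_mono[OF order_refl ideal_subset_N[OF I(1)]] by blast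
  ultimately show "bcomult T y \<in> pm.span (tensor_space N (bspace T) \<union> tensor_space (bspace T) N)"
    using pm.span_mono by blast
qed

lemma N_coact:
  assumes "y \<in> N"
  shows "hcoact T y \<in> tensor_space (bspace H) N"
  using assms
proof (rule lin_on_N[OF lin_coact subspace_tensor_space, rotated])
  fix I y assume I: "I \<in> nichols_ideals H T" "y \<in> I"
  then have "hcoact T y \<in> tensor_space (bspace H) I"
    by (auto simp: nichols_ideals_def)
  then show "hcoact T y \<in> tensor_space (bspace H) N"
    using tensor_space_mono[OF order_refl ideal_subset_N[OF I(1)]] by blast
qed

text \<open>
  The conditions in \<open>quot_proj\<close> can be met, so \<open>p\<close> is a projection along \<open>N\<close>.
\<close>

lemma p_props: "lin p \<and> (\<forall>x\<in>bspace T. p x \<in> bspace T \<and> x - p x \<in> N) \<and> (\<forall>x\<in>N. p x = 0)"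
proof -
  \<comment> \<open>a linear retraction \<open>g\<close> onto \<open>N\<close> gives the projection \<open>x - g x\<close> along \<open>N\<close>\<close>
  obtain g where g: "g ` UNIV \<subseteq> N" "lin g" "\<forall>v\<in>N. g v = v"
    using pp.linear_exists_left_inverse_on[OF lin_ident subspace_N] by auto
  have "lin (\<lambda>x. x - g x) \<and> (\<forall>x\<in>bspace T. x - g x \<in> bspace T \<and> x - (x - g x) \<in> N) \<and>
      (\<forall>x\<in>N. x - g x = 0)"
    using g N_subset by (auto intro: lin_minus lin_ident pm.subspace_diff[OF subspace_T])
  then have "\<exists>p. lin p \<and> (\<forall>x\<in>bspace T. p x \<in> bspace T \<and> x - p x \<in> N) \<and> (\<forall>x\<in>N. p x = 0)"
    by (intro exI[of _ "\<lambda>x. x - g x"])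
  then show ?thesis
    unfolding p_def quot_proj_def by (rule someI_ex)
qed

lemma lin_p: "lin p"
  and p_closed: "x \<in> bspace T \<Longrightarrow> p x \<in> bspace T"
  and diff_p_in_N: "x \<in> bspace T \<Longrightarrow> x - p x \<in> N"
  and p_N: "y \<in> N \<Longrightarrow> p y = 0"
  using p_props by blast+

lemma p_eqI: "x - y \<in> N \<Longrightarrow> p x = p y"
  using p_N[of "x - y"] by (simp add: lin_diff[OF lin_p])

lemma p_idem: "x \<in> bspace T \<Longrightarrow> p (p x) = p x"
  by (rule p_eqI[symmetric, OF diff_p_in_N])

lemma in_N_if_p_0: "x \<in> bspace T \<Longrightarrow> p x = 0 \<Longrightarrow> x \<in> N"
  using diff_p_in_N[of x] by simp

lemma B_simps [simp]:
  "bspace B = p ` bspace T" "bmult B x y = p (bmult T x y)" "bone B = p (bone T)"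
  "bcomult B x = tensor_map p p (bcomult T x)" "bcounit B = bcounit T" "bdeg B n = p ` bdeg T n"
  "hact B h x = p (hact T h x)" "hcoact B x = tensor_map id p (hcoact T x)"
  by (simp_all add: braided_quot_def p_def Let_def)

text \<open>
  This and the next lemmas say that the operations of the quotient do not depend on the choice of
  representatives.
\<close>

lemma p_mult:
  assumes x: "x \<in> bspace T" and y: "y \<in> bspace T"
  shows "p (bmult T (p x) (p y)) = p (bmult T x y)"
proof -
  have "bmult T x y - bmult T (p x) (p y) = bmult T (x - p x) y + bmult T (p x) (y - p y)"
    by (simp add: lin_diff[OF bilin_right[OF bilin_mult]] lin_diff[OF bilin_left[OF bilin_mult]])
  also have "\<dots> \<in> N"
    using N_mult diff_p_in_N p_closed x y by (intro pm.subspace_add[OF subspace_N]) auto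
  finally show ?thesis by (rule p_eqI[symmetric])
qed

lemma p_act:
  assumes "h \<in> bspace H" "x \<in> bspace T"
  shows "p (hact T h (p x)) = p (hact T h x)"
  using N_act[OF assms(1) diff_p_in_N[OF assms(2)]]
  by (intro p_eqI[symmetric]) (simp add: lin_diff[OF bilin_right[OF bilin_act]])

lemma p_coact:
  assumes "x \<in> bspace T"
  shows "tensor_map id p (hcoact T (p x)) = tensor_map id p (hcoact T x)"
proof -
  have "tensor_map id p (hcoact T (x - p x)) = tensor_map id (\<lambda>_. 0) (hcoact T (x - p x))"
    by (rule tensor_map_eq_on[OF lin_id lin_p lin_id lin_zero _ _ N_coact[OF diff_p_in_N[OF assms]]])
      (simp_all add: p_N)
  also have "\<dots> = 0"
    by (rule lin_eqI[OF lin_tensor_map lin_zero]) (auto simp: tensor_zero_right)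
  finally show ?thesis
    by (simp add: lin_diff[OF lin_coact] lin_diff[OF lin_tensor_map])
qed

lemma p_comult:
  assumes "x \<in> bspace T"
  shows "tensor_map p p (bcomult T (p x)) = tensor_map p p (bcomult T x)"
proof -
  have "tensor_map p p t = 0" if "t \<in> tensor_space N (bspace T) \<union> tensor_space (bspace T) N" for t
  proof -
    have "tensor_map p p t = 0" if "t \<in> tensor_space N (bspace T)"
      using tensor_map_eq_on[OF lin_p lin_p lin_zero lin_p _ _ that] p_N
        lin_eqI[OF lin_tensor_map lin_zero, of "\<lambda>_. 0" p t] by (auto simp: tensor_zero_left)
    moreover have "tensor_map p p t = 0" if "t \<in> tensor_space (bspace T) N"
      using tensor_map_eq_on[OF lin_p lin_p lin_p lin_zero _ _ that] p_N
        lin_eqI[OF lin_tensor_map lin_zero, of p "\<lambda>_. 0" t] by (auto simp: tensor_zero_right)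
    ultimately show ?thesis using that by blast
  qed
  then have "tensor_map p p (bcomult T (x - p x)) = 0"
    by (rule lin_eq_on_span[OF lin_tensor_map lin_zero _ N_comult[OF diff_p_in_N[OF assms]]])
  then show ?thesis
    by (simp add: lin_diff[OF lin_comult] lin_diff[OF lin_tensor_map])
qed

lemma p_counit:
  assumes "x \<in> bspace T"
  shows "bcounit T (p x) = bcounit T x"
proof (rule vscale_bvec_inject)
  have "vscale (bcounit T (x - p x)) (bvec ()) = (0 :: (unit, 'k) vec)"
    by (simp add: N_counit diff_p_in_N assms)
  then show "vscale (bcounit T (p x)) (bvec ()) = vscale (bcounit T x) (bvec ())"
    using lin_diff[OF lin_counit, of x "p x"] by simp
qed

end

text \<open>
  Isomorphism of braided Hopf algebras over two different Hopf algebras, along an isomorphism \<open>\<phi>\<close> of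
  those. No inverse of \<open>\<phi>\<close> occurs in this form; \<open>braided_isomorphic_twist\<close> leads back to the twisted
  version over one Hopf algebra.
\<close>

definition braided_iso_over ::
  "('h, 'k::field) bialg \<Rightarrow> ('h2, 'k) bialg \<Rightarrow> ('b, 'k, 'h) braided \<Rightarrow> ('c, 'k, 'h2) braided \<Rightarrow>
   (('h, 'k) vec \<Rightarrow> ('h2, 'k) vec) \<Rightarrow> (('b, 'k) vec \<Rightarrow> ('c, 'k) vec) \<Rightarrow> bool" where
  "braided_iso_over H H' T T' \<phi> F \<longleftrightarrow>
     lin \<phi> \<and> bij_betw \<phi> (bspace H) (bspace H') \<and> graded_hopf_iso T T' F \<and>
     (\<forall>h\<in>bspace H. \<forall>x\<in>bspace T. F (hact T h x) = hact T' (\<phi> h) (F x)) \<and>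
     (\<forall>x\<in>bspace T. hcoact T' (F x) = tensor_map \<phi> F (hcoact T x))"

text \<open>
  Each defining condition is expressed through operations that \<open>F\<close> respects. The inclusion of the
  homogeneous components is needed to move the image past the intersections \<open>I \<inter> T\<^sub>n\<close>.
\<close>

lemma nichols_ideals_image:
  assumes iso: "braided_iso_over H H' T T' \<phi> F" and deg: "\<And>n. bdeg T n \<subseteq> bspace T"
    and I: "I \<in> nichols_ideals H T"
  shows "F ` I \<in> nichols_ideals H' T'"
proof -
  have lin\<phi>: "lin \<phi>" and linF: "lin F"
    and \<phi>: "\<phi> ` bspace H = bspace H'" and F: "F ` bspace T = bspace T'"
    and inj: "inj_on F (bspace T)"
    and mult: "\<And>x y. x \<in> bspace T \<Longrightarrow> y \<in> bspace T \<Longrightarrow> F (bmult T x y) = bmult T' (F x) (F y)"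
    and comult: "\<And>x. x \<in> bspace T \<Longrightarrow> bcomult T' (F x) = tensor_map F F (bcomult T x)"
    and counit: "\<And>x. x \<in> bspace T \<Longrightarrow> bcounit T' (F x) = bcounit T x"
    and degF: "\<And>n. F ` bdeg T n = bdeg T' n"
    and act: "\<And>h x. h \<in> bspace H \<Longrightarrow> x \<in> bspace T \<Longrightarrow> F (hact T h x) = hact T' (\<phi> h) (F x)"
    and coact: "\<And>x. x \<in> bspace T \<Longrightarrow> hcoact T' (F x) = tensor_map \<phi> F (hcoact T x)"
    using iso by (auto simp: braided_iso_over_def graded_hopf_iso_def hopf_iso_def bij_betw_def)
  have IT: "I \<subseteq> bspace T" and Ispan: "I = pm.span (\<Union>n\<in>{2..}. I \<inter> bdeg T n)"
    and Imult: "\<And>x y. x \<in> bspace T \<Longrightarrow> y \<in> I \<Longrightarrow> bmult T x y \<in> I \<and> bmult T y x \<in> I"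
    and Icomult: "\<And>y. y \<in> I \<Longrightarrow>
      bcomult T y \<in> pm.span (tensor_space I (bspace T) \<union> tensor_space (bspace T) I)"
    and Icounit: "\<And>y. y \<in> I \<Longrightarrow> bcounit T y = 0"
    and Iact: "\<And>h y. h \<in> bspace H \<Longrightarrow> y \<in> I \<Longrightarrow> hact T h y \<in> I"
    and Icoact: "\<And>y. y \<in> I \<Longrightarrow> hcoact T y \<in> tensor_space (bspace H) I"
    using I unfolding nichols_ideals_def by blast+
  show ?thesis
    unfolding nichols_ideals_def mem_Collect_eq
  proof (intro conjI ballI)
    show "F ` I \<subseteq> bspace T'" using IT F by blast
    have "F ` I = F ` pm.span (\<Union>n\<in>{2..}. I \<inter> bdeg T n)"
      by (subst Ispan) (rule refl)
    also have "\<dots> = pm.span (\<Union>n\<in>{2..}. F ` (I \<inter> bdeg T n))"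
      by (simp only: lin_span_image[OF linF] image_UN)
    also have "(\<Union>n\<in>{2..}. F ` (I \<inter> bdeg T n)) = (\<Union>n\<in>{2..}. F ` I \<inter> bdeg T' n)"
      unfolding degF[symmetric] by (simp only: inj_on_image_Int[OF inj IT deg])
    finally show "F ` I = pm.span (\<Union>n\<in>{2..}. F ` I \<inter> bdeg T' n)" .
  next
    fix x y assume "x \<in> bspace T'" "y \<in> F ` I"
    then obtain a b where ab: "x = F a" "a \<in> bspace T" "y = F b" "b \<in> I"
      using F by blast
    then have "b \<in> bspace T" using IT by blast
    then show "bmult T' x y \<in> F ` I" "bmult T' y x \<in> F ` I"
      using ab Imult[OF ab(2,4)] mult by (simp_all flip: mult)
  next
    fix y assume "y \<in> F ` I"
    then obtain b where b: "y = F b" "b \<in> I" by blast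
    then have bT: "b \<in> bspace T" using IT by blast
    have "tensor_map F F (bcomult T b) \<in>
        pm.span (tensor_space (F ` I) (bspace T') \<union> tensor_space (bspace T') (F ` I))"
    proof (rule lin_in_span[OF lin_tensor_map _ pm.subspace_span Icomult[OF b(2)]])
      fix t assume "t \<in> tensor_space I (bspace T) \<union> tensor_space (bspace T) I"
      then have "tensor_map F F t \<in> tensor_space (F ` I) (bspace T') \<union> tensor_space (bspace T') (F ` I)"
        using tensor_map_in_tensor_space[OF linF linF, of I "F ` I" "bspace T" "bspace T'" t]
          tensor_map_in_tensor_space[OF linF linF, of "bspace T" "bspace T'" I "F ` I" t] F by blast
      then show "tensor_map F F t \<in>
          pm.span (tensor_space (F ` I) (bspace T') \<union> tensor_space (bspace T') (F ` I))"
        by (rule pm.span_base)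
    qed
    then show "bcomult T' y \<in>
        pm.span (tensor_space (F ` I) (bspace T') \<union> tensor_space (bspace T') (F ` I))"
      using comult[OF bT] b by simp
    show "bcounit T' y = 0"
      using counit[OF bT] Icounit[OF b(2)] b by simp
    have "tensor_map \<phi> F (hcoact T b) \<in> tensor_space (bspace H') (F ` I)"
      by (rule tensor_map_in_tensor_space[OF lin\<phi> linF _ _ Icoact[OF b(2)]]) (use \<phi> in blast)+
    then show "hcoact T' y \<in> tensor_space (bspace H') (F ` I)"
      using coact[OF bT] b by simp
    fix h assume "h \<in> bspace H'"
    then obtain g where g: "h = \<phi> g" "g \<in> bspace H" using \<phi> by blast
    show "hact T' h y \<in> F ` I"
      using imageI[OF Iact[OF g(2) b(2)], of F] by (simp add: act[OF g(2) bT] g(1) b(1))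
  qed
qed

text \<open>
  The map \<open>F\<close> carries the Nichols ideal onto the Nichols ideal, but it need not respect the chosen
  complements that serve as quotient spaces. Composing it with the projection of the target corrects
  this, and \<open>f (p x) = f x\<close> makes the composite compatible with all operations.
\<close>

lemma braided_quot_iso:
  assumes "braided_space H T" and "braided_space H' T'"
    and iso: "braided_iso_over H H' T T' \<phi> F" and iso': "braided_iso_over H' H T' T \<phi>' F'"
    and inverse: "\<And>y. y \<in> bspace T' \<Longrightarrow> F (F' y) = y"
  shows "braided_iso_over H H' (braided_quot T (nichols_ideal H T)) (braided_quot T' (nichols_ideal H' T'))
    \<phi> (\<lambda>x. quot_proj (bspace T') (nichols_ideal H' T') (F x))"
proof -
  interpret T: braided_space H T by fact
  interpret T': braided_space H' T' by fact
  have lin\<phi>: "lin \<phi>" and linF: "lin F"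
    and \<phi>: "\<phi> ` bspace H = bspace H'" and F: "F ` bspace T = bspace T'"
    and inj: "inj_on F (bspace T)" and bij\<phi>: "bij_betw \<phi> (bspace H) (bspace H')"
    and mult: "\<And>x y. x \<in> bspace T \<Longrightarrow> y \<in> bspace T \<Longrightarrow> F (bmult T x y) = bmult T' (F x) (F y)"
    and one: "F (bone T) = bone T'"
    and comult: "\<And>x. x \<in> bspace T \<Longrightarrow> bcomult T' (F x) = tensor_map F F (bcomult T x)"
    and counit: "\<And>x. x \<in> bspace T \<Longrightarrow> bcounit T' (F x) = bcounit T x"
    and degF: "\<And>n. F ` bdeg T n = bdeg T' n"
    and act: "\<And>h x. h \<in> bspace H \<Longrightarrow> x \<in> bspace T \<Longrightarrow> F (hact T h x) = hact T' (\<phi> h) (F x)"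
    and coact: "\<And>x. x \<in> bspace T \<Longrightarrow> hcoact T' (F x) = tensor_map \<phi> F (hcoact T x)"
    using iso by (auto simp: braided_iso_over_def graded_hopf_iso_def hopf_iso_def bij_betw_def)
  have FT: "F x \<in> bspace T'" if "x \<in> bspace T" for x using F that by blast
  have N: "F ` T.N = T'.N"
  proof
    have "F ` (\<Union>(nichols_ideals H T)) \<subseteq> \<Union>(nichols_ideals H' T')"
      using nichols_ideals_image[OF iso T.deg_subset] by blast
    then show "F ` T.N \<subseteq> T'.N"
      unfolding T.N_def T'.N_def nichols_ideal_def lin_span_image[OF linF] by (rule pm.span_mono)
    have "I' \<subseteq> F ` (\<Union>(nichols_ideals H T))" if I': "I' \<in> nichols_ideals H' T'" for I'
    proof
      fix y assume y: "y \<in> I'"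
      then have "y \<in> bspace T'" using I' by (auto simp: nichols_ideals_def)
      then have "y = F (F' y)" using inverse by simp
      then show "y \<in> F ` (\<Union>(nichols_ideals H T))"
        using nichols_ideals_image[OF iso' T'.deg_subset I'] y by blast
    qed
    then have "(\<Union>(nichols_ideals H' T')) \<subseteq> F ` (\<Union>(nichols_ideals H T))" by blast
    then show "T'.N \<subseteq> F ` T.N"
      unfolding T.N_def T'.N_def nichols_ideal_def lin_span_image[OF linF] by (rule pm.span_mono)
  qed
  define f where "f x = T'.p (F x)" for x
  have linf: "lin f" unfolding f_def by (rule lin_compose[OF T'.lin_p linF])
  have fp: "f (T.p x) = f x" if "x \<in> bspace T" for x
  proof -
    have "F (x - T.p x) \<in> T'.N" using T.diff_p_in_N[OF that] N by blast
    then show ?thesis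
      unfolding f_def by (intro T'.p_eqI[symmetric]) (simp add: lin_diff[OF linF])
  qed
  have bij: "bij_betw f (bspace T.B) (bspace T'.B)"
    unfolding bij_betw_def
  proof
    show "inj_on f (bspace T.B)"
    proof (rule inj_onI)
      fix x y assume "x \<in> bspace T.B" "y \<in> bspace T.B" and eq: "f x = f y"
      then have x: "x \<in> bspace T" "T.p x = x" and y: "y \<in> bspace T" "T.p y = y"
        using T.p_closed T.p_idem by auto
      have xy: "x - y \<in> bspace T" using x y pm.subspace_diff[OF T.subspace_T] by blast
      have "T'.p (F (x - y)) = 0"
        using eq unfolding f_def by (simp add: lin_diff[OF linF] lin_diff[OF T'.lin_p])
      then have "F (x - y) \<in> F ` T.N"
        unfolding N by (rule T'.in_N_if_p_0[OF FT[OF xy]])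
      then have "x - y \<in> T.N"
        using inj xy T.N_subset by (meson inj_on_image_mem_iff)
      then show "x = y" using T.p_eqI[of x y] x y by simp
    qed
    have "f ` T.p ` bspace T = f ` bspace T"
      using fp by (auto simp: image_image)
    then show "f ` bspace T.B = bspace T'.B"
      using F by (simp add: f_def image_image[symmetric])
  qed
  have deg: "f ` bdeg T.B n = bdeg T'.B n" for n
  proof -
    have "f ` T.p ` bdeg T n = f ` bdeg T n"
      using fp T.deg_subset unfolding image_image by (intro image_cong) auto
    also have "\<dots> = T'.p ` bdeg T' n" unfolding f_def degF[symmetric] image_image ..
    finally show ?thesis by simp
  qed
  have BT: "x \<in> bspace T" if "x \<in> bspace T.B" for x using that T.p_closed by auto
  have "hopf_iso T.B T'.B f"
    unfolding hopf_iso_def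
  proof (intro conjI ballI linf bij)
    show "f (bmult T.B x y) = bmult T'.B (f x) (f y)" if "x \<in> bspace T.B" "y \<in> bspace T.B" for x y
      using fp[OF T.mult_closed[OF BT[OF that(1)] BT[OF that(2)]]] BT that
      by (simp add: f_def mult T'.p_mult FT)
    show "f (bone T.B) = bone T'.B"
      using fp[OF T.one_closed] by (simp add: f_def one)
    show "bcounit T'.B (f x) = bcounit T.B x" if "x \<in> bspace T.B" for x
      using BT[OF that] by (simp add: f_def T'.p_counit FT counit)
    show "bcomult T'.B (f x) = tensor_map f f (bcomult T.B x)" if "x \<in> bspace T.B" for x
    proof -
      have "bcomult T'.B (f x) = tensor_map T'.p T'.p (tensor_map F F (bcomult T x))"
        using BT[OF that] by (simp add: f_def T'.p_comult FT comult)
      also have "\<dots> = tensor_map f f (bcomult T x)"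
        by (simp add: tensor_map_compose T'.lin_p f_def[abs_def])
      also have "\<dots> = tensor_map (\<lambda>x. f (T.p x)) (\<lambda>x. f (T.p x)) (bcomult T x)"
        by (rule tensor_map_eq_on[OF linf linf lin_compose[OF linf T.lin_p] lin_compose[OF linf T.lin_p]
              _ _ T.comult_closed[OF BT[OF that]]]) (simp_all add: fp)
      also have "\<dots> = tensor_map f f (bcomult T.B x)"
        by (simp add: tensor_map_compose linf)
      finally show ?thesis .
    qed
  qed
  then have gr: "graded_hopf_iso T.B T'.B f"
    using deg by (simp add: graded_hopf_iso_def)
  have actf: "f (hact T.B h x) = hact T'.B (\<phi> h) (f x)" if "h \<in> bspace H" "x \<in> bspace T.B" for h x
    using fp[OF T.act_closed[OF that(1) BT[OF that(2)]]] that BT \<phi>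
    by (simp add: f_def act T'.p_act FT image_subset_iff flip: \<phi>)
  have coactf: "hcoact T'.B (f x) = tensor_map \<phi> f (hcoact T.B x)" if "x \<in> bspace T.B" for x
  proof -
    have "hcoact T'.B (f x) = tensor_map id T'.p (tensor_map \<phi> F (hcoact T x))"
      using BT[OF that] by (simp add: f_def T'.p_coact FT coact)
    also have "\<dots> = tensor_map \<phi> f (hcoact T x)"
      by (simp add: tensor_map_compose T'.lin_p lin_id f_def[abs_def])
    also have "\<dots> = tensor_map \<phi> (\<lambda>x. f (T.p x)) (hcoact T x)"
      by (rule tensor_map_eq_on[OF lin\<phi> linf lin\<phi> lin_compose[OF linf T.lin_p]
            _ _ T.coact_closed[OF BT[OF that]]]) (simp_all add: fp)
    also have "\<dots> = tensor_map \<phi> f (hcoact T.B x)"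
      by (simp add: tensor_map_compose linf lin\<phi>)
    finally show ?thesis .
  qed
  have "braided_iso_over H H' T.B T'.B \<phi> f"
    unfolding braided_iso_over_def using lin\<phi> bij\<phi> gr actf coactf by blast
  then show ?thesis
    unfolding f_def T'.p_def T.N_def T'.N_def .
qed

section \<open>The Nichols algebra of an element system\<close>

lemma bilin_vcons: "bilin vcons"
  by (simp add: vcons_def)

lemma vcons_bvec [simp]: "vcons (bvec b) (bvec w) = bvec (b # w)"
  by (simp add: vcons_def)

lemma tpow_coord_space: 
  "tpow (coord_space S :: ('a, 'k::field) vec set) n = coord_space {w. length w = n \<and> set w \<subseteq> S}"
proof (induction n)
  case 0
  have "{w :: 'a list. length w = 0 \<and> set w \<subseteq> S} = {[]}" by auto
  then show ?case by (simp add: coord_space_eq_span)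
next
  case (Suc n)
  let ?W = "\<lambda>n. {w :: 'a list. length w = n \<and> set w \<subseteq> S}"
  have "tpow (coord_space S :: ('a, 'k) vec set) (Suc n) =
      pm.span {vcons v t | v t. v \<in> coord_space S \<and> t \<in> (coord_space (?W n) :: ('a list, 'k) vec set)}"
    using Suc by simp
  also have "\<dots> = coord_space (?W (Suc n))"
  proof
    show "pm.span {vcons v t | v t. v \<in> coord_space S \<and> t \<in> coord_space (?W n)} \<subseteq>
        (coord_space (?W (Suc n)) :: ('a list, 'k) vec set)"
    proof (rule pm.span_minimal[OF _ subspace_coord_space], safe)
      fix v :: "('a, 'k) vec" and t :: "('a list, 'k) vec" assume "v \<in> coord_space S" "t \<in> coord_space (?W n)"
      then show "vcons v t \<in> coord_space (?W (Suc n))"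
        by (rule bilin_in_coord[OF bilin_vcons _ subspace_coord_space, rotated]) auto
    qed
    have "bvec w \<in> pm.span {vcons v t | v t. v \<in> coord_space S \<and> t \<in> (coord_space (?W n) :: ('a list, 'k) vec set)}"
      if wn: "w \<in> ?W (Suc n)" for w
    proof -
      obtain b u where w: "w = b # u" using wn by (cases w) auto
      then have "bvec w = vcons (bvec b) (bvec u :: ('a list, 'k) vec)" by simp
      then show ?thesis
        using wn unfolding w by (intro pm.span_base) fastforce
    qed
    then show "coord_space (?W (Suc n)) \<subseteq>
        pm.span {vcons v t | v t. v \<in> coord_space S \<and> t \<in> (coord_space (?W n) :: ('a list, 'k) vec set)}"
      unfolding coord_space_eq_span[of "?W (Suc n)"] by (intro pm.span_minimal) auto
  qed
  finally show ?case .
qed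

lemma bij_betw_map_words:
  assumes "bij_betw f S T"
  shows "bij_betw (map f) {w. P (length w) \<and> set w \<subseteq> S} {w. P (length w) \<and> set w \<subseteq> T}"
proof (rule bij_betw_byWitness[where f' = "map (inv_into S f)"])
  have inv: "inv_into S f (f x) = x" "f x \<in> T" if "x \<in> S" for x
    using that assms by (auto simp: bij_betw_inv_into_left bij_betwE)
  have inv': "f (inv_into S f y) = y" "inv_into S f y \<in> S" if "y \<in> T" for y
    using that assms bij_betwE[OF bij_betw_inv_into[OF assms]] by (auto simp: bij_betw_inv_into_right)
  show "\<forall>w\<in>{w. P (length w) \<and> set w \<subseteq> S}. map (inv_into S f) (map f w) = w"
    by (auto intro!: map_idI simp: inv subset_iff)
  show "\<forall>w\<in>{w. P (length w) \<and> set w \<subseteq> T}. map f (map (inv_into S f) w) = w"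
    by (auto intro!: map_idI simp: inv' subset_iff)
qed (use assms bij_betwE[OF assms] bij_betwE[OF bij_betw_inv_into[OF assms]] in \<open>auto simp: subset_iff\<close>)

definition wchr :: "('g, 'i, 'k::field) esc \<Rightarrow> 'i list \<Rightarrow> 'g \<Rightarrow> 'k" where
  "wchr E w g = prod_list (map (\<lambda>i. echr E i g) w)"

definition wdeg :: "('g, 'i, 'k::field) esc \<Rightarrow> 'i list \<Rightarrow> 'g" where
  "wdeg E w = foldr (\<lambda>i g. eelt E i \<otimes>\<^bsub>egrp E\<^esub> g) w \<one>\<^bsub>egrp E\<^esub>"

abbreviation TV :: "('g, 'i, 'k::field) esc \<Rightarrow> ('i list, 'k, 'g) braided" where
  "TV E \<equiv> tensor_algebra (gralg E) (yd_V E)"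

lemma yd_V_simps [simp]:
  "yact (yd_V E) (bvec g) (bvec i) = vscale (echr E i g) (bvec i)"
  "ycoact (yd_V E) (bvec i) = bvec (eelt E i, i)"
  "yspace (yd_V E) = coord_space (eidx E)"
  by (simp_all add: yd_V_def)

lemma tens_act_bvec:
  "tens_act (gralg E) (yd_V E) w (bvec g) = vscale (wchr E w g) (bvec w)"
  by (induction w)
    (simp_all add: wchr_def lin_scale[OF bilin_left[OF bilin_vcons]] lin_scale[OF bilin_right[OF bilin_vcons]]
      mult.commute)

lemma lin_tens_act: "lin (tens_act (gralg E) (yd_V E) w)"
proof (cases w)
  case Nil
  have "tens_act (gralg E) (yd_V E) [] = lin_ext (\<lambda>_. bvec [])"
    by (rule ext) (simp add: bcounit_group_algebra)
  then show ?thesis by (simp only: Nil lin_lin_ext)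
next
  case (Cons b u)
  have "tens_act (gralg E) (yd_V E) (b # u) =
      (\<lambda>h. lin_ext (\<lambda>(a, c). vcons (yact (yd_V E) (bvec a) (bvec b))
        (tens_act (gralg E) (yd_V E) u (bvec c))) (bcomult (gralg E) h))"
    by (rule ext) simp
  then show ?thesis
    unfolding Cons by (simp only: lin_compose[OF lin_lin_ext group_algebra_simps(7)])
qed

lemma tens_coact_eq:
  "tens_coact (gralg E) (yd_V E) w = bvec (wdeg E w, w)"
  by (induction w) (simp_all add: wdeg_def)

text \<open>
  The braiding is diagonal: moving the letter \<open>b\<close> past the word \<open>x\<close> costs the scalar \<open>\<chi>\<^sub>x(g\<^sub>b)\<close>.
\<close>

lemma tens_comult_Cons:
  "tens_comult (gralg E) (yd_V E) (b # w) =
    lin_ext (\<lambda>(x, y). bvec (b # x, y) + vscale (wchr E x (eelt E b)) (bvec (x, b # y)))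
      (tens_comult (gralg E) (yd_V E) w)"
  by (simp add: tens_act_bvec tensor_scale_left)

lemma TV_simps:
  "bmult (TV E) (bvec u) (bvec w) = bvec (u @ w)"
  "bone (TV E) = bvec []"
  "bcomult (TV E) (bvec w) = tens_comult (gralg E) (yd_V E) w"
  "bcounit (TV E) x = Poly_Mapping.lookup x []"
  "bdeg (TV E) n = coord_space {w. length w = n \<and> set w \<subseteq> eidx E}"
  "hact (TV E) (bvec g) (bvec w) = vscale (wchr E w g) (bvec w)"
  "hcoact (TV E) (bvec w) = bvec (wdeg E w, w)"
  by (simp_all add: tensor_algebra_def tpow_coord_space tens_act_bvec tens_coact_eq)

lemma bspace_TV: "bspace (TV E) = coord_space {w. set w \<subseteq> eidx E}"
proof
  show "bspace (TV E) \<subseteq> coord_space {w. set w \<subseteq> eidx E}"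
    unfolding tensor_algebra_def braided.simps graded_bialg.simps bialg.simps tpow_coord_space yd_V_simps
    by (intro pm.span_minimal[OF _ subspace_coord_space] UN_least coord_space_mono) auto
  have "bvec w \<in> bspace (TV E)" if "set w \<subseteq> eidx E" for w
    unfolding tensor_algebra_def braided.simps graded_bialg.simps bialg.simps tpow_coord_space yd_V_simps
    using that by (intro pm.span_base UN_I[of "length w"]) auto
  moreover have "pm.subspace (bspace (TV E))"
    by (simp add: tensor_algebra_def)
  ultimately show "coord_space {w. set w \<subseteq> eidx E} \<subseteq> bspace (TV E)"
    unfolding coord_space_eq_span by (intro pm.span_minimal) auto
qed

lemma tens_comult_closed:
  assumes "set w \<subseteq> S"
  shows "tens_comult (gralg E) (yd_V E) w \<in> coord_space ({u. set u \<subseteq> S} \<times> {u. set u \<subseteq> S})"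
  using assms
proof (induction w)
  case (Cons b w)
  then have "tens_comult (gralg E) (yd_V E) w \<in> coord_space ({u. set u \<subseteq> S} \<times> {u. set u \<subseteq> S})"
    by simp
  then show ?case
    unfolding tens_comult_Cons
    by (rule lin_in_coord[OF lin_lin_ext _ subspace_coord_space, rotated])
      (use Cons.prems in \<open>auto intro!: pm.subspace_add pm.subspace_scale subspace_coord_space\<close>)
qed simp

lemma wdeg_closed:
  assumes "ESC E" "set w \<subseteq> eidx E"
  shows "wdeg E w \<in> carrier (egrp E)"
proof -
  interpret group "egrp E" by (rule ESC_group) fact
  show ?thesis using assms(2)
    by (induction w) (auto simp: wdeg_def ESC_elt[OF assms(1)])
qed

lemma braided_space_TV:
  assumes E: "ESC E"
  shows "braided_space (gralg E) (TV E)"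
proof (rule braided_space.intro)
  interpret group "egrp E" by (rule ESC_group) fact
  let ?W = "{w. set w \<subseteq> eidx E}"
  show "pm.subspace (bspace (TV E))" by (simp add: bspace_TV subspace_coord_space)
  show "bdeg (TV E) n \<subseteq> bspace (TV E)" for n
    unfolding bspace_TV TV_simps by (rule coord_space_mono) auto
  show mult: "bilin (bmult (TV E))" and comult: "lin (bcomult (TV E))" and coact: "lin (hcoact (TV E))"
    by (simp_all add: tensor_algebra_def)
  show "lin (\<lambda>x. vscale (bcounit (TV E) x) (bvec ()))"
    by (rule linI) (simp_all add: TV_simps lookup_add lookup_vscale pm.scale_left_distrib)
  show act: "bilin (hact (TV E))"
    unfolding tensor_algebra_def braided.simps
    by (intro bilinI lin_lin_ext lin_lin_ext_param lin_tens_act)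
  show "bone (TV E) \<in> bspace (TV E)" by (simp add: bspace_TV TV_simps)
  show "bmult (TV E) x y \<in> bspace (TV E)" if "x \<in> bspace (TV E)" "y \<in> bspace (TV E)" for x y
    using that unfolding bspace_TV
    by (rule bilin_in_coord[OF mult _ subspace_coord_space, rotated]) (auto simp: TV_simps)
  show "bcomult (TV E) x \<in> tensor_space (bspace (TV E)) (bspace (TV E))" if "x \<in> bspace (TV E)" for x
  proof -
    have "bcomult (TV E) x \<in> coord_space (?W \<times> ?W)"
      using that unfolding bspace_TV
      by (rule lin_in_coord[OF comult _ subspace_coord_space, rotated])
        (simp add: TV_simps tens_comult_closed)
    then show ?thesis unfolding bspace_TV using coord_space_subset_tensor_space by blast
  qed
  show "hact (TV E) h x \<in> bspace (TV E)" if "h \<in> bspace (gralg E)" "x \<in> bspace (TV E)" for h x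
    using that unfolding bspace_TV group_algebra_simps
    by (rule bilin_in_coord[OF act _ subspace_coord_space, rotated])
      (auto simp: TV_simps intro: pm.subspace_scale[OF subspace_coord_space])
  show "hcoact (TV E) x \<in> tensor_space (bspace (gralg E)) (bspace (TV E))"
    if "x \<in> bspace (TV E)" for x
  proof -
    have "hcoact (TV E) x \<in> coord_space (carrier (egrp E) \<times> ?W)"
      using that unfolding bspace_TV
      by (rule lin_in_coord[OF coact _ subspace_coord_space, rotated])
        (simp add: TV_simps wdeg_closed[OF E])
    then show ?thesis unfolding bspace_TV group_algebra_simps using coord_space_subset_tensor_space by blast
  qed
qed

text \<open>
  Renaming letters along \<open>\<sigma>\<close> preserves the characters and degrees of words, which are the only
  parameters of the structure maps of the tensor algebra.
\<close>

lemma TV_iso: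
  assumes E: "ESC E" and E': "ESC E'" and iso: "esc_iso E E' \<psi> \<sigma>"
  shows "braided_iso_over (gralg E) (gralg E') (TV E) (TV E')
    (basis_map \<psi>) (basis_map (map \<sigma>))"
proof -
  have \<psi>: "\<psi> \<in> iso (egrp E) (egrp E')" and \<sigma>: "bij_betw \<sigma> (eidx E) (eidx E')"
    and elt: "\<And>i. i \<in> eidx E \<Longrightarrow> \<psi> (eelt E i) = eelt E' (\<sigma> i)"
    and chr: "\<And>i h. i \<in> eidx E \<Longrightarrow> h \<in> carrier (egrp E) \<Longrightarrow> echr E' (\<sigma> i) (\<psi> h) = echr E i h"
    using iso by (auto simp: esc_iso_def)
  interpret T: braided_space "gralg E" "TV E" by (rule braided_space_TV[OF E])
  interpret T': braided_space "gralg E'" "TV E'" by (rule braided_space_TV[OF E'])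
  have hom: "\<psi> \<in> hom (egrp E) (egrp E')" and bij: "bij_betw \<psi> (carrier (egrp E)) (carrier (egrp E'))"
    using \<psi> by (auto simp: iso_def)
  let ?F = "basis_map (map \<sigma>)" and ?W = "{w. set w \<subseteq> eidx E}" and ?W' = "{w. set w \<subseteq> eidx E'}"
  have \<sigma>J: "\<sigma> ` eidx E = eidx E'" using \<sigma> by (simp add: bij_betw_def)
  have wchr: "wchr E' (map \<sigma> w) (\<psi> g) = wchr E w g" if "set w \<subseteq> eidx E" "g \<in> carrier (egrp E)" for w g
    using that(1) by (induction w) (auto simp: wchr_def chr that(2))
  have wdeg: "wdeg E' (map \<sigma> w) = \<psi> (wdeg E w)" if "set w \<subseteq> eidx E" for w
    using that
  proof (induction w)
    case Nil
    then show ?case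
      using hom_one[OF hom ESC_group[OF E] ESC_group[OF E']] by (simp add: wdeg_def)
  next
    case (Cons i w)
    then show ?case
      using hom_mult[OF hom, of "eelt E i" "wdeg E w"] ESC_elt[OF E] elt wdeg_closed[OF E, of w]
      by (simp add: wdeg_def)
  qed
  have bijW: "bij_betw (map \<sigma>) {w. length w = n \<and> set w \<subseteq> eidx E} {w. length w = n \<and> set w \<subseteq> eidx E'}" for n
    using bij_betw_map_words[OF \<sigma>, of "\<lambda>m. m = n"] by simp
  have bijL: "bij_betw (map \<sigma>) ?W ?W'"
    using bij_betw_map_words[OF \<sigma>, of "\<lambda>_. True"] by simp
  have comult_word: "tens_comult (gralg E') (yd_V E') (map \<sigma> w) =
      tensor_map ?F ?F (tens_comult (gralg E) (yd_V E) w)" if "set w \<subseteq> eidx E" for w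
    using that
  proof (induction w)
    case (Cons b w)
    let ?t = "tens_comult (gralg E) (yd_V E) w"
    let ?D = "\<lambda>E b. lin_ext (\<lambda>(x, y). bvec (b # x, y) + vscale (wchr E x (eelt E b)) (bvec (x, b # y)))"
    have t: "?t \<in> coord_space (?W \<times> ?W)" using Cons by (intro tens_comult_closed) auto
    have "?D E' (\<sigma> b) (tensor_map ?F ?F ?t) = tensor_map ?F ?F (?D E b ?t)"
    proof (rule lin_eq_on_coord[OF lin_compose[OF lin_lin_ext lin_tensor_map]
            lin_compose[OF lin_tensor_map lin_lin_ext] _ t])
      fix xy assume "xy \<in> ?W \<times> ?W"
      then obtain x y where xy: "xy = (x, y)" "set x \<subseteq> eidx E" by auto
      have "wchr E' (map \<sigma> x) (eelt E' (\<sigma> b)) = wchr E x (eelt E b)"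
        using wchr[OF xy(2) ESC_elt[OF E, of b]] Cons.prems elt[of b] by simp
      then show "?D E' (\<sigma> b) (tensor_map ?F ?F (bvec xy)) = tensor_map ?F ?F (?D E b (bvec xy))"
        by (simp add: xy(1) lin_add[OF lin_tensor_map] lin_scale[OF lin_tensor_map])
    qed
    then show ?case
      using Cons by (simp add: tens_comult_Cons del: tens_comult.simps(2))
  qed simp
  have "hopf_iso (TV E) (TV E') ?F"
    unfolding hopf_iso_def
  proof (intro conjI ballI lin_basis_map)
    show "bij_betw ?F (bspace (TV E)) (bspace (TV E'))"
      unfolding bspace_TV by (rule bij_betw_basis_map[OF bijL])
    show "?F (bmult (TV E) x y) = bmult (TV E') (?F x) (?F y)" for x y
      by (rule bilin_eqI[OF lin_compose_bilin[OF lin_basis_map T.bilin_mult]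
            bilin_compose[OF T'.bilin_mult lin_basis_map lin_basis_map]]) (simp add: TV_simps)
    show "?F (bone (TV E)) = bone (TV E')" by (simp add: TV_simps)
    show "bcomult (TV E') (?F x) = tensor_map ?F ?F (bcomult (TV E) x)" if "x \<in> bspace (TV E)" for x
      using that unfolding bspace_TV
      by (rule lin_eq_on_coord[OF lin_compose[OF T'.lin_comult lin_basis_map]
            lin_compose[OF lin_tensor_map T.lin_comult], rotated])
        (simp add: TV_simps comult_word)
    show "bcounit (TV E') (?F x) = bcounit (TV E) x" for x
    proof (rule vscale_bvec_inject)
      show "vscale (bcounit (TV E') (?F x)) (bvec ()) = vscale (bcounit (TV E) x) (bvec ())"
        by (rule lin_eqI[OF lin_compose[OF T'.lin_counit lin_basis_map] T.lin_counit])
          (simp add: TV_simps lookup_bvec)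
    qed
  qed
  moreover have "?F ` bdeg (TV E) n = bdeg (TV E') n" for n
    unfolding TV_simps using bij_betw_basis_map[OF bijW] by (rule bij_betw_imp_surj_on)
  moreover have "?F (hact (TV E) h x) = hact (TV E') (basis_map \<psi> h) (?F x)"
    if "h \<in> bspace (gralg E)" "x \<in> bspace (TV E)" for h x
    using that unfolding bspace_TV group_algebra_simps
    by (rule bilin_eq_on_coord[OF lin_compose_bilin[OF lin_basis_map T.bilin_act]
          bilin_compose[OF T'.bilin_act lin_basis_map lin_basis_map], rotated])
      (simp add: TV_simps wchr lin_scale[OF lin_basis_map])
  moreover have "hcoact (TV E') (?F x) = tensor_map (basis_map \<psi>) ?F (hcoact (TV E) x)"
    if "x \<in> bspace (TV E)" for x
    using that unfolding bspace_TV
    by (rule lin_eq_on_coord[OF lin_compose[OF T'.lin_coact lin_basis_map]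
          lin_compose[OF lin_tensor_map T.lin_coact], rotated])
      (simp add: TV_simps wdeg)
  ultimately show ?thesis
    unfolding braided_iso_over_def graded_hopf_iso_def using bij_betw_basis_map[OF bij] by simp
qed

text \<open>
  The twist uses a set-theoretic inverse of \<open>\<phi>\<close>. Coactions take values in the span of group elements,
  where this inverse agrees with \<open>\<psi>\<^sup>-\<^sup>1\<close>.
\<close>

lemma braided_isomorphic_twist:
  fixes X :: "('a, 'd::field, 'c) braided"
  assumes X: "\<And>x. x \<in> bspace X \<Longrightarrow> hcoact X x \<in> tensor_space (bspace H) (bspace X)"
    and bij: "bij_betw \<phi> (bspace H) (bspace H')" and H: "bspace H = coord_space S"
    and \<phi>: "\<And>g. g \<in> S \<Longrightarrow> \<phi> (bvec g) = bvec (\<psi> g)"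
    and iso: "braided_iso_over H H' X Y \<phi> f"
  shows "braided_isomorphic H X (braided_twist H \<phi> Y)"
proof -
  have f: "lin f" "graded_hopf_iso X Y f" "bij_betw f (bspace X) (bspace Y)"
    and act: "\<And>h x. h \<in> bspace H \<Longrightarrow> x \<in> bspace X \<Longrightarrow> f (hact X h x) = hact Y (\<phi> h) (f x)"
    and coact: "\<And>x. x \<in> bspace X \<Longrightarrow> hcoact Y (f x) = tensor_map \<phi> f (hcoact X x)"
    using iso by (auto simp: braided_iso_over_def graded_hopf_iso_def hopf_iso_def)
  let ?inv = "inv_into (bspace H) \<phi>"
  have inv: "?inv (bvec (\<psi> g)) = bvec g" if "g \<in> S" for g
    using inv_into_f_f[OF bij_betw_imp_inj_on[OF bij], of "bvec g"] that by (simp add: \<phi> H)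
  have twist: "tensor_map ?inv id (hcoact Y (f x)) = tensor_map id f (hcoact X x)" if x: "x \<in> bspace X" for x
  proof -
    have "tensor_space (bspace H) (bspace X) \<subseteq> coord_space (S \<times> UNIV)"
      unfolding tensor_space_def H
    proof (rule pm.span_minimal[OF _ subspace_coord_space], safe)
      fix u :: "('c, 'd) vec" and v :: "('a, 'd) vec" assume "u \<in> coord_space S"
      then show "tensor u v \<in> coord_space (S \<times> UNIV)"
        by (rule bilin_in_coord[OF bilin_tensor _ subspace_coord_space, of _ UNIV, rotated]) auto
    qed
    then have "hcoact X x \<in> coord_space (S \<times> UNIV)" using X[OF x] by blast
    then have "tensor_map ?inv id (tensor_map \<phi> f (hcoact X x)) = tensor_map id f (hcoact X x)"
      by (rule lin_eq_on_coord[OF lin_compose[OF lin_tensor_map lin_tensor_map] lin_tensor_map, rotated])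
        (auto simp: \<phi> tensor_map_tensor_bvec lin_id inv)
    then show ?thesis by (simp add: coact[OF x])
  qed
  have "graded_hopf_iso X (braided_twist H \<phi> Y) f"
    using f(2) by (simp add: graded_hopf_iso_def hopf_iso_def braided_twist_def)
  moreover have "yd_iso H (yd_of X) (yd_of (braided_twist H \<phi> Y)) f"
    using f act twist by (simp add: yd_iso_def yd_of_def braided_twist_def yd_twist_def)
  ultimately show ?thesis unfolding braided_isomorphic_def by blast
qed

lemma nichols_eq_quot:
  assumes "braided_space H T" "T = tensor_algebra H V"
  shows "nichols H V = braided_space.B H T"
  using assms braided_space.N_def[OF assms(1)] by (simp add: nichols_def)

lemma nichols_ideal_degree:
  assumes E: "ESC E"
  shows "nichols_ideal (gralg E) (TV E) \<subseteq> coord_space {w. 2 \<le> length w}"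
  unfolding nichols_ideal_def
proof (rule pm.span_minimal[OF _ subspace_coord_space], rule Union_least)
  fix I assume "I \<in> nichols_ideals (gralg E) (TV E)"
  then have "I = pm.span (\<Union>n\<in>{2..}. I \<inter> bdeg (TV E) n)"
    by (simp add: nichols_ideals_def)
  also have "\<dots> \<subseteq> coord_space {w. 2 \<le> length w}"
  proof (rule pm.span_minimal[OF _ subspace_coord_space], rule UN_least)
    fix n :: nat assume "n \<in> {2..}"
    then have "bdeg (TV E) n \<subseteq> coord_space {w. 2 \<le> length w}"
      unfolding TV_simps by (intro coord_space_mono) auto
    then show "I \<inter> bdeg (TV E) n \<subseteq> coord_space {w. 2 \<le> length w}" by blast
  qed
  finally show "I \<subseteq> coord_space {w. 2 \<le> length w}" .
qed

definition nichols_deg1 :: "('g, 'i, 'k::field) esc \<Rightarrow> ('g, 'i list, 'k) yd_mod" where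
  "nichols_deg1 E = (let B = nichols (gralg E) (yd_V E) in
     \<lparr>yspace = bdeg B 1, yact = hact B, ycoact = hcoact B\<rparr>)"

definition nichols_gen :: "('g, 'i, 'k::field) esc \<Rightarrow> 'i \<Rightarrow> ('i list, 'k) vec" where
  "nichols_gen E i = braided_space.p (gralg E) (TV E) (bvec [i])"

text \<open>
  The projection from the tensor algebra is injective in degree 1 because the Nichols ideal only
  contains words of length at least 2; hence the classes of the letters form an eigenbasis.
\<close>

lemma nichols_deg1_props:
  assumes E: "ESC E"
  shows nichols_deg1_eigenbasis:
      "yd_eigenbasis (egrp E) (nichols_deg1 E) (eidx E) (nichols_gen E) (eelt E) (echr E)"
    and yspace_nichols_deg1: "yspace (nichols_deg1 E) = pm.span (nichols_gen E ` eidx E)"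
    and nichols_deg1_subset: "yspace (nichols_deg1 E) \<subseteq> bspace (nichols (gralg E) (yd_V E))"
proof -
  interpret G: group "egrp E" by (rule ESC_group[OF E])
  interpret braided_space "gralg E" "TV E" by (rule braided_space_TV[OF E])
  let ?W = "{w. length w = 1 \<and> set w \<subseteq> eidx E}"
  have B: "nichols (gralg E) (yd_V E) = B"
    by (rule nichols_eq_quot[OF braided_space_axioms refl])
  have W: "?W = (\<lambda>i. [i]) ` eidx E"
    by (auto simp: length_Suc_conv)
  have deg1: "bdeg (TV E) 1 = pm.span ((\<lambda>i. bvec [i]) ` eidx E)"
    unfolding TV_simps W by (simp add: coord_space_eq_span image_image)
  have gen: "nichols_gen E i = p (bvec [i])" for i by (simp add: nichols_gen_def)
  have inj: "inj_on p (bdeg (TV E) 1)"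
  proof (rule inj_onI)
    fix x y assume xy: "x \<in> bdeg (TV E) 1" "y \<in> bdeg (TV E) 1" "p x = p y"
    then have d: "x - y \<in> coord_space ?W"
      unfolding TV_simps by (intro pm.subspace_diff subspace_coord_space) auto
    have "x - y \<in> bspace (TV E)"
      using xy deg_subset by (intro pm.subspace_diff subspace_T) auto
    moreover have "p (x - y) = 0" using xy(3) by (simp add: lin_diff[OF lin_p])
    ultimately have "x - y \<in> N" by (rule in_N_if_p_0)
    then have "x - y \<in> coord_space {w. 2 \<le> length w}"
      using nichols_ideal_degree[OF E] by (auto simp: N_def)
    then have "Poly_Mapping.keys (x - y) \<subseteq> ?W \<inter> {w. 2 \<le> length w}"
      using d by (auto simp: coord_space_def)
    also have "\<dots> = {}" by auto
    finally show "x = y" by simp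
  qed
  show span: "yspace (nichols_deg1 E) = pm.span (nichols_gen E ` eidx E)"
    unfolding nichols_deg1_def B Let_def yd_mod.simps B_simps deg1 lin_span_image[OF lin_p]
    by (simp add: image_image gen)
  show "yspace (nichols_deg1 E) \<subseteq> bspace (nichols (gralg E) (yd_V E))"
    unfolding B nichols_deg1_def Let_def yd_mod.simps B_simps using deg_subset by (rule image_mono)
  have X: "yact (nichols_deg1 E) = hact B" "ycoact (nichols_deg1 E) = hcoact B"
    by (simp_all add: nichols_deg1_def B Let_def)
  have word: "bvec [i] \<in> bdeg (TV E) 1" if "i \<in> eidx E" for i
    using that unfolding deg1 by (intro pm.span_base) auto
  have wordT: "bvec [i] \<in> bspace (TV E)" if "i \<in> eidx E" for i
    using word[OF that] deg_subset by blast
  have "inj_on (nichols_gen E) (eidx E)"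
    unfolding gen[abs_def] by (rule inj_onI, drule inj_onD[OF inj]) (use word in auto)
  moreover have "pm.independent (nichols_gen E ` eidx E)"
  proof -
    have "pm.independent ((\<lambda>i. bvec [i] :: ('b list, 'c) vec) ` eidx E)"
      using independent_bvec[of "(\<lambda>i. [i]) ` eidx E"] by (simp add: image_image)
    then have "pm.independent (p ` (\<lambda>i. bvec [i]) ` eidx E)"
      using inj unfolding deg1 by (intro pp.linear_independent_injective_image[OF lin_p])
    then show ?thesis by (simp add: image_image gen)
  qed
  moreover have "hact B (bvec g) (nichols_gen E i) = vscale (echr E i g) (nichols_gen E i)"
    if "i \<in> eidx E" "g \<in> carrier (egrp E)" for i g
    using p_act[of "bvec g" "bvec [i]"] that wordT
    by (simp add: gen TV_simps wchr_def lin_scale[OF lin_p])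
  moreover have "hcoact B (nichols_gen E i) = tensor (bvec (eelt E i)) (nichols_gen E i)" if "i \<in> eidx E" for i
    using p_coact[of "bvec [i]"] that wordT ESC_elt[OF E that]
    by (simp add: gen TV_simps wdeg_def)
  moreover have "nichols_gen E i \<in> yspace (nichols_deg1 E)" if "i \<in> eidx E" for i
    unfolding span using that by (intro pm.span_base) auto
  moreover have "hact B = (\<lambda>h x. p (hact (TV E) h x))" "hcoact B = (\<lambda>x. tensor_map id p (hcoact (TV E) x))"
    by (intro ext; simp)+
  then have "bilin (hact B)" "lin (hcoact B)"
    by (simp_all only: lin_compose_bilin[OF lin_p bilin_act] lin_compose[OF lin_tensor_map lin_coact])
  ultimately show "yd_eigenbasis (egrp E) (nichols_deg1 E) (eidx E) (nichols_gen E) (eelt E) (echr E)"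
    unfolding yd_eigenbasis_def using ESC_elt[OF E] by (simp add: span X)
qed

lemma ESC_isomorphic_iff_nichols:
  fixes E :: "('g, 'i, 'k::field) esc" and E' :: "('h, 'j, 'k) esc"
  assumes E: "ESC E" and E': "ESC E'"
  defines "kG \<equiv> gralg E :: ('g, 'k) bialg"
    and "kG' \<equiv> gralg E' :: ('h, 'k) bialg"
  shows "ESC_isomorphic E E' \<longleftrightarrow>
    (\<exists>\<phi>. hopf_iso kG kG' \<phi> \<and>
      braided_isomorphic kG (nichols kG (yd_V E)) (braided_twist kG \<phi> (nichols kG' (yd_V E'))))"
proof
  assume "ESC_isomorphic E E'"
  then obtain \<psi> \<sigma> where iso: "esc_iso E E' \<psi> \<sigma>"
    unfolding ESC_isomorphic_iff_esc_iso by blast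
  then have \<psi>: "\<psi> \<in> iso (egrp E) (egrp E')" and \<sigma>: "bij_betw \<sigma> (eidx E) (eidx E')"
    by (auto simp: esc_iso_def)
  interpret group_algebra_iso "egrp E" "egrp E'" "basis_map \<psi>" \<psi>
    using group_algebra_iso_basis_map[OF ESC_group[OF E] ESC_group[OF E'] \<psi>] .
  interpret T: braided_space "gralg E" "TV E" by (rule braided_space_TV[OF E])
  interpret T': braided_space "gralg E'" "TV E'" by (rule braided_space_TV[OF E'])
  have B: "nichols kG (yd_V E) = T.B" and B': "nichols kG' (yd_V E') = T'.B"
    unfolding kG_def kG'_def
    by (rule nichols_eq_quot[OF T.braided_space_axioms refl] nichols_eq_quot[OF T'.braided_space_axioms refl])+
  have inverse: "basis_map (map \<sigma>) (basis_map (map (inv_into (eidx E) \<sigma>)) y) = y"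
    if "y \<in> bspace (TV E')" for y
  proof (rule basis_map_inverse)
    show "y \<in> coord_space {w. set w \<subseteq> eidx E'}" using that by (simp add: bspace_TV)
    show "map \<sigma> (map (inv_into (eidx E) \<sigma>) w) = w" if "w \<in> {w. set w \<subseteq> eidx E'}" for w
      using that bij_betw_inv_into_right[OF \<sigma>] by (auto intro!: map_idI)
  qed
  obtain f where f: "braided_iso_over kG kG' (nichols kG (yd_V E)) (nichols kG' (yd_V E')) (basis_map \<psi>) f"
    using braided_quot_iso[OF T.braided_space_axioms T'.braided_space_axioms TV_iso[OF E E' iso]
        TV_iso[OF E' E esc_iso_inverse[OF E E' iso]] inverse]
    unfolding kG_def kG'_def nichols_def by blast
  have "braided_isomorphic kG (nichols kG (yd_V E))
      (braided_twist kG (basis_map \<psi>) (nichols kG' (yd_V E')))"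
  proof (rule braided_isomorphic_twist[OF _ _ _ _ f])
    show "hcoact (nichols kG (yd_V E)) x \<in> tensor_space (bspace kG) (bspace (nichols kG (yd_V E)))"
      if "x \<in> bspace (nichols kG (yd_V E))" for x
    proof -
      have "x \<in> bspace (TV E)" using that T.p_closed by (auto simp: B)
      then show ?thesis
        unfolding B T.B_simps unfolding kG_def
        by (intro tensor_map_in_tensor_space[OF lin_id T.lin_p _ _ T.coact_closed]) auto
    qed
    show "bij_betw (basis_map \<psi>) (bspace kG) (bspace kG')"
      using bij_phi by (simp add: kG_def kG'_def)
    show "bspace kG = coord_space (carrier (egrp E))" by (simp add: kG_def)
  qed (simp add: phi_bvec)
  then show "\<exists>\<phi>. hopf_iso kG kG' \<phi> \<and>
      braided_isomorphic kG (nichols kG (yd_V E)) (braided_twist kG \<phi> (nichols kG' (yd_V E')))"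
    using hopf unfolding kG_def kG'_def by blast
next
  assume "\<exists>\<phi>. hopf_iso kG kG' \<phi> \<and>
      braided_isomorphic kG (nichols kG (yd_V E)) (braided_twist kG \<phi> (nichols kG' (yd_V E')))"
  then obtain \<phi> f where \<phi>: "hopf_iso kG kG' \<phi>"
    and gr: "graded_hopf_iso (nichols kG (yd_V E)) (braided_twist kG \<phi> (nichols kG' (yd_V E'))) f"
    and yd: "yd_iso kG (yd_of (nichols kG (yd_V E))) (yd_of (braided_twist kG \<phi> (nichols kG' (yd_V E')))) f"
    unfolding braided_isomorphic_def by blast
  have deg1: "f ` yspace (nichols_deg1 E) = yspace (nichols_deg1 E')"
    using gr by (simp add: graded_hopf_iso_def braided_twist_def nichols_deg1_def kG_def kG'_def Let_def)
  have sub: "yspace (nichols_deg1 E) \<subseteq> bspace (nichols kG (yd_V E))"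
    using nichols_deg1_subset[OF E] by (simp add: kG_def)
  have "yd_iso kG (nichols_deg1 E) (yd_twist kG \<phi> (nichols_deg1 E')) f"
    unfolding yd_iso_def
  proof (intro conjI ballI)
    show "lin f" using yd by (simp add: yd_iso_def)
    have "inj_on f (yspace (nichols_deg1 E))"
      using yd sub by (auto simp: yd_iso_def yd_of_def bij_betw_def intro: inj_on_subset)
    then show "bij_betw f (yspace (nichols_deg1 E)) (yspace (yd_twist kG \<phi> (nichols_deg1 E')))"
      using deg1 by (simp add: bij_betw_def yd_twist_def)
    fix x assume "x \<in> yspace (nichols_deg1 E)"
    then have x: "x \<in> yspace (yd_of (nichols kG (yd_V E)))" using sub by (auto simp: yd_of_def)
    show "ycoact (yd_twist kG \<phi> (nichols_deg1 E')) (f x) = tensor_map id f (ycoact (nichols_deg1 E) x)"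
      using yd x unfolding yd_iso_def
      by (simp add: yd_of_def braided_twist_def yd_twist_def nichols_deg1_def Let_def kG_def kG'_def)
    fix h assume "h \<in> bspace kG"
    then show "f (yact (nichols_deg1 E) h x) = yact (yd_twist kG \<phi> (nichols_deg1 E')) h (f x)"
      using yd x unfolding yd_iso_def
      by (simp add: yd_of_def braided_twist_def yd_twist_def nichols_deg1_def Let_def kG_def kG'_def)
  qed
  then show "ESC_isomorphic E E'"
    unfolding ESC_isomorphic_iff_yd_isomorphic[OF E E' nichols_deg1_eigenbasis[OF E]
        yspace_nichols_deg1[OF E] nichols_deg1_eigenbasis[OF E'] yspace_nichols_deg1[OF E'] refl]
      yd_isomorphic_def
    using \<phi> unfolding kG_def kG'_def by blast
qed

section \<open>The product of paths\<close>

type_synonym ('g, 'i) path = "('g, 'i) arrow list \<times> 'g"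

text \<open>
  Left and right translation of arrows; the right action of the arrow bimodule carries in addition the
  scalar given by the character of the label.
\<close>

definition ltr :: "('g, 'i, 'k::field) esc \<Rightarrow> 'g \<Rightarrow> ('g, 'i) arrow \<Rightarrow> ('g, 'i) arrow" where
  "ltr E h a = Arrow (h \<otimes>\<^bsub>egrp E\<^esub> atarget a) (alabel a) (h \<otimes>\<^bsub>egrp E\<^esub> asource a)"

definition rtr :: "('g, 'i, 'k::field) esc \<Rightarrow> ('g, 'i) arrow \<Rightarrow> 'g \<Rightarrow> ('g, 'i) arrow" where
  "rtr E a h = Arrow (atarget a \<otimes>\<^bsub>egrp E\<^esub> h) (alabel a) (asource a \<otimes>\<^bsub>egrp E\<^esub> h)"

lemma translate_simps [simp]:
  "atarget (ltr E h a) = h \<otimes>\<^bsub>egrp E\<^esub> atarget a" "asource (ltr E h a) = h \<otimes>\<^bsub>egrp E\<^esub> asource a"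
  "alabel (ltr E h a) = alabel a" "alabel (rtr E a h) = alabel a"
  "atarget (rtr E a h) = atarget a \<otimes>\<^bsub>egrp E\<^esub> h" "asource (rtr E a h) = asource a \<otimes>\<^bsub>egrp E\<^esub> h"
  by (simp_all add: ltr_def rtr_def)

definition pcons :: "('g, 'i) arrow \<Rightarrow> (('g, 'i) path, 'k::field) vec \<Rightarrow> (('g, 'i) path, 'k) vec" where
  "pcons a = basis_map (\<lambda>(w, x). (a # w, x))"

lemma lin_pcons [simp]: "lin (pcons a)"
  by (simp add: pcons_def)

lemma pcons_bvec [simp]: "pcons a (bvec (w, x)) = bvec (a # w, x)"
  by (simp add: pcons_def)

text \<open>
  The product of paths as a shuffle product. A path is a list of composable arrows, read from its end to
  its start, together with its starting vertex, so that vertices are paths of length 0. A product path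
  begins with an arrow of one factor, translated by the end vertex of the other one, and continues with
  the product of what is left.
\<close>

fun path_mult ::
  "('g, 'i, 'k::field) esc \<Rightarrow> ('g, 'i) path \<Rightarrow> ('g, 'i) path \<Rightarrow> (('g, 'i) path, 'k) vec" where
  "path_mult E ([], x) ([], y) = bvec ([], x \<otimes>\<^bsub>egrp E\<^esub> y)"
| "path_mult E ([], x) (b # v, y) = pcons (ltr E x b) (path_mult E ([], x) (v, y))"
| "path_mult E (a # u, x) ([], y) =
     vscale (echr E (alabel a) y) (pcons (rtr E a y) (path_mult E (u, x) ([], y)))"
| "path_mult E (a # u, x) (b # v, y) =
     vscale (echr E (alabel a) (atarget b))
       (pcons (rtr E a (atarget b)) (path_mult E (u, x) (b # v, y))) +
     pcons (ltr E (atarget a) b) (path_mult E (a # u, x) (v, y))"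

text \<open>
  Deconcatenation. The starting vertex of the first part is the end vertex of the second part.
\<close>

fun path_comult :: "('g, 'i) path \<Rightarrow> (('g, 'i) path \<times> ('g, 'i) path, 'k::field) vec" where
  "path_comult ([], x) = bvec (([], x), ([], x))"
| "path_comult (a # w, x) =
     bvec (([], atarget a), (a # w, x)) + tensor_map (pcons a) id (path_comult (w, x))"

definition pmult ::
  "('g, 'i, 'k::field) esc \<Rightarrow> (('g, 'i) path, 'k) vec \<Rightarrow> (('g, 'i) path, 'k) vec \<Rightarrow> (('g, 'i) path, 'k) vec"
  where "pmult E = bilin_ext (path_mult E)"

definition pcomult ::
  "(('g, 'i) path, 'k::field) vec \<Rightarrow> (('g, 'i) path \<times> ('g, 'i) path, 'k) vec" where
  "pcomult = lin_ext path_comult"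

lemma pmult_bvec [simp]: "pmult E (bvec P) (bvec Q) = path_mult E P Q"
  by (simp add: pmult_def)

lemma bilin_pmult [simp]: "bilin (pmult E)"
  by (simp add: pmult_def)

lemma pcomult_bvec [simp]: "pcomult (bvec P) = path_comult P"
  by (simp add: pcomult_def)

lemma lin_pcomult [simp]: "lin pcomult"
  by (simp add: pcomult_def)

lemma pcomult_pcons:
  "pcomult (pcons a z) = tensor (bvec ([], atarget a)) (pcons a z) + tensor_map (pcons a) id (pcomult z)"
proof (rule lin_eqI[OF lin_compose[OF lin_pcomult lin_pcons]])
  show "lin (\<lambda>z. tensor (bvec ([], atarget a)) (pcons a z) + tensor_map (pcons a) id (pcomult z))"
    by (intro lin_plus lin_compose[OF bilin_right[OF bilin_tensor]] lin_compose[OF lin_tensor_map]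
        lin_pcons lin_pcomult)
qed (auto simp: id_def)

abbreviation (input) pconsl where "pconsl a \<equiv> tensor_map (pcons a) id"

text \<open>
  The next three lemmas are the recursion of \<open>path_mult\<close>, transported to the first tensor factor of the
  componentwise product on pairs of paths.
\<close>

lemma vertex_times_pcons:
  "tensor_mult (pmult E) (bvec (([], g), P)) (pconsl b z) =
    pconsl (ltr E g b) (tensor_mult (pmult E) (bvec (([], g), P)) z)"
proof (rule lin_eqI[of "\<lambda>z. tensor_mult (pmult E) (bvec (([], g), P)) (pconsl b z)"
      "\<lambda>z. pconsl (ltr E g b) (tensor_mult (pmult E) (bvec (([], g), P)) z)"])
  show "lin (\<lambda>z. tensor_mult (pmult E) (bvec (([], g), P)) (pconsl b z))"
    by (intro lin_compose[OF bilin_right[OF bilin_tensor_mult] lin_tensor_map])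
  show "lin (\<lambda>z. pconsl (ltr E g b) (tensor_mult (pmult E) (bvec (([], g), P)) z))"
    by (intro lin_compose[OF lin_tensor_map bilin_right[OF bilin_tensor_mult]])
qed (auto simp: tensor_map_left_tensor)

lemma pcons_times_vertex:
  "tensor_mult (pmult E) (pconsl a z) (bvec (([], h), P)) =
    vscale (echr E (alabel a) h) (pconsl (rtr E a h) (tensor_mult (pmult E) z (bvec (([], h), P))))"
proof (rule lin_eqI[of "\<lambda>z. tensor_mult (pmult E) (pconsl a z) (bvec (([], h), P))"
      "\<lambda>z. vscale (echr E (alabel a) h) (pconsl (rtr E a h) (tensor_mult (pmult E) z (bvec (([], h), P))))"])
  show "lin (\<lambda>z. tensor_mult (pmult E) (pconsl a z) (bvec (([], h), P)))"
    by (intro lin_compose[OF bilin_left[OF bilin_tensor_mult] lin_tensor_map])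
  show "lin (\<lambda>z. vscale (echr E (alabel a) h)
      (pconsl (rtr E a h) (tensor_mult (pmult E) z (bvec (([], h), P)))))"
    by (intro lin_vscale lin_compose[OF lin_tensor_map bilin_left[OF bilin_tensor_mult]])
qed (auto simp: tensor_map_left_tensor tensor_scale_left)

lemma pcons_times_pcons:
  "tensor_mult (pmult E) (pconsl a z) (pconsl b z') =
    vscale (echr E (alabel a) (atarget b))
      (pconsl (rtr E a (atarget b)) (tensor_mult (pmult E) z (pconsl b z'))) +
    pconsl (ltr E (atarget a) b) (tensor_mult (pmult E) (pconsl a z) z')"
proof (rule bilin_eqI[of "\<lambda>z z'. tensor_mult (pmult E) (pconsl a z) (pconsl b z')"
      "\<lambda>z z'. vscale (echr E (alabel a) (atarget b))
        (pconsl (rtr E a (atarget b)) (tensor_mult (pmult E) z (pconsl b z'))) +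
        pconsl (ltr E (atarget a) b) (tensor_mult (pmult E) (pconsl a z) z')"])
  show "bilin (\<lambda>z z'. tensor_mult (pmult E) (pconsl a z) (pconsl b z'))"
    by (intro bilin_compose[OF bilin_tensor_mult lin_tensor_map lin_tensor_map])
  show "bilin (\<lambda>z z'. vscale (echr E (alabel a) (atarget b))
      (pconsl (rtr E a (atarget b)) (tensor_mult (pmult E) z (pconsl b z'))) +
    pconsl (ltr E (atarget a) b) (tensor_mult (pmult E) (pconsl a z) z'))"
    by (intro bilin_plus lin_compose_bilin[OF lin_vscale[OF lin_tensor_map]]
        lin_compose_bilin[OF lin_tensor_map]
        bilin_compose[OF bilin_tensor_mult lin_ident lin_tensor_map]
        bilin_compose[OF bilin_tensor_mult lin_tensor_map lin_ident])
qed (auto simp: tensor_map_left_tensor tensor_scale_left tensor_add_left)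

text \<open>
  Split the comultiplication of a nonempty path \<open>a u\<close> as \<open>t(a) \<otimes> a u\<close> plus terms whose first part
  begins with \<open>a\<close>. In the product of two such sums, the terms whose first part is a vertex give the leading
  term of the comultiplication of the product, and the other terms are regrouped by the first arrow of
  the first part with the recursion of the product; the induction hypothesis applies to both groups.
\<close>

lemma path_comult_mult:
  "pcomult (path_mult E P Q) = tensor_mult (pmult E) (path_comult P) (path_comult Q)"
proof (induction E P Q rule: path_mult.induct)
  case (2 E x b v y)
  then show ?case
    by (simp add: pcomult_pcons lin_add[OF bilin_right[OF bilin_tensor_mult]] vertex_times_pcons)
next
  case (3 E a u x y)
  then show ?case
    by (simp add: pcomult_pcons lin_scale[OF lin_pcomult] lin_add[OF bilin_left[OF bilin_tensor_mult]]
        pcons_times_vertex pm.scale_right_distrib tensor_scale_right)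
next
  case (4 E a u x b v y)
  let ?m = "tensor_mult (pmult E)"
  \<comment> \<open>\<open>?Va + ?A\<close> and \<open>?Vb + ?B\<close> are the two comultiplications, split by whether the first part is
    a vertex; \<open>?r\<close> and \<open>?l\<close> prepend the first arrow of the left or the right factor\<close>
  let ?Va = "bvec (([], atarget a), (a # u, x))" and ?Vb = "bvec (([], atarget b), (b # v, y))"
  let ?A = "pconsl a (path_comult (u, x))" and ?B = "pconsl b (path_comult (v, y))"
  let ?r = "\<lambda>z. vscale (echr E (alabel a) (atarget b)) (pconsl (rtr E a (atarget b)) z)"
  let ?l = "pconsl (ltr E (atarget a) b)"
  have addl: "?m (x + y) z = ?m x z + ?m y z" for x y z by (rule lin_add[OF bilin_left[OF bilin_tensor_mult]])
  have addr: "?m z (x + y) = ?m z x + ?m z y" for x y z by (rule lin_add[OF bilin_right[OF bilin_tensor_mult]])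
  have radd: "?r (x + y) = ?r x + ?r y" for x y
    by (simp add: lin_add[OF lin_tensor_map] pm.scale_right_distrib)
  have ladd: "?l (x + y) = ?l x + ?l y" for x y by (rule lin_add[OF lin_tensor_map])
  have "pcomult (path_mult E (a # u, x) (b # v, y)) =
      tensor (bvec ([], atarget a \<otimes>\<^bsub>egrp E\<^esub> atarget b)) (path_mult E (a # u, x) (b # v, y)) +
      ?r (pcomult (path_mult E (u, x) (b # v, y))) + ?l (pcomult (path_mult E (a # u, x) (v, y)))"
    by (simp add: lin_add[OF lin_pcomult] lin_scale[OF lin_pcomult] pcomult_pcons pm.scale_right_distrib
        tensor_add_right tensor_scale_right)
  also have "\<dots> = ?m ?Va ?Vb + ?r (?m (path_comult (u, x)) (?Vb + ?B)) + ?l (?m (?Va + ?A) (path_comult (v, y)))"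
    using 4 by simp
  also have "\<dots> = ?m ?Va ?Vb + (?m ?A ?Vb + ?r (?m (path_comult (u, x)) ?B)) +
      (?m ?Va ?B + ?l (?m ?A (path_comult (v, y))))"
    by (simp only: addl addr radd ladd vertex_times_pcons pcons_times_vertex)
  also have "\<dots> = ?m (?Va + ?A) (?Vb + ?B)"
    by (simp only: addl addr pcons_times_pcons[of E a "path_comult (u, x)"] add.assoc add.left_commute add.commute)
  finally show ?case by simp
qed simp

subsection \<open>Paths in the quiver of an element system\<close>

fun path_target :: "('g, 'i) path \<Rightarrow> 'g" where
  "path_target ([], x) = x"
| "path_target (a # w, x) = atarget a"

fun is_path :: "('g, 'i, 'k::field) esc \<Rightarrow> ('g, 'i) path \<Rightarrow> bool" where
  "is_path E ([], x) \<longleftrightarrow> x \<in> carrier (egrp E)"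
| "is_path E (a # w, x) \<longleftrightarrow> a \<in> esc_arrows E \<and> asource a = path_target (w, x) \<and> is_path E (w, x)"

lemma esc_arrows_iff:
  "a \<in> esc_arrows E \<longleftrightarrow> alabel a \<in> eidx E \<and> asource a \<in> carrier (egrp E) \<and>
    atarget a = eelt E (alabel a) \<otimes>\<^bsub>egrp E\<^esub> asource a"
  by (cases a) (auto simp: esc_arrows_def)

lemma arrow_target_closed:
  assumes "ESC E" "a \<in> esc_arrows E"
  shows "atarget a \<in> carrier (egrp E)"
proof -
  interpret group "egrp E" by (rule ESC_group) fact
  show ?thesis using assms by (simp add: esc_arrows_iff ESC_elt)
qed

lemma translate_arrow:
  assumes E: "ESC E" and a: "a \<in> esc_arrows E" and h: "h \<in> carrier (egrp E)"
  shows "ltr E h a \<in> esc_arrows E" "rtr E a h \<in> esc_arrows E"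
proof -
  interpret group "egrp E" by (rule ESC_group[OF E])
  have i: "alabel a \<in> eidx E" and s: "asource a \<in> carrier (egrp E)"
    using a by (auto simp: esc_arrows_iff)
  have "h \<otimes>\<^bsub>egrp E\<^esub> (eelt E (alabel a) \<otimes>\<^bsub>egrp E\<^esub> asource a) =
      eelt E (alabel a) \<otimes>\<^bsub>egrp E\<^esub> (h \<otimes>\<^bsub>egrp E\<^esub> asource a)"
    using ESC_elt[OF E i] s h by (simp add: ESC_central[OF E i h] flip: m_assoc)
  then show "ltr E h a \<in> esc_arrows E"
    using a h by (simp add: esc_arrows_iff)
  show "rtr E a h \<in> esc_arrows E"
    using a h ESC_elt[OF E i] by (simp add: esc_arrows_iff m_assoc)
qed

text \<open>
  The paths that can occur in the product of \<open>P\<close> and \<open>Q\<close>. The condition on the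
  target is what makes the induction go through: it says where a further arrow can be attached.
\<close>

definition paths_over :: "('g, 'i, 'k::field) esc \<Rightarrow> ('g, 'i) path \<Rightarrow> ('g, 'i) path \<Rightarrow> ('g, 'i) path set" where
  "paths_over E P Q = {R. is_path E R \<and> path_target R = path_target P \<otimes>\<^bsub>egrp E\<^esub> path_target Q \<and>
     length (fst R) = length (fst P) + length (fst Q)}"

lemma pcons_paths_over:
  assumes "z \<in> coord_space (paths_over E P Q)" "a \<in> esc_arrows E"
    "asource a = path_target P \<otimes>\<^bsub>egrp E\<^esub> path_target Q"
    "atarget a = path_target P' \<otimes>\<^bsub>egrp E\<^esub> path_target Q'"
    "length (fst P') + length (fst Q') = Suc (length (fst P) + length (fst Q))"
  shows "pcons a z \<in> coord_space (paths_over E P' Q')"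
  using assms(1) unfolding pcons_def
proof (rule basis_map_in_coord_space)
  fix R assume "R \<in> paths_over E P Q"
  then show "(case R of (w, x) \<Rightarrow> (a # w, x)) \<in> paths_over E P' Q'"
    using assms(2-5) by (cases R) (auto simp: paths_over_def)
qed

lemma path_mult_closed:
  assumes E: "ESC E"
  shows "is_path E P \<Longrightarrow> is_path E Q \<Longrightarrow> path_mult E P Q \<in> coord_space (paths_over E P Q)"
  using E
proof (induction E P Q rule: path_mult.induct)
  case (1 E x y)
  interpret group "egrp E" by (rule ESC_group) fact
  show ?case using 1 by (simp add: paths_over_def)
next
  case (2 E x b v y)
  then show ?case
    by (auto intro!: pcons_paths_over[of _ E "([], x)" "(v, y)"] translate_arrow)
next
  case (3 E a u x y)
  then show ?case
    by (auto intro!: pm.subspace_scale subspace_coord_space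
        pcons_paths_over[of _ E "(u, x)" "([], y)"] translate_arrow)
next
  case (4 E a u x b v y)
  then have "pcons (rtr E a (atarget b)) (path_mult E (u, x) (b # v, y)) \<in>
      coord_space (paths_over E (a # u, x) (b # v, y))"
    by (auto intro!: pcons_paths_over[of _ E "(u, x)" "(b # v, y)"] translate_arrow
        simp: arrow_target_closed)
  moreover have "pcons (ltr E (atarget a) b) (path_mult E (a # u, x) (v, y)) \<in>
      coord_space (paths_over E (a # u, x) (b # v, y))"
    using 4 by (auto intro!: pcons_paths_over[of _ E "(a # u, x)" "(v, y)"] translate_arrow
        simp: arrow_target_closed)
  ultimately show ?case
    by (auto intro!: pm.subspace_add pm.subspace_scale subspace_coord_space)
qed

text \<open>
  The first part of a decomposition has the same end vertex as the whole path; this is needed to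
  prepend a further arrow to it.
\<close>

lemma path_comult_closed:
  fixes E :: "('g, 'i, 'k::field) esc"
  assumes E: "ESC E"
  shows "is_path E P \<Longrightarrow> (path_comult P :: (('g, 'i) path \<times> ('g, 'i) path, 'k) vec) \<in>
     coord_space ({R. is_path E R \<and> path_target R = path_target P} \<times> Collect (is_path E))"
proof (induction P rule: path_comult.induct)
  case (2 a w x)
  let ?S = "\<lambda>P. {R. is_path E R \<and> path_target R = path_target P} \<times> Collect (is_path E)"
  have "tensor_map (pcons a) id (path_comult (w, x) :: (('g, 'i) path \<times> ('g, 'i) path, 'k) vec) \<in> coord_space (?S (a # w, x))"
  proof (rule lin_in_coord[OF lin_tensor_map _ subspace_coord_space])
    show "(path_comult (w, x) :: (('g, 'i) path \<times> ('g, 'i) path, 'k) vec) \<in> coord_space (?S (w, x))" using 2 by simp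
    show "tensor_map (pcons a) id (bvec PQ :: (('g, 'i) path \<times> ('g, 'i) path, 'k) vec) \<in> coord_space (?S (a # w, x))" if "PQ \<in> ?S (w, x)" for PQ
      using that 2(2) by auto
  qed
  moreover have "(bvec (([], atarget a), (a # w, x)) :: (('g, 'i) path \<times> ('g, 'i) path, 'k) vec) \<in> coord_space (?S (a # w, x))"
    using 2(2) arrow_target_closed[OF E] by simp
  ultimately show ?case
    by (simp add: pm.subspace_add[OF subspace_coord_space])
qed simp

section \<open>The cotensor coalgebra of the arrow bimodule\<close>

text \<open>
  The translation between paths and the basis elements of the cotensor coalgebra, where the starting
  vertex of a path of positive length is determined by its last arrow.
\<close>

definition path_word :: "('g, 'i) path \<Rightarrow> 'g + ('g, 'i) arrow list" where
  "path_word P = (if fst P = [] then Inl (snd P) else Inr (fst P))"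

definition word_path :: "'g + ('g, 'i) arrow list \<Rightarrow> ('g, 'i) path" where
  "word_path b = (case b of Inl g \<Rightarrow> ([], g) | Inr w \<Rightarrow> (w, asource (last w)))"

definition cot_words :: "('g, 'i, 'k::field) esc \<Rightarrow> ('g + ('g, 'i) arrow list) set" where
  "cot_words E = path_word ` Collect (is_path E)"

lemma is_path_source: "is_path E (w, x) \<Longrightarrow> w \<noteq> [] \<Longrightarrow> asource (last w) = x"
proof (induction w)
  case (Cons a w)
  then show ?case by (cases w) auto
qed simp

lemma word_path_word: "is_path E P \<Longrightarrow> word_path (path_word P) = P"
  using is_path_source by (cases P) (auto simp: path_word_def word_path_def)

lemma is_path_iff:
  assumes "w \<noteq> []"
  shows "is_path E (w, x) \<longleftrightarrow> set w \<subseteq> esc_arrows E \<and> asource (last w) = x \<and>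
    (\<forall>p. 0 < p \<and> p < length w \<longrightarrow> asource (w ! (p - 1)) = atarget (w ! p))"
  using assms
proof (induction w)
  case (Cons a w)
  show ?case
  proof (cases w)
    case Nil
    then show ?thesis by (auto simp: esc_arrows_iff)
  next
    case (Cons b v)
    have "(\<forall>p. 0 < p \<and> p < length (a # w) \<longrightarrow> asource ((a # w) ! (p - 1)) = atarget ((a # w) ! p)) \<longleftrightarrow>
      asource a = atarget b \<and> (\<forall>p. 0 < p \<and> p < length w \<longrightarrow> asource (w ! (p - 1)) = atarget (w ! p))"
      (is "?l \<longleftrightarrow> ?r")
    proof
      assume l: ?l
      have "asource a = atarget b" using l[rule_format, of 1] Cons by simp
      moreover have "asource (w ! (p - 1)) = atarget (w ! p)" if "0 < p" "p < length w" for p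
        using l[rule_format, of "Suc p"] that by (simp add: nth_Cons')
      ultimately show ?r by blast
    next
      assume r: ?r
      show ?l
      proof (intro allI impI)
        fix p assume p: "0 < p \<and> p < length (a # w)"
        then obtain q where q: "p = Suc q" by (cases p) auto
        show "asource ((a # w) ! (p - 1)) = atarget ((a # w) ! p)"
          using r p Cons unfolding q by (cases q) auto
      qed
    qed
    then show ?thesis
      using Cons.IH Cons by auto
  qed
qed simp

lemma arrow_bimod_simps [simp]:
  "mspace (arrow_bimod E) = coord_space (esc_arrows E)"
  "lact (arrow_bimod E) (bvec h) (bvec a) = bvec (ltr E h a)"
  "ract (arrow_bimod E) (bvec a) (bvec h) = vscale (echr E (alabel a) h) (bvec (rtr E a h))"
  "lcoact (arrow_bimod E) (bvec a) = bvec (atarget a, a)"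
  "rcoact (arrow_bimod E) (bvec a) = bvec (a, asource a)"
  "bilin (lact (arrow_bimod E))" "bilin (ract (arrow_bimod E))"
  by (simp_all add: arrow_bimod_def ltr_def rtr_def)

text \<open>
  On a word, the two maps of the equalizer keep the word and insert, at the cut, the source of an arrow
  and the target of the next one respectively. Both are injective on words, so a vector is equalized iff every word
  in its support is composable.
\<close>

lemma equalizer_coord_space:
  fixes E :: "('g, 'i, 'k::field) esc"
  defines "W \<equiv> \<lambda>n. {w. length w = n \<and> set w \<subseteq> esc_arrows E}"
  shows "{t \<in> coord_space (W n). \<forall>p. 0 < p \<and> p < n \<longrightarrow>
      cot_right (arrow_bimod E) p t = cot_left (arrow_bimod E) p t} =
    coord_space {w \<in> W n. \<forall>p. 0 < p \<and> p < n \<longrightarrow> asource (w ! (p - 1)) = atarget (w ! p)}"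
    (is "?L = coord_space ?C")
proof -
  let ?r = "\<lambda>p (w :: ('g, 'i) arrow list). (take (p - 1) w @ [w ! (p - 1)], asource (w ! (p - 1)), drop p w)"
  let ?l = "\<lambda>p (w :: ('g, 'i) arrow list). (take p w, atarget (w ! p), w ! p # drop (Suc p) w)"
  have right: "cot_right (arrow_bimod E) p = basis_map (?r p)" for p
    by (simp add: cot_right_def basis_map_def)
  have left: "cot_left (arrow_bimod E) p = basis_map (?l p)" for p
    by (simp add: cot_left_def basis_map_def)
  have r: "?r p w = (take p w, asource (w ! (p - 1)), drop p w)"
    if "0 < p" "p < length w" for p w
    using that take_Suc_conv_app_nth[of "p - 1" w] by simp
  have l: "?l p w = (take p w, atarget (w ! p), drop p w)"
    if "0 < p" "p < length w" for p w
    using that by (simp add: Cons_nth_drop_Suc)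
  have td: "v = w" if "take p v = take p w" "drop p v = drop p w"
    for p and v w :: "('g, 'i) arrow list"
    using that by (metis append_take_drop_id)
  show ?thesis
  proof (intro equalityI subsetI)
    fix t :: "(('g, 'i) arrow list, 'k) vec" assume t: "t \<in> ?L"
    then have tW: "t \<in> coord_space (W n)" by blast
    show "t \<in> coord_space ?C"
    proof (rule coord_spaceI)
      fix w assume w: "Poly_Mapping.lookup t w \<noteq> 0"
      then have wW: "w \<in> W n" using coord_spaceD[OF tW] by blast
      moreover have "asource (w ! (p - 1)) = atarget (w ! p)" if p: "0 < p" "p < n" for p
      proof (rule ccontr)
        assume ne: "asource (w ! (p - 1)) \<noteq> atarget (w ! p)"
        have "Poly_Mapping.lookup (basis_map (?r p) t) (?r p w) = Poly_Mapping.lookup t w"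
          unfolding basis_map_def
        proof (rule lookup_lin_ext_delta[OF tW])
          fix v assume v: "v \<in> W n"
          have rv: "?r p v = (take p v, asource (v ! (p - 1)), drop p v)"
            and rw: "?r p w = (take p w, asource (w ! (p - 1)), drop p w)"
            using r v wW p unfolding W_def by auto
          have "?r p v = ?r p w \<longleftrightarrow> v = w"
            unfolding rv rw using td[of p v w] by auto
          then show "Poly_Mapping.lookup (bvec (?r p v)) (?r p w) = (if v = w then 1 else 0)"
            by (simp add: lookup_bvec)
        qed
        moreover have "Poly_Mapping.lookup (basis_map (?l p) t) (?r p w) = 0"
          unfolding basis_map_def
        proof (rule lookup_lin_ext_zero[OF tW])
          fix v assume v: "v \<in> W n"
          have lv: "?l p v = (take p v, atarget (v ! p), drop p v)"
            and rw: "?r p w = (take p w, asource (w ! (p - 1)), drop p w)"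
            using l r v wW p unfolding W_def by auto
          have "?l p v \<noteq> ?r p w"
            unfolding lv rw using td[of p v w] ne by auto
          then show "Poly_Mapping.lookup (bvec (?l p v)) (?r p w) = 0"
            by (simp add: lookup_bvec)
        qed
        moreover have "basis_map (?r p) t = basis_map (?l p) t"
          using t p by (simp add: right left)
        ultimately show False using w by simp
      qed
      ultimately show "w \<in> ?C" by blast
    qed
  next
    fix t :: "(('g, 'i) arrow list, 'k) vec" assume t: "t \<in> coord_space ?C"
    have "t \<in> coord_space (W n)" using t coord_space_mono[of ?C "W n"] by blast
    moreover have "cot_right (arrow_bimod E) p t = cot_left (arrow_bimod E) p t" if p: "0 < p" "p < n" for p
      unfolding right left
    proof (rule lin_eq_on_coord[OF lin_basis_map lin_basis_map _ t])
      fix w assume "w \<in> ?C"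
      then have "?r p w = ?l p w" using p r[of p w] l[of p w] by (simp add: W_def)
      then show "basis_map (?r p) (bvec w) = basis_map (?l p) (bvec w)" by (simp only: basis_map_bvec)
    qed
    ultimately show "t \<in> ?L" by blast
  qed
qed

lemma cot_in_eq: "cot_in0 = basis_map Inl" "cot_in = basis_map Inr" "cot_in1 = basis_map (\<lambda>a. Inr [a])"
  by (simp_all add: cot_in0_def cot_in_def cot_in1_def basis_map_def)

lemma cot_deg_eq:
  "cot_deg (gralg E) (arrow_bimod E) n =
    coord_space (path_word ` {P. is_path E P \<and> length (fst P) = n})"
proof (cases "n = 0")
  case True
  have A: "{P. is_path E P \<and> length (fst P) = 0} = (\<lambda>g. ([], g)) ` carrier (egrp E)"
    by auto
  have "path_word ` {P. is_path E P \<and> length (fst P) = 0} = Inl ` carrier (egrp E)"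
    unfolding A image_image path_word_def by simp
  then show ?thesis
    using True by (simp add: cot_deg_def cot_in_eq basis_map_image_coord)
next
  case False
  let ?C = "{w \<in> {w. length w = n \<and> set w \<subseteq> esc_arrows E}.
    \<forall>p. 0 < p \<and> p < n \<longrightarrow> asource (w ! (p - 1)) = atarget (w ! p)}"
  have "Inr w \<in> path_word ` {P. is_path E P \<and> length (fst P) = n}" if "w \<in> ?C" for w
    using that False is_path_iff[of w E "asource (last w)"]
    by (intro image_eqI[of _ _ "(w, asource (last w))"]) (auto simp: path_word_def)
  moreover have "path_word P \<in> Inr ` ?C" if "is_path E P" "length (fst P) = n" for P
    using that False is_path_iff[of "fst P" E "snd P"] by (auto simp: path_word_def)
  ultimately have "path_word ` {P. is_path E P \<and> length (fst P) = n} = Inr ` ?C" by blast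
  then show ?thesis
    using False
    by (simp only: cot_in_eq cot_deg_def arrow_bimod_simps tpow_coord_space equalizer_coord_space
        basis_map_image_coord if_False)
qed

lemma cot_space_eq: "cot_space (gralg E) (arrow_bimod E) = coord_space (cot_words E)"
proof
  show "cot_space (gralg E) (arrow_bimod E) \<subseteq> coord_space (cot_words E)"
    unfolding cot_space_def cot_deg_eq cot_words_def
    by (intro pm.span_minimal[OF _ subspace_coord_space] UN_least coord_space_mono) auto
  have "bvec b \<in> cot_space (gralg E) (arrow_bimod E)" if b: "b \<in> cot_words E" for b
  proof -
    obtain P where "is_path E P" "b = path_word P" using b by (auto simp: cot_words_def)
    then have "bvec b \<in> cot_deg (gralg E) (arrow_bimod E) (length (fst P))"
      unfolding cot_deg_eq by simp
    then show ?thesis unfolding cot_space_def by (intro pm.span_base) blast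
  qed
  moreover have "pm.subspace (cot_space (gralg E) (arrow_bimod E))"
    by (simp add: cot_space_def)
  ultimately show "coord_space (cot_words E) \<subseteq> cot_space (gralg E) (arrow_bimod E)"
    unfolding coord_space_eq_span by (intro pm.span_minimal) auto
qed

text \<open>
  \<open>emb\<close> identifies the span of the paths with the cotensor coalgebra, and \<open>dec\<close> is its inverse there.
\<close>

definition emb :: "(('g, 'i) path, 'k::field) vec \<Rightarrow> ('g + ('g, 'i) arrow list, 'k) vec" where
  "emb = basis_map path_word"

definition dec :: "('g + ('g, 'i) arrow list, 'k::field) vec \<Rightarrow> (('g, 'i) path, 'k) vec" where
  "dec = basis_map word_path"

lemma lin_emb [simp]: "lin emb" and lin_dec [simp]: "lin dec"
  and emb_bvec [simp]: "emb (bvec P) = bvec (path_word P)"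
  and dec_bvec [simp]: "dec (bvec b) = bvec (word_path b)"
  by (simp_all add: emb_def dec_def)

text \<open>
  The closed form needed to compare with the comultiplication of the cotensor coalgebra, which
  separates the two summands that contain a vertex.
\<close>

lemma path_comult_sum:
  "path_comult (w, x) =
    (\<Sum>p\<le>length w. bvec ((take p w, path_target (drop p w, x)), (drop p w, x)))"
proof (induction w)
  case (Cons a w)
  then show ?case
    by (simp add: sum.atMost_Suc_shift lin_sum[OF lin_tensor_map] del: sum.atMost_Suc)
qed simp

lemma cot_comult_Inl: "cot_comult (gralg E) (arrow_bimod E) (bvec (Inl g)) = bvec (Inl g, Inl g)"
  by (simp add: cot_comult_def cot_in0_def)

lemma cot_comult_Inr:
  assumes "w \<noteq> []"
  shows "cot_comult (gralg E) (arrow_bimod E) (bvec (Inr w)) =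
    bvec (Inl (atarget (hd w)), Inr w) +
    (\<Sum>p\<in>{0<..<length w}. bvec (Inr (take p w), Inr (drop p w))) +
    bvec (Inr w, Inl (asource (last w)))"
  using assms by (simp add: cot_comult_def)

lemma lin_cot_comult [simp]: "lin (cot_comult H M)"
  by (simp add: cot_comult_def)

lemma cot_comult_emb:
  fixes E :: "('g, 'i, 'k::field) esc"
  assumes "z \<in> coord_space (Collect (is_path E))"
  shows "cot_comult (gralg E) (arrow_bimod E) (emb z) = tensor_map emb emb (pcomult z)"
proof (rule lin_eq_on_coord[OF lin_compose[OF lin_cot_comult lin_emb]
      lin_compose[OF lin_tensor_map lin_pcomult] _ assms])
  fix P assume "P \<in> Collect (is_path E)"
  then have P: "is_path E P" by simp
  obtain w x where wx: "P = (w, x)" by (cases P)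
  show "cot_comult (gralg E) (arrow_bimod E) (emb (bvec P)) = tensor_map emb emb (pcomult (bvec P))"
  proof (cases "w = []")
    case True
    then show ?thesis by (simp add: wx path_word_def cot_comult_Inl)
  next
    case False
    let ?f = "\<lambda>p. bvec (path_word (take p w, path_target (drop p w, x)), path_word (drop p w, x)) :: (_, 'k) vec"
    have hd: "path_target (w, x) = atarget (hd w)" using False by (cases w) auto
    have "{..length w} = insert 0 (insert (length w) {0<..<length w})" by auto
    then have "tensor_map emb emb (pcomult (bvec P)) =
        ?f 0 + (?f (length w) + (\<Sum>p\<in>{0<..<length w}. ?f p))"
      using False by (simp add: wx path_comult_sum lin_sum[OF lin_tensor_map] lin_add[OF lin_tensor_map])
    also have "(\<Sum>p\<in>{0<..<length w}. ?f p) = (\<Sum>p\<in>{0<..<length w}. bvec (Inr (take p w), Inr (drop p w)))"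
      by (intro sum.cong) (auto simp: path_word_def)
    finally show ?thesis
      using False is_path_source[OF P[unfolded wx]] hd
      by (simp add: wx path_word_def cot_comult_Inr add_ac)
  qed
qed

lemma cot_comult_closed:
  fixes E :: "('g, 'i, 'k::field) esc"
  assumes E: "ESC E" and b: "b \<in> cot_words E"
  shows "cot_comult (gralg E) (arrow_bimod E) (bvec b) \<in> coord_space (cot_words E \<times> cot_words E)"
proof -
  obtain P where P: "is_path E P" "b = path_word P" using b by (auto simp: cot_words_def)
  have "tensor_map emb emb (path_comult P :: (_, 'k) vec) \<in> coord_space (cot_words E \<times> cot_words E)"
    by (rule lin_in_coord[OF lin_tensor_map _ subspace_coord_space path_comult_closed[OF E P(1)]])
      (auto simp: cot_words_def)
  then show ?thesis
    using cot_comult_emb[of "bvec P" E] P by simp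
qed

subsection \<open>The multiplication of the cotensor coalgebra\<close>

definition cmul ::
  "('g, 'i, 'k::field) esc \<Rightarrow> ('g + ('g, 'i) arrow list, 'k) vec \<Rightarrow>
   ('g + ('g, 'i) arrow list, 'k) vec \<Rightarrow> ('g + ('g, 'i) arrow list, 'k) vec" where
  "cmul E x y = emb (pmult E (dec x) (dec y))"

lemma bilin_cmul: "bilin (cmul E)"
  unfolding cmul_def[abs_def]
  by (intro lin_compose_bilin[OF lin_emb] bilin_compose[OF bilin_pmult lin_dec lin_dec])

lemma cmul_path_word:
  "is_path E P \<Longrightarrow> is_path E Q \<Longrightarrow>
    cmul E (bvec (path_word P)) (bvec (path_word Q)) = emb (path_mult E P Q)"
  by (simp add: cmul_def word_path_word)

lemma cmul_closed:
  assumes E: "ESC E" and xy: "x \<in> coord_space (cot_words E)" "y \<in> coord_space (cot_words E)"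
  shows "cmul E x y \<in> coord_space (cot_words E)"
proof (rule bilin_in_coord[OF bilin_cmul _ subspace_coord_space xy])
  fix a b assume "a \<in> cot_words E" "b \<in> cot_words E"
  then obtain P Q where PQ: "is_path E P" "a = path_word P" "is_path E Q" "b = path_word Q"
    by (auto simp: cot_words_def)
  have "emb (path_mult E P Q) \<in> coord_space (cot_words E)"
    unfolding emb_def
    by (rule basis_map_in_coord_space[OF path_mult_closed[OF E PQ(1,3)]])
      (auto simp: cot_words_def paths_over_def)
  then show "cmul E (bvec a) (bvec b) \<in> coord_space (cot_words E)"
    using PQ by (simp add: cmul_path_word)
qed

lemma tensor_mult_emb:
  assumes "s \<in> coord_space (Collect (is_path E) \<times> Collect (is_path E))"
    and "t \<in> coord_space (Collect (is_path E) \<times> Collect (is_path E))"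
  shows "tensor_mult (cmul E) (tensor_map emb emb s) (tensor_map emb emb t) =
    tensor_map emb emb (tensor_mult (pmult E) s t)"
  by (rule bilin_eq_on_coord[OF bilin_compose[OF bilin_tensor_mult lin_tensor_map lin_tensor_map]
        lin_compose_bilin[OF lin_tensor_map bilin_tensor_mult] _ assms])
    (auto simp: cmul_path_word tensor_map_tensor)

lemma cmul_comult:
  fixes E :: "('g, 'i, 'k::field) esc"
  assumes E: "ESC E" and xy: "x \<in> coord_space (cot_words E)" "y \<in> coord_space (cot_words E)"
  defines "D \<equiv> cot_comult (gralg E) (arrow_bimod E)"
  shows "D (cmul E x y) = tensor_mult (cmul E) (D x) (D y)"
proof (rule bilin_eq_on_coord[OF lin_compose_bilin[OF _ bilin_cmul] bilin_compose[OF bilin_tensor_mult] _ xy])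
  fix a b assume "a \<in> cot_words E" "b \<in> cot_words E"
  then obtain P Q where PQ: "is_path E P" "a = path_word P" "is_path E Q" "b = path_word Q"
    by (auto simp: cot_words_def)
  have D: "D (bvec (path_word R)) = tensor_map emb emb (path_comult R)" if "is_path E R" for R
    using cot_comult_emb[of "bvec R" E] that by (simp add: D_def)
  have closed: "(path_comult R :: (_, 'k) vec) \<in> coord_space (Collect (is_path E) \<times> Collect (is_path E))"
    if "is_path E R" for R
    using path_comult_closed[OF E that] coord_space_mono[of "{S. is_path E S \<and> path_target S = path_target R} \<times> Collect (is_path E)"
        "Collect (is_path E) \<times> Collect (is_path E)"] by blast
  have "path_mult E P Q \<in> coord_space (Collect (is_path E))"
    using path_mult_closed[OF E PQ(1,3)] coord_space_mono[of "paths_over E P Q" "Collect (is_path E)"]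
    by (auto simp: paths_over_def)
  then have "D (cmul E (bvec a) (bvec b)) = tensor_map emb emb (pcomult (path_mult E P Q))"
    using PQ by (simp add: cmul_path_word D_def cot_comult_emb)
  also have "\<dots> = tensor_mult (cmul E) (D (bvec a)) (D (bvec b))"
    using PQ closed by (simp add: path_comult_mult tensor_mult_emb D)
  finally show "D (cmul E (bvec a) (bvec b)) = tensor_mult (cmul E) (D (bvec a)) (D (bvec b))" .
qed (simp_all add: D_def)

lemma lin_cot_pr0 [simp]: "lin cot_pr0" and lin_cot_pr1 [simp]: "lin cot_pr1"
  by (simp_all add: cot_pr0_def cot_pr1_def)

lemma cot_pr_bvec [simp]:
  "cot_pr0 (bvec (Inl g)) = bvec g" "cot_pr0 (bvec (Inr w)) = 0"
  "cot_pr1 (bvec (Inl g)) = 0" "cot_pr1 (bvec (Inr [a])) = bvec a"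
  "length w \<noteq> 1 \<Longrightarrow> cot_pr1 (bvec (Inr w)) = 0"
  by (auto simp: cot_pr0_def cot_pr1_def split: list.split)

text \<open>
  The length of paths is additive in products, so the components of degree 0 and 1 of a product vanish
  for all but a few lengths of the factors.
\<close>

lemma cot_pr_emb_long:
  assumes "z \<in> coord_space {P. length (fst P) = n}"
  shows "n \<noteq> 0 \<Longrightarrow> cot_pr0 (emb z) = 0" "n \<noteq> 1 \<Longrightarrow> cot_pr1 (emb z) = 0"
proof -
  show "cot_pr0 (emb z) = 0" if "n \<noteq> 0"
    by (rule lin_eq_on_coord[OF lin_compose[OF lin_cot_pr0 lin_emb] lin_zero _ assms])
      (use that in \<open>auto simp: path_word_def\<close>)
  show "cot_pr1 (emb z) = 0" if "n \<noteq> 1"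
    by (rule lin_eq_on_coord[OF lin_compose[OF lin_cot_pr1 lin_emb] lin_zero _ assms])
      (use that in \<open>auto simp: path_word_def\<close>)
qed

lemma cmul_pr0:
  assumes E: "ESC E" and xy: "x \<in> coord_space (cot_words E)" "y \<in> coord_space (cot_words E)"
  shows "cot_pr0 (cmul E x y) = bmult (gralg E) (cot_pr0 x) (cot_pr0 y)"
proof (rule bilin_eq_on_coord[OF lin_compose_bilin[OF lin_cot_pr0 bilin_cmul]
      bilin_compose[OF _ lin_cot_pr0 lin_cot_pr0] _ xy])
  fix a b assume "a \<in> cot_words E" "b \<in> cot_words E"
  then obtain u x v y where PQ: "is_path E (u, x)" "a = path_word (u, x)" "is_path E (v, y)" "b = path_word (v, y)"
    by (auto simp: cot_words_def)
  have long: "path_mult E (u, x) (v, y) \<in> coord_space {P. length (fst P) = length u + length v}"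
    using path_mult_closed[OF E PQ(1,3)]
      coord_space_mono[of "paths_over E (u, x) (v, y)" "{P. length (fst P) = length u + length v}"]
    by (auto simp: paths_over_def)
  have m0: "bmult (gralg E) 0 w = 0" "bmult (gralg E) w 0 = 0" for w
    by (rule lin_0[OF bilin_left] lin_0[OF bilin_right]; simp)+
  show "cot_pr0 (cmul E (bvec a) (bvec b)) = bmult (gralg E) (cot_pr0 (bvec a)) (cot_pr0 (bvec b))"
  proof (cases "u = [] \<and> v = []")
    case True
    then show ?thesis using PQ by (simp add: cmul_path_word) (simp add: path_word_def)
  next
    case False
    then show ?thesis
      using PQ cot_pr_emb_long(1)[OF long] by (auto simp: cmul_path_word) (auto simp: path_word_def m0)
  qed
qed simp

lemma cmul_pr1:
  fixes E :: "('g, 'i, 'k::field) esc"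
  assumes E: "ESC E" and xy: "x \<in> coord_space (cot_words E)" "y \<in> coord_space (cot_words E)"
  shows "cot_pr1 (cmul E x y) = lact (arrow_bimod E) (cot_pr0 x) (cot_pr1 y) + ract (arrow_bimod E) (cot_pr1 x) (cot_pr0 y)"
proof (rule bilin_eq_on_coord[OF lin_compose_bilin[OF lin_cot_pr1 bilin_cmul]
      bilin_plus[OF bilin_compose[OF _ lin_cot_pr0 lin_cot_pr1] bilin_compose[OF _ lin_cot_pr1 lin_cot_pr0]] _ xy])
  fix a b assume "a \<in> cot_words E" "b \<in> cot_words E"
  then obtain u x v y where PQ: "is_path E (u, x)" "a = path_word (u, x)" "is_path E (v, y)" "b = path_word (v, y)"
    by (auto simp: cot_words_def)
  have long: "path_mult E (u, x) (v, y) \<in> coord_space {P. length (fst P) = length u + length v}"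
    using path_mult_closed[OF E PQ(1,3)]
      coord_space_mono[of "paths_over E (u, x) (v, y)" "{P. length (fst P) = length u + length v}"]
    by (auto simp: paths_over_def)
  have m0: "lact (arrow_bimod E) 0 w = 0" "lact (arrow_bimod E) h 0 = 0"
    "ract (arrow_bimod E) 0 h = 0" "ract (arrow_bimod E) w 0 = 0" for w h
    by (rule lin_0[OF bilin_left] lin_0[OF bilin_right]; simp)+
  consider "u = []" "v = []" | c where "u = [c]" "v = []" | c where "u = []" "v = [c]"
    | "length u + length v \<ge> 2"
    by (cases u; cases v) (fastforce simp: neq_Nil_conv)+
  then show "cot_pr1 (cmul E (bvec a) (bvec b)) = lact (arrow_bimod E) (cot_pr0 (bvec a)) (cot_pr1 (bvec b)) +
      ract (arrow_bimod E) (cot_pr1 (bvec a)) (cot_pr0 (bvec b))"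
  proof cases
    case 4
    have "cot_pr1 (cmul E (bvec a) (bvec b)) = 0"
      using PQ 4 cot_pr_emb_long(2)[OF long] by (simp add: cmul_path_word)
    moreover have "cot_pr0 (bvec a) = (0 :: ('g, 'k) vec) \<or> cot_pr1 (bvec b) = (0 :: (('g, 'i) arrow, 'k) vec)"
      "cot_pr1 (bvec a) = (0 :: (('g, 'i) arrow, 'k) vec) \<or> cot_pr0 (bvec b) = (0 :: ('g, 'k) vec)"
      using PQ 4 by (cases "u = []"; cases "v = []"; auto simp: path_word_def)+
    ultimately show ?thesis by (auto simp: m0)
  qed (use PQ in \<open>simp_all add: cmul_path_word lin_scale[OF lin_emb]\<close>,
       simp_all add: path_word_def m0 lin_scale[OF lin_cot_pr1])
qed simp_all

lemma bcounit_group_algebra_mult: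
  fixes a b :: "('g, 'k::field) vec"
  shows "bcounit (group_algebra G) (bmult (group_algebra G) a b) =
    bcounit (group_algebra G) a * bcounit (group_algebra G) b"
proof (rule vscale_bvec_inject)
  let ?e = "\<lambda>x. bcounit (group_algebra G) x"
  have lin_e: "lin (\<lambda>x. vscale (?e x) (bvec ()))"
    unfolding bcounit_group_algebra by simp
  have e: "?e (x + y) = ?e x + ?e y" "?e (vscale c x) = c * ?e x" for x y c
  proof -
    show "?e (x + y) = ?e x + ?e y"
      using lin_add[OF lin_e, of x y]
      by (intro vscale_bvec_inject[of _ "()"]) (simp add: pm.scale_left_distrib)
    show "?e (vscale c x) = c * ?e x"
      using lin_scale[OF lin_e, of c x] by (intro vscale_bvec_inject[of _ "()"]) simp
  qed
  show "vscale (?e (bmult (group_algebra G) a b)) (bvec ()) = vscale (?e a * ?e b) (bvec ())"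
  proof (rule bilin_eqI[of "\<lambda>a b. vscale (?e (bmult (group_algebra G) a b)) (bvec ())"
        "\<lambda>a b. vscale (?e a * ?e b) (bvec ())"])
    show "bilin (\<lambda>a b. vscale (?e (bmult (group_algebra G) a b)) (bvec ()))"
      by (rule lin_compose_bilin[OF lin_e]) simp
    show "bilin (\<lambda>a b. vscale (?e a * ?e b) (bvec ()))"
      by (intro bilinI linI) (simp_all add: e algebra_simps pm.scale_left_distrib)
  qed simp_all
qed

lemma is_cot_mult_cmul:
  assumes E: "ESC E"
  shows "is_cot_mult (gralg E) (arrow_bimod E) (cmul E)"
  unfolding is_cot_mult_def cot_space_eq cot_counit_def
  using cmul_closed[OF E] cmul_comult[OF E] cmul_pr0[OF E] cmul_pr1[OF E] bilin_cmul
  by (simp add: bcounit_group_algebra_mult)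

text \<open>
  The only way to cut a word into \<open>[a]\<close> and \<open>w\<close> is to cut \<open>a # w\<close> after its first letter, and the
  summands with a vertex cannot interfere since \<open>w\<close> is nonempty.
\<close>

lemma lookup_cot_comult:
  fixes E :: "('g, 'i, 'k::field) esc"
  assumes z: "z \<in> coord_space (cot_words E)" and w: "w \<noteq> []"
  shows "Poly_Mapping.lookup (cot_comult (gralg E) (arrow_bimod E) z) (Inr [a], Inr w) =
    Poly_Mapping.lookup z (Inr (a # w))"
proof -
  let ?D = "cot_comult (gralg E) (arrow_bimod E)"
  have "?D z = lin_ext (\<lambda>b. ?D (bvec b)) z" by (rule lin_eq_lin_ext) simp
  also have "Poly_Mapping.lookup \<dots> (Inr [a], Inr w) = Poly_Mapping.lookup z (Inr (a # w))"
  proof (rule lookup_lin_ext_delta[OF z])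
    fix b assume "b \<in> cot_words E"
    then consider g where "b = Inl g" | v where "b = Inr v" "v \<noteq> []"
      by (auto simp: cot_words_def path_word_def split: if_splits)
    then show "Poly_Mapping.lookup (?D (bvec b)) (Inr [a], Inr w) = (if b = Inr (a # w) then 1 else 0)"
    proof cases
      case 1
      then show ?thesis by (simp add: cot_comult_Inl lookup_bvec)
    next
      case 2
      have eq: "take p v = [a] \<and> drop p v = w \<longleftrightarrow> p = 1 \<and> v = a # w" if "p < length v" for p
      proof
        assume l: "take p v = [a] \<and> drop p v = w"
        then have "length (take p v) = 1" by simp
        then have "p = 1" using that by simp
        moreover have "v = a # w" using l append_take_drop_id[of p v] by simp
        ultimately show "p = 1 \<and> v = a # w" by simp
      qed auto
      have "Poly_Mapping.lookup (?D (bvec b)) (Inr [a], Inr w) = (\<Sum>p\<in>{0<..<length v}.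
          Poly_Mapping.lookup (bvec (Inr (take p v) :: 'g + ('g, 'i) arrow list,
            Inr (drop p v) :: 'g + ('g, 'i) arrow list)) (Inr [a], Inr w))"
        unfolding 2(1) cot_comult_Inr[OF 2(2)]
        by (simp add: lookup_add lookup_sum_vec lookup_bvec[of "(Inl x, y)" for x y]
            lookup_bvec[of "(x, Inl y)" for x y])
      also have "\<dots> = (\<Sum>p\<in>{0<..<length v}. if p = 1 then (if v = a # w then 1 else 0) else 0)"
        by (intro sum.cong) (auto simp: lookup_bvec eq)
      also have "\<dots> = (if b = Inr (a # w) then 1 else 0)"
        using w 2 by auto
      finally show ?thesis .
    qed
  qed
  finally show ?thesis .
qed

lemma lookup_cot_pr0: "Poly_Mapping.lookup (cot_pr0 z) g = Poly_Mapping.lookup z (Inl g)"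
  unfolding cot_pr0_def
  by (rule lookup_lin_ext_delta[of _ UNIV]) (auto simp: lookup_bvec split: sum.split)

lemma lookup_cot_pr1: "Poly_Mapping.lookup (cot_pr1 z) a = Poly_Mapping.lookup z (Inr [a])"
  unfolding cot_pr1_def
  by (rule lookup_lin_ext_delta[of _ UNIV]) (auto simp: lookup_bvec split: sum.split list.split)

text \<open>
  Coefficients of products are compared by induction on the length of the word at which they are
  taken. Degrees 0 and 1 are prescribed. For a longer word \<open>a # w\<close>, the previous lemmas express the
  coefficient through the comultiplication, that is through coefficients of other products at \<open>[a]\<close> and
  at \<open>w\<close>; so the statement has to be proved for all factors simultaneously.
\<close>

lemma is_cot_mult_unique:
  fixes E :: "('g, 'i, 'k::field) esc"
  assumes E: "ESC E" and m: "is_cot_mult (gralg E) (arrow_bimod E) m"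
    and m': "is_cot_mult (gralg E) (arrow_bimod E) m'"
    and xy: "x \<in> coord_space (cot_words E)" "y \<in> coord_space (cot_words E)"
  shows "m x y = m' x y"
proof -
  let ?D = "cot_comult (gralg E) (arrow_bimod E)"
  have bilin: "bilin m" "bilin m'" using m m' by (auto simp: is_cot_mult_def)
  have words: "Poly_Mapping.lookup (m (bvec X) (bvec Y)) (Inr w) = Poly_Mapping.lookup (m' (bvec X) (bvec Y)) (Inr w)"
    if "X \<in> cot_words E" "Y \<in> cot_words E" for X Y w
    using that
  proof (induction w arbitrary: X Y)
    case Nil
    have "Inr [] \<notin> cot_words E" by (auto simp: cot_words_def path_word_def)
    moreover have "m (bvec X) (bvec Y) \<in> coord_space (cot_words E)" "m' (bvec X) (bvec Y) \<in> coord_space (cot_words E)"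
      using m m' Nil by (auto simp: is_cot_mult_def cot_space_eq)
    ultimately show ?case using coord_spaceD by metis
  next
    case (Cons a w)
    have one: "Poly_Mapping.lookup (m (bvec X) (bvec Y)) (Inr [a]) = Poly_Mapping.lookup (m' (bvec X) (bvec Y)) (Inr [a])"
      if "X \<in> cot_words E" "Y \<in> cot_words E" for X Y
      using m m' that by (simp add: is_cot_mult_def cot_space_eq flip: lookup_cot_pr1)
    show ?case
    proof (cases "w = []")
      case True
      then show ?thesis using one Cons.prems by simp
    next
      case False
      have D: "?D (bvec X) \<in> coord_space (cot_words E \<times> cot_words E)"
        "?D (bvec Y) \<in> coord_space (cot_words E \<times> cot_words E)"
        using cot_comult_closed[OF E] Cons.prems by auto
      have step: "Poly_Mapping.lookup (n (bvec X) (bvec Y)) (Inr (a # w)) =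
          Poly_Mapping.lookup (tensor_mult n (?D (bvec X)) (?D (bvec Y))) (Inr [a], Inr w)"
        if "is_cot_mult (gralg E) (arrow_bimod E) n" for n
        using that Cons.prems lookup_cot_comult[OF _ False, of "n (bvec X) (bvec Y)" E a]
        by (simp add: is_cot_mult_def cot_space_eq)
      show ?thesis
        unfolding step[OF m] step[OF m']
        by (rule lookup_tensor_mult_cong[where S = "cot_words E" and m = m and m' = m'])
          (fact D one Cons.IH)+
    qed
  qed
  show ?thesis
  proof (rule bilin_eq_on_coord[OF bilin _ xy])
    fix X Y assume XY: "X \<in> cot_words E" "Y \<in> cot_words E"
    have "Poly_Mapping.lookup (m (bvec X) (bvec Y)) (Inl g) = Poly_Mapping.lookup (m' (bvec X) (bvec Y)) (Inl g)" for g
      using m m' XY by (simp add: is_cot_mult_def cot_space_eq flip: lookup_cot_pr0)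
    then have "Poly_Mapping.lookup (m (bvec X) (bvec Y)) b = Poly_Mapping.lookup (m' (bvec X) (bvec Y)) b" for b
      using words[OF XY] by (cases b) auto
    then show "m (bvec X) (bvec Y) = m' (bvec X) (bvec Y)" by (rule poly_mapping_eqI)
  qed
qed

text \<open>
  The multiplication of the cotensor coalgebra is chosen by its defining property; existence and
  uniqueness identify it with the explicit product.
\<close>

lemma cot_mult_eq_cmul:
  assumes E: "ESC E" and "x \<in> coord_space (cot_words E)" "y \<in> coord_space (cot_words E)"
  shows "cot_mult (gralg E) (arrow_bimod E) x y = cmul E x y"
proof (rule is_cot_mult_unique[OF E _ is_cot_mult_cmul[OF E] assms(2,3)])
  show "is_cot_mult (gralg E) (arrow_bimod E) (cot_mult (gralg E) (arrow_bimod E))"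
    unfolding cot_mult_def by (rule someI[of "is_cot_mult (gralg E) (arrow_bimod E)", OF is_cot_mult_cmul[OF E]])
qed

section \<open>Multiple Taft algebras\<close>

abbreviation gen :: "('g, 'i, 'k::field) esc \<Rightarrow> ('g + ('g, 'i) arrow list, 'k) vec set" where
  "gen E \<equiv> gen_space (gralg E) (arrow_bimod E)"

lemma multiple_taft_simps [simp]:
  "bspace (multiple_taft E) = gen E"
  "bmult (multiple_taft E) = cot_mult (gralg E) (arrow_bimod E)"
  "bone (multiple_taft E) = bvec (Inl \<one>\<^bsub>egrp E\<^esub>)"
  "bcomult (multiple_taft E) = cot_comult (gralg E) (arrow_bimod E)"
  "bcounit (multiple_taft E) x = bcounit (gralg E) (cot_pr0 x)"
  "bdeg (multiple_taft E) n = gen E \<inter> cot_deg (gralg E) (arrow_bimod E) n"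
  by (simp_all add: multiple_taft_def gen_hopf_def cot_counit_def cot_in_eq)

lemma Inl_in_cot_words [simp]: "Inl g \<in> cot_words E \<longleftrightarrow> g \<in> carrier (egrp E)"
proof
  assume "g \<in> carrier (egrp E)"
  then show "Inl g \<in> cot_words E"
    unfolding cot_words_def by (intro image_eqI[of _ _ "([], g)"]) (auto simp: path_word_def)
qed (auto simp: cot_words_def path_word_def split: if_splits)

lemma arrow_is_path: "is_path E ([a], x) \<longleftrightarrow> a \<in> esc_arrows E \<and> x = asource a"
  by (auto simp: esc_arrows_iff)

lemma Inr_in_cot_words [simp]: "Inr [a] \<in> cot_words E \<longleftrightarrow> a \<in> esc_arrows E"
proof
  assume "a \<in> esc_arrows E"
  then show "Inr [a] \<in> cot_words E"
    unfolding cot_words_def using arrow_is_path[of E a]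
    by (intro image_eqI[of _ _ "([a], asource a)"]) (auto simp: path_word_def)
qed (auto simp: cot_words_def path_word_def split: if_splits)

lemma in0_closed: "h \<in> coord_space (carrier (egrp E)) \<Longrightarrow> cot_in0 h \<in> coord_space (cot_words E)"
  and in1_closed: "x \<in> coord_space (esc_arrows E) \<Longrightarrow> cot_in1 x \<in> coord_space (cot_words E)"
  unfolding cot_in_eq by (auto intro: basis_map_in_coord_space)

lemma subspace_gen: "pm.subspace (gen E)"
  unfolding gen_space_def by (rule pm.subspace_Inter) blast

lemma gen_in0: "h \<in> coord_space (carrier (egrp E)) \<Longrightarrow> cot_in0 h \<in> gen E"
  unfolding gen_space_def by auto

lemma gen_in1: "x \<in> coord_space (esc_arrows E) \<Longrightarrow> cot_in1 x \<in> gen E"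
  unfolding gen_space_def by auto

lemma gen_mult: "x \<in> gen E \<Longrightarrow> y \<in> gen E \<Longrightarrow> cot_mult (gralg E) (arrow_bimod E) x y \<in> gen E"
  unfolding gen_space_def by blast

text \<open>
  The induction principle for the subalgebra generated in degrees 0 and 1.
\<close>

lemma gen_least:
  assumes "pm.subspace S" "\<And>h. h \<in> coord_space (carrier (egrp E)) \<Longrightarrow> cot_in0 h \<in> S"
    "\<And>x. x \<in> coord_space (esc_arrows E) \<Longrightarrow> cot_in1 x \<in> S"
    "\<And>x y. x \<in> S \<Longrightarrow> y \<in> S \<Longrightarrow> cot_mult (gralg E) (arrow_bimod E) x y \<in> S"
  shows "gen E \<subseteq> S"
  unfolding gen_space_def using assms by (intro Inter_lower) auto

lemma gen_subset: "ESC E \<Longrightarrow> gen E \<subseteq> coord_space (cot_words E)"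
  by (rule gen_least)
    (auto simp: subspace_coord_space in0_closed in1_closed cot_mult_eq_cmul cmul_closed)

subsection \<open>Functoriality\<close>

definition arrow_map :: "('g \<Rightarrow> 'h) \<Rightarrow> ('i \<Rightarrow> 'j) \<Rightarrow> ('g, 'i) arrow \<Rightarrow> ('h, 'j) arrow" where
  "arrow_map \<psi> \<sigma> a = Arrow (\<psi> (atarget a)) (\<sigma> (alabel a)) (\<psi> (asource a))"

definition path_map :: "('g \<Rightarrow> 'h) \<Rightarrow> ('i \<Rightarrow> 'j) \<Rightarrow> ('g, 'i) path \<Rightarrow> ('h, 'j) path" where
  "path_map \<psi> \<sigma> P = (map (arrow_map \<psi> \<sigma>) (fst P), \<psi> (snd P))"

definition word_map ::
  "('g \<Rightarrow> 'h) \<Rightarrow> ('i \<Rightarrow> 'j) \<Rightarrow> 'g + ('g, 'i) arrow list \<Rightarrow> 'h + ('h, 'j) arrow list" where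
  "word_map \<psi> \<sigma> = map_sum \<psi> (map (arrow_map \<psi> \<sigma>))"

lemma arrow_map_simps [simp]:
  "atarget (arrow_map \<psi> \<sigma> a) = \<psi> (atarget a)" "asource (arrow_map \<psi> \<sigma> a) = \<psi> (asource a)"
  "alabel (arrow_map \<psi> \<sigma> a) = \<sigma> (alabel a)"
  by (simp_all add: arrow_map_def)

lemma path_map_simps [simp]:
  "path_map \<psi> \<sigma> ([], x) = ([], \<psi> x)"
  "path_map \<psi> \<sigma> (a # w, x) = (arrow_map \<psi> \<sigma> a # map (arrow_map \<psi> \<sigma>) w, \<psi> x)"
  "snd (path_map \<psi> \<sigma> P) = \<psi> (snd P)"
  "length (fst (path_map \<psi> \<sigma> P)) = length (fst P)"
  by (simp_all add: path_map_def)

lemma path_word_map: "path_word (path_map \<psi> \<sigma> P) = word_map \<psi> \<sigma> (path_word P)"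
  by (auto simp: path_word_def path_map_def word_map_def)

lemma path_target_map: "path_target (path_map \<psi> \<sigma> P) = \<psi> (path_target P)"
  by (cases P rule: path_target.cases) (auto simp: path_map_def)

lemma emb_path_map: "emb (basis_map (path_map \<psi> \<sigma>) z) = basis_map (word_map \<psi> \<sigma>) (emb z)"
  by (rule lin_eqI[OF lin_compose[OF lin_emb lin_basis_map] lin_compose[OF lin_basis_map lin_emb]])
    (simp add: path_word_map)

lemma pcons_path_map:
  "basis_map (path_map \<psi> \<sigma>) (pcons a z) = pcons (arrow_map \<psi> \<sigma> a) (basis_map (path_map \<psi> \<sigma>) z)"
  by (rule lin_eqI[OF lin_compose[OF lin_basis_map lin_pcons] lin_compose[OF lin_pcons lin_basis_map]])
    (auto simp: path_map_def)

lemma path_comult_map: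
  "path_comult (path_map \<psi> \<sigma> P) =
    tensor_map (basis_map (path_map \<psi> \<sigma>)) (basis_map (path_map \<psi> \<sigma>)) (path_comult P)"
proof (induction P rule: path_comult.induct)
  case (2 a w x)
  let ?F = "basis_map (path_map \<psi> \<sigma>)"
  have "tensor_map (pcons (arrow_map \<psi> \<sigma> a)) id (tensor_map ?F ?F z) = tensor_map ?F ?F (tensor_map (pcons a) id z)"
    for z by (simp add: tensor_map_compose lin_id pcons_path_map)
  moreover have "path_map \<psi> \<sigma> (w, x) = (map (arrow_map \<psi> \<sigma>) w, \<psi> x)"
    by (simp add: path_map_def)
  ultimately show ?case
    using 2 by (simp add: lin_add[OF lin_tensor_map])
qed simp

locale esc_isomorphism =
  fixes E :: "('g, 'i, 'k::field) esc" and E' :: "('h, 'j, 'k) esc" and \<psi> :: "'g \<Rightarrow> 'h" and \<sigma> :: "'i \<Rightarrow> 'j"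
  assumes E: "ESC E" and E': "ESC E'" and iso: "esc_iso E E' \<psi> \<sigma>"
begin

abbreviation "F \<equiv> basis_map (word_map \<psi> \<sigma>) :: ('g + ('g, 'i) arrow list, 'k) vec \<Rightarrow> ('h + ('h, 'j) arrow list, 'k) vec"

lemma psi: "\<psi> \<in> iso (egrp E) (egrp E')" and sigma: "bij_betw \<sigma> (eidx E) (eidx E')"
  and elt: "i \<in> eidx E \<Longrightarrow> \<psi> (eelt E i) = eelt E' (\<sigma> i)"
  and chr: "i \<in> eidx E \<Longrightarrow> h \<in> carrier (egrp E) \<Longrightarrow> echr E' (\<sigma> i) (\<psi> h) = echr E i h"
  using iso by (auto simp: esc_iso_def)

lemma psi_mult: "g \<in> carrier (egrp E) \<Longrightarrow> h \<in> carrier (egrp E) \<Longrightarrow>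
    \<psi> (g \<otimes>\<^bsub>egrp E\<^esub> h) = \<psi> g \<otimes>\<^bsub>egrp E'\<^esub> \<psi> h"
  and psi_closed: "g \<in> carrier (egrp E) \<Longrightarrow> \<psi> g \<in> carrier (egrp E')"
  using psi by (auto simp: iso_def hom_def)

lemma sigma_closed: "i \<in> eidx E \<Longrightarrow> \<sigma> i \<in> eidx E'"
  using sigma by (rule bij_betwE[rule_format])

lemma arrow_map_closed: "a \<in> esc_arrows E \<Longrightarrow> arrow_map \<psi> \<sigma> a \<in> esc_arrows E'"
  by (simp add: esc_arrows_iff sigma_closed psi_closed psi_mult ESC_elt[OF E] elt)

lemma arrow_map_ltr:
  "a \<in> esc_arrows E \<Longrightarrow> h \<in> carrier (egrp E) \<Longrightarrow>
    arrow_map \<psi> \<sigma> (ltr E h a) = ltr E' (\<psi> h) (arrow_map \<psi> \<sigma> a)"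
  and arrow_map_rtr:
  "a \<in> esc_arrows E \<Longrightarrow> h \<in> carrier (egrp E) \<Longrightarrow>
    arrow_map \<psi> \<sigma> (rtr E a h) = rtr E' (arrow_map \<psi> \<sigma> a) (\<psi> h)"
  using arrow_target_closed[OF E, of a]
  by (simp_all add: ltr_def rtr_def arrow_map_def psi_mult esc_arrows_iff)

lemma is_path_map: "is_path E P \<Longrightarrow> is_path E' (path_map \<psi> \<sigma> P)"
proof (induction P rule: path_comult.induct)
  case (2 a w x)
  then show ?case
    using path_target_map[of \<psi> \<sigma> "(w, x)"] by (simp add: arrow_map_closed path_map_def)
qed (simp add: psi_closed)

lemma path_mult_map:
  "is_path E P \<Longrightarrow> is_path E Q \<Longrightarrow>
    basis_map (path_map \<psi> \<sigma>) (path_mult E P Q) = path_mult E' (path_map \<psi> \<sigma> P) (path_map \<psi> \<sigma> Q)"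
proof (induction "length (fst P) + length (fst Q)" arbitrary: P Q rule: less_induct)
  case less
  obtain u x v y where PQ: "P = (u, x)" "Q = (v, y)" by (cases P; cases Q)
  let ?F = "basis_map (path_map \<psi> \<sigma>)"
  have pm: "path_map \<psi> \<sigma> (w, z) = (map (arrow_map \<psi> \<sigma>) w, \<psi> z)" for w z
    by (simp add: path_map_def)
  have IH: "?F (path_mult E (u', x) (v', y)) =
      path_mult E' (map (arrow_map \<psi> \<sigma>) u', \<psi> x) (map (arrow_map \<psi> \<sigma>) v', \<psi> y)"
    if "length u' + length v' < length u + length v" "is_path E (u', x)" "is_path E (v', y)" for u' v'
    using less(1)[of "(u', x)" "(v', y)"] that PQ by (simp add: pm)
  show ?case
  proof (cases u)
    case Nil
    show ?thesis
    proof (cases v)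
      case Nil
      then show ?thesis using \<open>u = []\<close> less.prems PQ by (simp add: psi_mult)
    next
      case (Cons b v')
      then show ?thesis
        using \<open>u = []\<close> less.prems PQ IH[of u v'] by (simp add: pcons_path_map arrow_map_ltr)
    qed
  next
    case (Cons a u')
    then have a: "a \<in> esc_arrows E" "alabel a \<in> eidx E" using less.prems PQ by (auto simp: esc_arrows_iff)
    show ?thesis
    proof (cases v)
      case Nil
      then show ?thesis
        using Cons a less.prems PQ IH[of u' v]
        by (simp add: pcons_path_map arrow_map_rtr chr lin_scale[OF lin_basis_map])
    next
      case (Cons b v')
      then show ?thesis
        using \<open>u = a # u'\<close> a less.prems PQ IH[of u' v] IH[of u v'] arrow_target_closed[OF E, of b]
          arrow_target_closed[OF E, of a]
        by (simp add: pcons_path_map arrow_map_rtr arrow_map_ltr chr lin_scale[OF lin_basis_map]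
            lin_add[OF lin_basis_map])
    qed
  qed
qed

lemma F_mult:
  assumes "x \<in> coord_space (cot_words E)" "y \<in> coord_space (cot_words E)"
  shows "F (cmul E x y) = cmul E' (F x) (F y)"
proof (rule bilin_eq_on_coord[OF lin_compose_bilin[OF lin_basis_map bilin_cmul]
      bilin_compose[OF bilin_cmul lin_basis_map lin_basis_map] _ assms])
  fix a b assume "a \<in> cot_words E" "b \<in> cot_words E"
  then obtain P Q where PQ: "is_path E P" "a = path_word P" "is_path E Q" "b = path_word Q"
    by (auto simp: cot_words_def)
  then show "F (cmul E (bvec a) (bvec b)) = cmul E' (F (bvec a)) (F (bvec b))"
    by (simp add: cmul_path_word path_word_map[symmetric] is_path_map path_mult_map[symmetric] emb_path_map)
qed

lemma F_comult:
  assumes "x \<in> coord_space (cot_words E)"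
  shows "cot_comult (gralg E') (arrow_bimod E') (F x) = tensor_map F F (cot_comult (gralg E) (arrow_bimod E) x)"
proof (rule lin_eq_on_coord[OF lin_compose[OF lin_cot_comult lin_basis_map]
      lin_compose[OF lin_tensor_map lin_cot_comult] _ assms])
  fix b assume "b \<in> cot_words E"
  then obtain P where P: "is_path E P" "b = path_word P"
    by (auto simp: cot_words_def)
  have "cot_comult (gralg E') (arrow_bimod E') (F (bvec b)) =
      tensor_map emb emb (path_comult (path_map \<psi> \<sigma> P))"
    using cot_comult_emb[of "bvec (path_map \<psi> \<sigma> P)" E'] is_path_map[OF P(1)] P(2)
    by (simp add: path_word_map)
  also have "\<dots> = tensor_map F F (tensor_map emb emb (path_comult P))"
    by (simp add: path_comult_map tensor_map_compose emb_path_map)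
  also have "tensor_map emb emb (path_comult P) = cot_comult (gralg E) (arrow_bimod E) (bvec b)"
    using cot_comult_emb[of "bvec P" E] P by simp
  finally show "cot_comult (gralg E') (arrow_bimod E') (F (bvec b)) =
      tensor_map F F (cot_comult (gralg E) (arrow_bimod E) (bvec b))" .
qed

lemma F_pr0: "cot_pr0 (F x) = basis_map \<psi> (cot_pr0 x)"
proof (rule lin_eqI[OF lin_compose[OF lin_cot_pr0 lin_basis_map] lin_compose[OF lin_basis_map lin_cot_pr0]])
  show "cot_pr0 (F (bvec b)) = basis_map \<psi> (cot_pr0 (bvec b))" for b
    by (cases b) (simp_all add: word_map_def lin_0[OF lin_basis_map])
qed

lemma F_in0: "F (cot_in0 h) = cot_in0 (basis_map \<psi> h)"
  unfolding cot_in_eq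
  by (rule lin_eqI[OF lin_compose[OF lin_basis_map lin_basis_map] lin_compose[OF lin_basis_map lin_basis_map]])
    (simp add: word_map_def)

lemma F_in1: "F (cot_in1 x) = cot_in1 (basis_map (arrow_map \<psi> \<sigma>) x)"
  unfolding cot_in_eq
  by (rule lin_eqI[OF lin_compose[OF lin_basis_map lin_basis_map] lin_compose[OF lin_basis_map lin_basis_map]])
    (simp add: word_map_def)

lemma F_closed: "x \<in> coord_space (cot_words E) \<Longrightarrow> F x \<in> coord_space (cot_words E')"
  by (rule basis_map_in_coord_space)
    (auto simp: cot_words_def path_word_map[symmetric] intro!: imageI is_path_map)

text \<open>
  The elements whose image lies in the generated subalgebra of the target form a subalgebra that
  contains all generators.
\<close>

lemma F_gen: "F ` gen E \<subseteq> gen E'"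
proof -
  let ?S = "{x \<in> coord_space (cot_words E). F x \<in> gen E'}"
  have "gen E \<subseteq> ?S"
  proof (rule gen_least)
    have "pm.subspace (coord_space (cot_words E) \<inter> {x. F x \<in> gen E'})"
      by (rule pm.subspace_inter[OF subspace_coord_space
            pp.linear_subspace_linear_preimage[OF lin_basis_map subspace_gen]])
    then show "pm.subspace ?S" by (simp add: Int_def)
    show "cot_in0 h \<in> ?S" if "h \<in> coord_space (carrier (egrp E))" for h
      using that by (auto simp: F_in0 in0_closed intro!: gen_in0 basis_map_in_coord_space psi_closed)
    show "cot_in1 x \<in> ?S" if "x \<in> coord_space (esc_arrows E)" for x
      using that by (auto simp: F_in1 in1_closed intro!: gen_in1 basis_map_in_coord_space arrow_map_closed)
    show "cot_mult (gralg E) (arrow_bimod E) x y \<in> ?S" if "x \<in> ?S" "y \<in> ?S" for x y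
      using that gen_mult[of "F x" E' "F y"]
      by (simp add: cot_mult_eq_cmul[OF E] cmul_closed[OF E] F_mult cot_mult_eq_cmul[OF E'] F_closed)
  qed
  then show ?thesis by blast
qed

end

lemma esc_isomorphism_inverse:
  assumes "esc_isomorphism E E' \<psi> \<sigma>"
  shows "esc_isomorphism E' E (inv_into (carrier (egrp E)) \<psi>) (inv_into (eidx E) \<sigma>)"
  using assms esc_iso_inverse unfolding esc_isomorphism_def by blast

lemma is_path_set: "is_path E P \<Longrightarrow> set (fst P) \<subseteq> esc_arrows E \<and> snd P \<in> carrier (egrp E)"
  by (induction P rule: path_comult.induct) auto

lemma path_map_inverse:
  assumes "is_path E P" "ESC E"
    and \<psi>: "\<And>g. g \<in> carrier (egrp E) \<Longrightarrow> \<psi>' (\<psi> g) = g" and \<sigma>: "\<And>i. i \<in> eidx E \<Longrightarrow> \<sigma>' (\<sigma> i) = i"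
  shows "path_map \<psi>' \<sigma>' (path_map \<psi> \<sigma> P) = P"
proof -
  have arrow: "arrow_map \<psi>' \<sigma>' (arrow_map \<psi> \<sigma> a) = a" if "a \<in> esc_arrows E" for a
    using that arrow_target_closed[OF assms(2) that]
    by (cases a) (simp add: arrow_map_def \<psi> \<sigma> esc_arrows_iff)
  have "map (arrow_map \<psi>' \<sigma>') (map (arrow_map \<psi> \<sigma>) (fst P)) = fst P"
    using is_path_set[OF assms(1)] arrow by (auto intro!: map_idI)
  then show ?thesis
    using is_path_set[OF assms(1)] by (simp add: path_map_def \<psi> prod_eq_iff)
qed

text \<open>
  Surjectivity onto the generated subalgebra and onto the homogeneous components follows by applying
  the inclusions to the inverse isomorphism of element systems as well.
\<close>

lemma multiple_taft_iso:
  fixes E :: "('g, 'i, 'k::field) esc" and E' :: "('h, 'j, 'k) esc"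
  assumes "esc_isomorphism E E' \<psi> \<sigma>"
  shows "graded_hopf_iso (multiple_taft E) (multiple_taft E') (basis_map (word_map \<psi> \<sigma>))"
proof -
  interpret esc_isomorphism E E' \<psi> \<sigma> by fact
  let ?\<psi> = "inv_into (carrier (egrp E)) \<psi>" and ?\<sigma> = "inv_into (eidx E) \<sigma>"
  interpret inv: esc_isomorphism E' E ?\<psi> ?\<sigma> by (rule esc_isomorphism_inverse) fact
  interpret G: group "egrp E" by (rule ESC_group[OF E])
  interpret G': group "egrp E'" by (rule ESC_group[OF E'])
  have bij: "bij_betw \<psi> (carrier (egrp E)) (carrier (egrp E'))" using psi by (simp add: iso_def)
  have path1: "path_map ?\<psi> ?\<sigma> (path_map \<psi> \<sigma> P) = P" if "is_path E P" for P
    by (rule path_map_inverse[OF that E])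
      (simp_all add: bij_betw_inv_into_left[OF bij] bij_betw_inv_into_left[OF sigma])
  have path2: "path_map \<psi> \<sigma> (path_map ?\<psi> ?\<sigma> P) = P" if "is_path E' P" for P
    by (rule path_map_inverse[OF that E'])
      (simp_all add: bij_betw_inv_into_right[OF bij] bij_betw_inv_into_right[OF sigma])
  have F1: "inv.F (F x) = x" if "x \<in> coord_space (cot_words E)" for x
    using that
    by (intro basis_map_inverse[of "cot_words E"])
      (auto simp: cot_words_def path_word_map[symmetric] path1)
  have F2: "F (inv.F y) = y" if "y \<in> coord_space (cot_words E')" for y
    using that
    by (intro basis_map_inverse[of "cot_words E'"])
      (auto simp: cot_words_def path_word_map[symmetric] path2)
  have inj: "inj_on F (coord_space (cot_words E))"
    using F1 by (rule inj_on_inverseI)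
  have gen: "F ` gen E = gen E'"
  proof
    show "gen E' \<subseteq> F ` gen E"
    proof
      fix y assume y: "y \<in> gen E'"
      then have "y = F (inv.F y)" using gen_subset[OF E'] F2 by force
      then show "y \<in> F ` gen E" using inv.F_gen y by blast
    qed
  qed (rule F_gen)
  have deg: "F ` cot_deg (gralg E) (arrow_bimod E) n = cot_deg (gralg E') (arrow_bimod E') n" for n
  proof -
    have paths: "path_map \<psi> \<sigma> ` {P. is_path E P \<and> length (fst P) = n} = {P. is_path E' P \<and> length (fst P) = n}"
    proof (intro equalityI subsetI)
      fix P assume "P \<in> {P. is_path E' P \<and> length (fst P) = n}"
      then show "P \<in> path_map \<psi> \<sigma> ` {P. is_path E P \<and> length (fst P) = n}"
        using path2[of P] inv.is_path_map[of P]
        by (intro image_eqI[of _ _ "path_map ?\<psi> ?\<sigma> P"]) auto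
    qed (auto simp: is_path_map)
    have "word_map \<psi> \<sigma> ` path_word ` {P. is_path E P \<and> length (fst P) = n} =
        path_word ` path_map \<psi> \<sigma> ` {P. is_path E P \<and> length (fst P) = n}"
      by (simp only: image_image path_word_map)
    then show ?thesis
      unfolding cot_deg_eq basis_map_image_coord paths by (rule arg_cong)
  qed
  have deg_sub: "cot_deg (gralg E) (arrow_bimod E) n \<subseteq> coord_space (cot_words E)" for n
    unfolding cot_deg_eq cot_words_def by (rule coord_space_mono) auto
  note sub = subsetD[OF gen_subset[OF E]]
  have "hopf_iso (multiple_taft E) (multiple_taft E') F"
    unfolding hopf_iso_def multiple_taft_simps
  proof (intro conjI ballI lin_basis_map)
    show "bij_betw F (gen E) (gen E')"
      using inj_on_subset[OF inj gen_subset[OF E]] gen by (simp add: bij_betw_def)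
    show "F (cot_mult (gralg E) (arrow_bimod E) x y) = cot_mult (gralg E') (arrow_bimod E') (F x) (F y)"
      if "x \<in> gen E" "y \<in> gen E" for x y
      using sub[OF that(1)] sub[OF that(2)]
      by (simp add: cot_mult_eq_cmul[OF E] cot_mult_eq_cmul[OF E'] F_mult F_closed)
    show "F (bvec (Inl \<one>\<^bsub>egrp E\<^esub>)) = bvec (Inl \<one>\<^bsub>egrp E'\<^esub>)"
      using psi hom_one[of \<psi> "egrp E" "egrp E'"] G.is_group G'.is_group by (simp add: word_map_def iso_def)
    show "cot_comult (gralg E') (arrow_bimod E') (F x) = tensor_map F F (cot_comult (gralg E) (arrow_bimod E) x)"
      if "x \<in> gen E" for x using F_comult[OF sub[OF that]] .
    show "bcounit (gralg E') (cot_pr0 (F x)) = bcounit (gralg E) (cot_pr0 x)" if "x \<in> gen E" for x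
      by (simp add: F_pr0 bcounit_basis_map[of "egrp E'" \<psi> _ "egrp E"])
  qed
  moreover have "F ` bdeg (multiple_taft E) n = bdeg (multiple_taft E') n" for n
    unfolding multiple_taft_simps inj_on_image_Int[OF inj gen_subset[OF E] deg_sub] gen deg ..
  ultimately show ?thesis by (simp add: graded_hopf_iso_def)
qed

lemma in1_deg: "cot_in1 ` coord_space (esc_arrows E) = cot_deg (gralg E) (arrow_bimod E) 1"
  and in0_deg: "cot_in0 ` coord_space (carrier (egrp E)) = cot_deg (gralg E) (arrow_bimod E) 0"
proof -
  have A: "{P. is_path E P \<and> length (fst P) = 1} = (\<lambda>a. ([a], asource a)) ` esc_arrows E"
  proof (intro equalityI subsetI)
    fix P assume P: "P \<in> {P. is_path E P \<and> length (fst P) = 1}"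
    then obtain a x where "P = ([a], x)" by (cases P) (auto simp: length_Suc_conv)
    then show "P \<in> (\<lambda>a. ([a], asource a)) ` esc_arrows E" using P by auto
  qed (auto simp: arrow_is_path simp del: is_path.simps)
  show "cot_in1 ` coord_space (esc_arrows E) = cot_deg (gralg E) (arrow_bimod E) 1"
    unfolding cot_deg_eq cot_in_eq basis_map_image_coord A image_image by (simp add: path_word_def)
  show "cot_in0 ` coord_space (carrier (egrp E)) = cot_deg (gralg E) (arrow_bimod E) 0"
    by (simp add: cot_deg_def)
qed

lemma pr_in [simp]: "cot_pr0 (cot_in0 h) = h" "cot_pr1 (cot_in1 x) = x"
    "cot_pr0 (cot_in1 x) = 0" "cot_pr1 (cot_in0 h) = 0"
proof -
  note rules = lin_compose[OF lin_cot_pr0 lin_basis_map] lin_compose[OF lin_cot_pr1 lin_basis_map]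
  show "cot_pr0 (cot_in0 h) = h" "cot_pr1 (cot_in1 x) = x" "cot_pr0 (cot_in1 x) = 0" "cot_pr1 (cot_in0 h) = 0"
    unfolding cot_in_eq
    by (rule lin_eqI[OF rules(1) lin_ident] lin_eqI[OF rules(2) lin_ident]
        lin_eqI[OF rules(1) lin_zero] lin_eqI[OF rules(2) lin_zero]; simp; fail)+
qed

lemma lin_cot_in [simp]: "lin cot_in0" "lin cot_in1"
  by (simp_all add: cot_in_eq)

lemma cmul_in:
  fixes E :: "('g, 'i, 'k::field) esc"
  assumes "h \<in> coord_space (carrier (egrp E))"
  shows "h' \<in> coord_space (carrier (egrp E)) \<Longrightarrow> cmul E (cot_in0 h) (cot_in0 h') = cot_in0 (bmult (gralg E) h h')"
    and "x \<in> coord_space (esc_arrows E) \<Longrightarrow> cmul E (cot_in0 h) (cot_in1 x) = cot_in1 (lact (arrow_bimod E) h x)"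
    and "x \<in> coord_space (esc_arrows E) \<Longrightarrow> cmul E (cot_in1 x) (cot_in0 h) = cot_in1 (ract (arrow_bimod E) x h)"
proof -
  have w0: "bvec (Inl g) = bvec (path_word ([], g))" for g by (simp add: path_word_def)
  have w1: "bvec (Inr [a]) = bvec (path_word ([a], asource a))" for a by (simp add: path_word_def)
  show "cmul E (cot_in0 h) (cot_in0 h') = cot_in0 (bmult (gralg E) h h')"
    if h': "h' \<in> coord_space (carrier (egrp E))"
    by (rule bilin_eq_on_coord[OF bilin_compose[OF bilin_cmul lin_cot_in(1) lin_cot_in(1)]
          lin_compose_bilin[OF lin_cot_in(1)] _ assms h'])
      (simp_all add: cot_in_eq w0 cmul_path_word)
  show "cmul E (cot_in0 h) (cot_in1 x) = cot_in1 (lact (arrow_bimod E) h x)"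
    if x: "x \<in> coord_space (esc_arrows E)"
    by (rule bilin_eq_on_coord[OF bilin_compose[OF bilin_cmul lin_cot_in(1) lin_cot_in(2)]
          lin_compose_bilin[OF lin_cot_in(2)] _ assms x])
      (auto simp: cot_in_eq w0 w1 cmul_path_word esc_arrows_iff)
  show "cmul E (cot_in1 x) (cot_in0 h) = cot_in1 (ract (arrow_bimod E) x h)"
    if x: "x \<in> coord_space (esc_arrows E)"
    by (rule bilin_eq_on_coord[OF bilin_compose[OF bilin_cmul lin_cot_in(2) lin_cot_in(1)]
          lin_compose_bilin[OF lin_cot_in(2)] _ x assms])
      (auto simp: cot_in_eq w0 w1 cmul_path_word esc_arrows_iff lin_scale[OF lin_emb] lin_scale[OF lin_basis_map])
qed

lemma cot_comult_in:
  "cot_comult (gralg E) (arrow_bimod E) (cot_in0 h) = tensor_map cot_in0 cot_in0 (bcomult (gralg E) h)"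
  "cot_comult (gralg E) (arrow_bimod E) (cot_in1 x) =
    tensor_map cot_in0 cot_in1 (lcoact (arrow_bimod E) x) + tensor_map cot_in1 cot_in0 (rcoact (arrow_bimod E) x)"
proof -
  have empty: "{0<..<Suc 0} = {}" by auto
  have lin: "lin (lcoact (arrow_bimod E))" "lin (rcoact (arrow_bimod E))" by (simp_all add: arrow_bimod_def)
  show "cot_comult (gralg E) (arrow_bimod E) (cot_in0 h) = tensor_map cot_in0 cot_in0 (bcomult (gralg E) h)"
    by (rule lin_eqI[OF lin_compose[OF lin_cot_comult lin_cot_in(1)] lin_compose[OF lin_tensor_map group_algebra_simps(7)]])
      (simp add: cot_in_eq cot_comult_Inl)
  show "cot_comult (gralg E) (arrow_bimod E) (cot_in1 x) =
    tensor_map cot_in0 cot_in1 (lcoact (arrow_bimod E) x) + tensor_map cot_in1 cot_in0 (rcoact (arrow_bimod E) x)"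
    by (rule lin_eqI[OF lin_compose[OF lin_cot_comult lin_cot_in(2)]
          lin_plus[OF lin_compose[OF lin_tensor_map lin(1)] lin_compose[OF lin_tensor_map lin(2)]]])
      (simp add: cot_in_eq cot_comult_Inr empty)
qed

lemma arrow_ad_act:
  "yact (arrow_ad E) (bvec g) x =
    ract (arrow_bimod E) (lact (arrow_bimod E) (bvec g) x) (bvec (inv\<^bsub>egrp E\<^esub> g))"
proof (rule lin_eqI[of "yact (arrow_ad E) (bvec g)"])
  show "lin (yact (arrow_ad E) (bvec g))"
    by (simp add: arrow_ad_def bilin_right)
  show "lin (\<lambda>x. ract (arrow_bimod E) (lact (arrow_bimod E) (bvec g) x) (bvec (inv\<^bsub>egrp E\<^esub> g)))"
    by (intro lin_compose[OF bilin_left bilin_right]) simp_all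
qed (simp add: arrow_ad_def)

lemma lact_closed:
  assumes "ESC E" "h \<in> coord_space (carrier (egrp E))" "x \<in> coord_space (esc_arrows E)"
  shows "lact (arrow_bimod E) h x \<in> coord_space (esc_arrows E)"
  by (rule bilin_in_coord[OF _ _ subspace_coord_space assms(2,3)]) (simp_all add: translate_arrow[OF assms(1)])

lemma lin_arrow_coact [simp]: "lin (lcoact (arrow_bimod E))" "lin (rcoact (arrow_bimod E))"
  by (simp_all add: arrow_bimod_def)

text \<open>
  The operator picks the arrows that start at \<open>1\<close>. This describes them through the right
  coaction, hence in terms that isomorphisms preserve.
\<close>

lemma yspace_arrow_ad_iff:
  fixes E :: "('g, 'i, 'k::field) esc"
  assumes "x \<in> coord_space (esc_arrows E)"
  shows "x \<in> yspace (arrow_ad E) \<longleftrightarrow> right_slice \<one>\<^bsub>egrp E\<^esub> (rcoact (arrow_bimod E) x) = x"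
    and "right_slice \<one>\<^bsub>egrp E\<^esub> (rcoact (arrow_bimod E) x) \<in> yspace (arrow_ad E)"
proof -
  let ?L = "{a \<in> esc_arrows E. asource a = \<one>\<^bsub>egrp E\<^esub>}"
  have Y: "yspace (arrow_ad E) = coord_space ?L" by (simp add: arrow_ad_def)
  show mem: "right_slice \<one>\<^bsub>egrp E\<^esub> (rcoact (arrow_bimod E) x) \<in> yspace (arrow_ad E)"
    unfolding Y
    by (rule lin_in_coord[OF lin_compose[OF lin_right_slice lin_arrow_coact(2)] _ subspace_coord_space assms])
      (simp add: pm.subspace_0[OF subspace_coord_space])
  show "x \<in> yspace (arrow_ad E) \<longleftrightarrow> right_slice \<one>\<^bsub>egrp E\<^esub> (rcoact (arrow_bimod E) x) = x"
  proof
    assume "x \<in> yspace (arrow_ad E)"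
    then have x: "x \<in> coord_space ?L" unfolding Y .
    show "right_slice \<one>\<^bsub>egrp E\<^esub> (rcoact (arrow_bimod E) x) = x"
    proof (rule lin_eq_on_coord[OF lin_compose[OF lin_right_slice lin_arrow_coact(2)] lin_ident _ x])
      fix a assume "a \<in> ?L"
      then show "right_slice \<one>\<^bsub>egrp E\<^esub> (rcoact (arrow_bimod E) (bvec a)) = bvec a" by simp
    qed
  next
    assume eq: "right_slice \<one>\<^bsub>egrp E\<^esub> (rcoact (arrow_bimod E) x) = x"
    show "x \<in> yspace (arrow_ad E)" by (rule mem[unfolded eq])
  qed
qed

text \<open>
  The restrictions \<open>\<phi>\<close> to degree 0 and \<open>F\<close> to degree 1 respect products and comultiplication. Products of
  elements of degrees 0 and 1 are the two actions on arrows, and the comultiplication in degree 1 is the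
  sum of the two coactions, so \<open>F\<close> is an isomorphism of Hopf bimodules along \<open>\<phi>\<close>.
\<close>

lemma graded_hopf_iso_imp_arrow_ad:
  fixes E :: "('g, 'i, 'k::field) esc" and E' :: "('h, 'j, 'k) esc"
  assumes E: "ESC E" and E': "ESC E'" and iso: "graded_hopf_iso (multiple_taft E) (multiple_taft E') f"
  shows "\<exists>\<phi>. hopf_iso (gralg E) (gralg E') \<phi> \<and>
    yd_isomorphic (gralg E) (arrow_ad E) (yd_twist (gralg E) \<phi> (arrow_ad E'))"
proof -
  let ?M = "arrow_bimod E" and ?M' = "arrow_bimod E'"
  let ?G = "coord_space (carrier (egrp E)) :: ('g, 'k) vec set" and ?G' = "coord_space (carrier (egrp E')) :: ('h, 'k) vec set"
  let ?A = "coord_space (esc_arrows E) :: (('g, 'i) arrow, 'k) vec set"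
  let ?A' = "coord_space (esc_arrows E') :: (('h, 'j) arrow, 'k) vec set"
  have linf: "lin f" and bijf: "bij_betw f (gen E) (gen E')"
    and mult: "\<And>x y. x \<in> gen E \<Longrightarrow> y \<in> gen E \<Longrightarrow> f (cot_mult (gralg E) ?M x y) = cot_mult (gralg E') ?M' (f x) (f y)"
    and one: "f (bvec (Inl \<one>\<^bsub>egrp E\<^esub>)) = bvec (Inl \<one>\<^bsub>egrp E'\<^esub>)"
    and comult: "\<And>x. x \<in> gen E \<Longrightarrow> cot_comult (gralg E') ?M' (f x) = tensor_map f f (cot_comult (gralg E) ?M x)"
    and counit: "\<And>x. x \<in> gen E \<Longrightarrow> bcounit (gralg E') (cot_pr0 (f x)) = bcounit (gralg E) (cot_pr0 x)"
    and deg: "\<And>n. f ` (gen E \<inter> cot_deg (gralg E) ?M n) = gen E' \<inter> cot_deg (gralg E') ?M' n"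
    using iso by (auto simp: graded_hopf_iso_def hopf_iso_def)
  have injf: "inj_on f (gen E)" using bijf by (simp add: bij_betw_def)
  have deg0: "f ` cot_in0 ` ?G = cot_in0 ` ?G'" and deg1: "f ` cot_in1 ` ?A = cot_in1 ` ?A'"
  proof -
    have "gen E \<inter> cot_deg (gralg E) ?M 0 = cot_in0 ` ?G" "gen E' \<inter> cot_deg (gralg E') ?M' 0 = cot_in0 ` ?G'"
      "gen E \<inter> cot_deg (gralg E) ?M 1 = cot_in1 ` ?A" "gen E' \<inter> cot_deg (gralg E') ?M' 1 = cot_in1 ` ?A'"
      using gen_in0 gen_in1 unfolding in0_deg[symmetric] in1_deg[symmetric] by auto
    then show "f ` cot_in0 ` ?G = cot_in0 ` ?G'" "f ` cot_in1 ` ?A = cot_in1 ` ?A'"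
      using deg[of 0] deg[of 1] by simp_all
  qed
  define \<phi> where "\<phi> h = cot_pr0 (f (cot_in0 h))" for h
  define F where "F x = cot_pr1 (f (cot_in1 x))" for x
  have lin\<phi>: "lin \<phi>" and linF: "lin F"
    unfolding \<phi>_def F_def by (intro lin_compose[OF _ lin_compose[OF linf]] lin_cot_pr0 lin_cot_pr1 lin_cot_in)+
  have f0: "f (cot_in0 h) = cot_in0 (\<phi> h)" "\<phi> h \<in> ?G'" if "h \<in> ?G" for h
  proof -
    have "f (cot_in0 h) \<in> cot_in0 ` ?G'" using deg0 that by blast
    then show "f (cot_in0 h) = cot_in0 (\<phi> h)" "\<phi> h \<in> ?G'" by (auto simp: \<phi>_def)
  qed
  have f1: "f (cot_in1 x) = cot_in1 (F x)" "F x \<in> ?A'" if "x \<in> ?A" for x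
  proof -
    have "f (cot_in1 x) \<in> cot_in1 ` ?A'" using deg1 that by blast
    then show "f (cot_in1 x) = cot_in1 (F x)" "F x \<in> ?A'" by (auto simp: F_def)
  qed
  have bij\<phi>: "bij_betw \<phi> ?G ?G'"
    unfolding bij_betw_def
  proof (intro conjI inj_onI equalityI subsetI)
    show "x = y" if "x \<in> ?G" "y \<in> ?G" "\<phi> x = \<phi> y" for x y
    proof -
      have "f (cot_in0 x) = f (cot_in0 y)" using that f0 by simp
      then have "cot_in0 x = (cot_in0 y :: ('g + ('g, 'i) arrow list, 'k) vec)"
        by (rule inj_onD[OF injf]) (simp_all add: gen_in0 that)
      then show ?thesis by (drule_tac arg_cong[of _ _ cot_pr0]) simp
    qed
    show "y \<in> \<phi> ` ?G" if "y \<in> ?G'" for y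
    proof -
      have "cot_in0 y \<in> f ` cot_in0 ` ?G" using deg0 that by blast
      then obtain x where x: "x \<in> ?G" "cot_in0 y = f (cot_in0 x)" by blast
      then have "y = \<phi> x" unfolding \<phi>_def by (simp flip: x(2))
      then show ?thesis using x by blast
    qed
  qed (use f0 in auto)
  have bijF: "bij_betw F ?A ?A'"
    unfolding bij_betw_def
  proof (intro conjI inj_onI equalityI subsetI)
    show "x = y" if "x \<in> ?A" "y \<in> ?A" "F x = F y" for x y
    proof -
      have "f (cot_in1 x) = f (cot_in1 y)" using that f1 by simp
      then have "cot_in1 x = (cot_in1 y :: ('g + ('g, 'i) arrow list, 'k) vec)"
        by (rule inj_onD[OF injf]) (simp_all add: gen_in1 that)
      then show ?thesis by (drule_tac arg_cong[of _ _ cot_pr1]) simp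
    qed
    show "y \<in> F ` ?A" if "y \<in> ?A'" for y
    proof -
      have "cot_in1 y \<in> f ` cot_in1 ` ?A" using deg1 that by blast
      then obtain x where x: "x \<in> ?A" "cot_in1 y = f (cot_in1 x)" by blast
      then have "y = F x" unfolding F_def by (simp flip: x(2))
      then show ?thesis using x by blast
    qed
  qed (use f1 in auto)
  have mult_in: "cot_mult (gralg E) ?M x y = cmul E x y" if "x \<in> gen E" "y \<in> gen E" for x y
    using that gen_subset[OF E] by (intro cot_mult_eq_cmul[OF E]) auto
  have mult_in': "cot_mult (gralg E') ?M' x y = cmul E' x y" if "x \<in> gen E'" "y \<in> gen E'" for x y
    using that gen_subset[OF E'] by (intro cot_mult_eq_cmul[OF E']) auto
  have \<phi>mult: "\<phi> (bmult (gralg E) x y) = bmult (gralg E') (\<phi> x) (\<phi> y)" if "x \<in> ?G" "y \<in> ?G" for x y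
  proof -
    have "f (cot_in0 (bmult (gralg E) x y)) = cot_in0 (bmult (gralg E') (\<phi> x) (\<phi> y))"
      using mult[OF gen_in0[OF that(1)] gen_in0[OF that(2)]] that f0
      by (simp add: mult_in mult_in' gen_in0 cmul_in)
    then show ?thesis by (simp add: \<phi>_def)
  qed
  have Flact: "F (lact ?M h x) = lact ?M' (\<phi> h) (F x)" if "h \<in> ?G" "x \<in> ?A" for h x
  proof -
    have "f (cot_in1 (lact ?M h x)) = cot_in1 (lact ?M' (\<phi> h) (F x))"
      using mult[OF gen_in0[OF that(1)] gen_in1[OF that(2)]] that f0 f1
      by (simp add: mult_in mult_in' gen_in0 gen_in1 cmul_in)
    then show ?thesis by (simp add: F_def)
  qed
  have Fract: "F (ract ?M x h) = ract ?M' (F x) (\<phi> h)" if "h \<in> ?G" "x \<in> ?A" for h x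
  proof -
    have "f (cot_in1 (ract ?M x h)) = cot_in1 (ract ?M' (F x) (\<phi> h))"
      using mult[OF gen_in1[OF that(2)] gen_in0[OF that(1)]] that f0 f1
      by (simp add: mult_in mult_in' gen_in0 gen_in1 cmul_in)
    then show ?thesis by (simp add: F_def)
  qed
  have "hopf_iso (gralg E) (gralg E') \<phi>"
    unfolding hopf_iso_def group_algebra_simps
  proof (intro conjI ballI lin\<phi> bij\<phi> \<phi>mult)
    show "\<phi> (bvec \<one>\<^bsub>egrp E\<^esub>) = bvec \<one>\<^bsub>egrp E'\<^esub>"
      using one by (simp add: \<phi>_def cot_in_eq)
    show "bcounit (gralg E') (\<phi> x) = bcounit (gralg E) x" if "x \<in> ?G" for x
      using counit[OF gen_in0[OF that]] by (simp add: \<phi>_def)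
    show "bcomult (gralg E') (\<phi> x) = tensor_map \<phi> \<phi> (bcomult (gralg E) x)" if "x \<in> ?G" for x
    proof -
      have "tensor_map cot_in0 cot_in0 (bcomult (gralg E') (\<phi> x)) =
          tensor_map f f (tensor_map cot_in0 cot_in0 (bcomult (gralg E) x))"
        using comult[OF gen_in0[OF that]] f0(1)[OF that] by (simp add: cot_comult_in)
      then have "tensor_map cot_pr0 cot_pr0 (tensor_map cot_in0 cot_in0 (bcomult (gralg E') (\<phi> x)) ::
            (('h + ('h, 'j) arrow list) \<times> ('h + ('h, 'j) arrow list), 'k) vec) =
          tensor_map cot_pr0 cot_pr0 (tensor_map f f (tensor_map cot_in0 cot_in0 (bcomult (gralg E) x)))"
        by simp
      moreover have "tensor_map (\<lambda>x. x) (\<lambda>x. x) z = z" for z :: "('h \<times> 'h, 'k) vec"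
        by (rule lin_eqI[OF lin_tensor_map lin_ident]) auto
      ultimately show ?thesis
        by (simp add: tensor_map_compose linf lin_compose \<phi>_def[abs_def])
    qed
  qed
  then obtain \<psi> where "group_algebra_iso (egrp E) (egrp E') \<phi> \<psi>"
    using hopf_iso_imp_group_algebra_iso[OF ESC_group[OF E] ESC_group[OF E']] by blast
  then interpret group_algebra_iso "egrp E" "egrp E'" \<phi> \<psi> .
  interpret G: group "egrp E" by (rule ESC_group[OF E])
  interpret G': group "egrp E'" by (rule ESC_group[OF E'])
  interpret gh: group_hom "egrp E" "egrp E'" \<psi>
    using hom_psi by unfold_locales
  let ?W = "yspace (arrow_ad E) :: (('g, 'i) arrow, 'k) vec set"
  let ?W' = "yspace (arrow_ad E') :: (('h, 'j) arrow, 'k) vec set"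
  have WA: "?W \<subseteq> ?A" "?W' \<subseteq> ?A'"
    unfolding arrow_ad_def yd_mod.simps by (rule coord_space_mono; blast)+
  have lcoactF: "lcoact ?M' (F x) = tensor_map \<phi> F (lcoact ?M x)"
    and rcoactF: "rcoact ?M' (F x) = tensor_map F \<phi> (rcoact ?M x)" if x: "x \<in> ?A" for x
  proof -
    let ?z = "tensor_map (\<lambda>h. f (cot_in0 h)) (\<lambda>x. f (cot_in1 x)) (lcoact ?M x) +
        tensor_map (\<lambda>x. f (cot_in1 x)) (\<lambda>h. f (cot_in0 h)) (rcoact ?M x)"
    have z: "tensor_map cot_in0 cot_in1 (lcoact ?M' (F x)) + tensor_map cot_in1 cot_in0 (rcoact ?M' (F x)) = ?z"
      using comult[OF gen_in1[OF x]] f1(1)[OF x]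
      by (simp add: cot_comult_in lin_add[OF lin_tensor_map] tensor_map_compose linf)
    \<comment> \<open>\<open>f\<close> preserves degrees, so projecting to degrees \<open>(0, 1)\<close> or \<open>(1, 0)\<close> separates the coactions\<close>
    have pr0f1: "cot_pr0 (f (cot_in1 y)) = 0" if "y \<in> ?A" for y
      using f1(1)[OF that] by simp
    have pr1f0: "cot_pr1 (f (cot_in0 h)) = 0" if "h \<in> ?G" for h
      using f0(1)[OF that] by simp
    have ident: "tensor_map (\<lambda>x. x) (\<lambda>x. x) w = w" for w :: "('a \<times> 'b, 'k) vec"
      by (rule lin_eqI[OF lin_tensor_map lin_ident]) auto
    have "lcoact ?M x \<in> coord_space (carrier (egrp E) \<times> esc_arrows E)"
      by (rule lin_in_coord[OF lin_arrow_coact(1) _ subspace_coord_space x]) (simp add: arrow_target_closed[OF E])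
    then have "tensor_map (\<lambda>h. cot_pr1 (f (cot_in0 h))) (\<lambda>x. cot_pr0 (f (cot_in1 x))) (lcoact ?M x) =
        tensor_map (\<lambda>_. 0) (\<lambda>_. 0) (lcoact ?M x)"
      by (rule tensor_map_cong_coord[rotated 2]) (simp_all add: pr0f1 pr1f0)
    then show "rcoact ?M' (F x) = tensor_map F \<phi> (rcoact ?M x)"
      using arg_cong[OF z, of "tensor_map cot_pr1 cot_pr0"]
      by (simp add: lin_add[OF lin_tensor_map] tensor_map_compose tensor_map_zero ident
          \<phi>_def[abs_def] F_def[abs_def])
    have "rcoact ?M x \<in> coord_space (esc_arrows E \<times> carrier (egrp E))"
      by (rule lin_in_coord[OF lin_arrow_coact(2) _ subspace_coord_space x]) (simp add: esc_arrows_iff)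
    then have "tensor_map (\<lambda>x. cot_pr0 (f (cot_in1 x))) (\<lambda>h. cot_pr1 (f (cot_in0 h))) (rcoact ?M x) =
        tensor_map (\<lambda>_. 0) (\<lambda>_. 0) (rcoact ?M x)"
      by (rule tensor_map_cong_coord[rotated 2]) (simp_all add: pr0f1 pr1f0)
    then show "lcoact ?M' (F x) = tensor_map \<phi> F (lcoact ?M x)"
      using arg_cong[OF z, of "tensor_map cot_pr0 cot_pr1"]
      by (simp add: lin_add[OF lin_tensor_map] tensor_map_compose tensor_map_zero ident
          \<phi>_def[abs_def] F_def[abs_def])
  qed
  have source: "\<psi> g = \<one>\<^bsub>egrp E'\<^esub> \<longleftrightarrow> g = \<one>\<^bsub>egrp E\<^esub>" if "g \<in> carrier (egrp E)" for g
    using inj_onD[OF bij_betw_imp_inj_on[OF bij_psi], of g "\<one>\<^bsub>egrp E\<^esub>"] that by auto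
  have FP: "F (right_slice \<one>\<^bsub>egrp E\<^esub> (rcoact ?M x)) = right_slice \<one>\<^bsub>egrp E'\<^esub> (rcoact ?M' (F x))" if x: "x \<in> ?A" for x
  proof -
    have "F (right_slice \<one>\<^bsub>egrp E\<^esub> (rcoact ?M x)) = right_slice \<one>\<^bsub>egrp E'\<^esub> (tensor_map F \<phi> (rcoact ?M x))"
    proof (rule lin_eq_on_coord[OF lin_compose[OF linF lin_compose[OF lin_right_slice lin_arrow_coact(2)]]
            lin_compose[OF lin_right_slice lin_compose[OF lin_tensor_map lin_arrow_coact(2)]] _ x])
      fix a assume "a \<in> esc_arrows E"
      then have "asource a \<in> carrier (egrp E)" by (simp add: esc_arrows_iff)
      then show "F (right_slice \<one>\<^bsub>egrp E\<^esub> (rcoact ?M (bvec a))) =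
          right_slice \<one>\<^bsub>egrp E'\<^esub> (tensor_map F \<phi> (rcoact ?M (bvec a)))"
        by (simp add: phi_bvec right_slice_tensor_bvec source lin_0[OF linF])
    qed
    then show ?thesis by (simp add: rcoactF[OF x])
  qed
  have bijW: "bij_betw F ?W ?W'"
  proof (rule bij_betw_subset[OF bijF WA(1)], intro equalityI subsetI)
    fix y assume "y \<in> F ` ?W"
    then obtain x where x: "x \<in> ?W" "x \<in> ?A" "y = F x" using WA by blast
    then show "y \<in> ?W'"
      using FP[OF x(2)] yspace_arrow_ad_iff(1)[OF x(2)] yspace_arrow_ad_iff(1)[OF f1(2)[OF x(2)]] by simp
  next
    fix y assume y: "y \<in> ?W'"
    then have "y \<in> F ` ?A" unfolding bij_betw_imp_surj_on[OF bijF] using WA(2) by blast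
    then obtain x where x: "x \<in> ?A" "y = F x" by blast
    let ?x = "right_slice \<one>\<^bsub>egrp E\<^esub> (rcoact ?M x)"
    have eq: "F ?x = F x"
      using FP[OF x(1)] yspace_arrow_ad_iff(1)[OF f1(2)[OF x(1)]] y x(2) by simp
    have "?x \<in> ?W" by (rule yspace_arrow_ad_iff(2)[OF x(1)])
    then have "F ?x \<in> F ` ?W" by (rule imageI)
    then show "y \<in> F ` ?W" unfolding eq x(2) .
  qed
  have bilin_ad: "bilin (yact (arrow_ad E))" "bilin (yact (arrow_ad E'))"
    using arrow_ad_eigenbasis[OF E] arrow_ad_eigenbasis[OF E'] by (simp_all add: yd_eigenbasis_def)
  have act: "F (yact (arrow_ad E) h x) = yact (arrow_ad E') (\<phi> h) (F x)" if h: "h \<in> ?G" and x: "x \<in> ?A" for h x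
  proof (rule lin_eq_on_coord[OF lin_compose[OF linF bilin_left[OF bilin_ad(1)]]
        lin_compose[OF bilin_left[OF bilin_ad(2)] lin\<phi>] _ h])
    fix g assume g: "g \<in> carrier (egrp E)"
    then have gi: "bvec g \<in> ?G" "bvec (inv\<^bsub>egrp E\<^esub> g) \<in> ?G" by simp_all
    have "F (yact (arrow_ad E) (bvec g) x) =
        ract ?M' (lact ?M' (\<phi> (bvec g)) (F x)) (\<phi> (bvec (inv\<^bsub>egrp E\<^esub> g)))"
      unfolding arrow_ad_act Fract[OF gi(2) lact_closed[OF E gi(1) x]] Flact[OF gi(1) x] ..
    also have "\<dots> = yact (arrow_ad E') (\<phi> (bvec g)) (F x)"
      using g by (simp add: phi_bvec arrow_ad_act)
    finally show "F (yact (arrow_ad E) (bvec g) x) = yact (arrow_ad E') (\<phi> (bvec g)) (F x)" .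
  qed
  have coact: "ycoact (yd_twist (gralg E) \<phi> (arrow_ad E')) (F x) = tensor_map id F (ycoact (arrow_ad E) x)"
    if x: "x \<in> ?A" for x
  proof -
    let ?inv = "inv_into ?G \<phi>"
    have "tensor_map ?inv id (tensor_map \<phi> F (lcoact ?M x)) = tensor_map id F (lcoact ?M x)"
    proof (rule lin_eq_on_coord[OF lin_compose[OF lin_tensor_map lin_compose[OF lin_tensor_map lin_arrow_coact(1)]]
            lin_compose[OF lin_tensor_map lin_arrow_coact(1)] _ x])
      fix a assume "a \<in> esc_arrows E"
      then have "atarget a \<in> carrier (egrp E)" by (rule arrow_target_closed[OF E])
      then show "tensor_map ?inv id (tensor_map \<phi> F (lcoact ?M (bvec a))) = tensor_map id F (lcoact ?M (bvec a))"
        by (simp add: phi_bvec tensor_map_tensor_bvec lin_id inv_phi_bvec)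
    qed
    then show ?thesis
      by (simp add: yd_twist_def arrow_ad_def lcoactF[OF x])
  qed
  have "yd_iso (gralg E) (arrow_ad E) (yd_twist (gralg E) \<phi> (arrow_ad E')) F"
    unfolding yd_iso_def
  proof (intro conjI ballI linF)
    show "bij_betw F ?W (yspace (yd_twist (gralg E) \<phi> (arrow_ad E')))"
      using bijW by (simp add: yd_twist_def)
    fix x assume "x \<in> ?W"
    then have x: "x \<in> ?A" using WA by blast
    show "ycoact (yd_twist (gralg E) \<phi> (arrow_ad E')) (F x) = tensor_map id F (ycoact (arrow_ad E) x)"
      by (rule coact[OF x])
    fix h assume "h \<in> bspace (gralg E)"
    then show "F (yact (arrow_ad E) h x) = yact (yd_twist (gralg E) \<phi> (arrow_ad E')) h (F x)"
      using act[OF _ x] by (simp add: yd_twist_def)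
  qed
  then show ?thesis using hopf unfolding yd_isomorphic_def by blast
qed

lemma ESC_isomorphic_iff_multiple_taft:
  fixes E :: "('g, 'i, 'k::field) esc" and E' :: "('h, 'j, 'k) esc"
  assumes E: "ESC E" and E': "ESC E'"
  shows "ESC_isomorphic E E' \<longleftrightarrow> graded_hopf_isomorphic (multiple_taft E) (multiple_taft E')"
proof
  assume "ESC_isomorphic E E'"
  then obtain \<psi> \<sigma> where "esc_iso E E' \<psi> \<sigma>" unfolding ESC_isomorphic_iff_esc_iso by blast
  then have "esc_isomorphism E E' \<psi> \<sigma>" using E E' by (simp add: esc_isomorphism_def)
  then show "graded_hopf_isomorphic (multiple_taft E) (multiple_taft E')"
    unfolding graded_hopf_isomorphic_def using multiple_taft_iso by blast
next
  assume "graded_hopf_isomorphic (multiple_taft E) (multiple_taft E')"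
  then show "ESC_isomorphic E E'"
    unfolding graded_hopf_isomorphic_def ESC_isomorphic_iff_arrow_ad[OF E E']
    using graded_hopf_iso_imp_arrow_ad[OF E E'] by blast
qed

theorem theorem4:
  fixes E :: "('g, 'i, 'k::field) esc" and E' :: "('h, 'j, 'k) esc"
    and Jr :: "'i set" and Jr' :: "'j set"
    and u :: "'g set \<Rightarrow> 'g" and u' :: "'h set \<Rightarrow> 'h"
  assumes "ESC E" and "ESC E'"
    and "esc_reps E Jr" and "esc_reps E' Jr'"
    and "\<forall>C\<in>conj_classes (egrp E). u C \<in> C"
    and "\<forall>C\<in>conj_classes (egrp E'). u' C \<in> C"
  shows "let kG = group_algebra (egrp E) :: ('g, 'k) bialg;
             kG' = group_algebra (egrp E') :: ('h, 'k) bialg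
    in all_equivalent
     [ESC_isomorphic E E',
      CRSC_isomorphic (rsc_of_esc E Jr u) (rsc_of_esc E' Jr' u'),
      \<exists>\<phi>. hopf_iso kG kG' \<phi> \<and> yd_isomorphic kG (yd_V E) (yd_twist kG \<phi> (yd_V E')),
      \<exists>\<phi>. hopf_iso kG kG' \<phi> \<and>
        braided_isomorphic kG (nichols kG (yd_V E)) (braided_twist kG \<phi> (nichols kG' (yd_V E'))),
      \<exists>\<phi>. hopf_iso kG kG' \<phi> \<and> yd_isomorphic kG (arrow_ad E) (yd_twist kG \<phi> (arrow_ad E')),
      graded_hopf_isomorphic (multiple_taft E) (multiple_taft E')]"
  unfolding Let_def all_equivalent_def
    ESC_isomorphic_iff_CRSC[OF assms, symmetric]
    ESC_isomorphic_iff_yd_V[OF assms(1,2), symmetric]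
    ESC_isomorphic_iff_nichols[OF assms(1,2), symmetric]
    ESC_isomorphic_iff_arrow_ad[OF assms(1,2), symmetric]
    ESC_isomorphic_iff_multiple_taft[OF assms(1,2), symmetric]
  by simp

end
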